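(* Let $\xi:C([0,T];\mathbb R^d)\to\mathbb R$ be continuous (for the supremum norm) and bounded. Let $u,w:\boldsymbol\Lambda\to\mathbb R$ be respectively upper and lower semicontinuous (with respect to $d_\infty$), satisfying $\sup u<+\infty$ and $\inf w>-\infty$. Suppose that $u$ (resp. $w$) is a (path-dependent) viscosity subsolution (resp. supersolution) of the path-dependent heat equation $$\begin{cases}\partial_t^Hu(t,\boldsymbol x)+\frac12\mathrm{tr}\big[\partial^V_{\boldsymbol x\boldsymbol x}u(t,\boldsymbol x)\big]=0,&(t,\boldsymbol x)\in[0,T)\times C([0,T];\mathbb R^d),\\ u(T,\boldsymbol x)=\xi(\boldsymbol x),&\boldsymbol x\in C([0,T];\mathbb R^d).\end{cases}$$ Then $u\le w$ on $\boldsymbol\Lambda$.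
   Context: Fix $T>0$ and $d\in\mathbb N$, $d\ge1$. $D([0,T];\mathbb R^d)$ is the set of c\`adl\`ag functions $\boldsymbol{\hat x}:[0,T]\to\mathbb R^d$ and $C([0,T];\mathbb R^d)$ the subset of continuous functions; $\|\cdot\|_\infty$ is the supremum norm (with $|\cdot|$ the Euclidean norm on $\mathbb R^d$), and $\boldsymbol{\hat x}(\cdot\wedge t)$ is the path $s\mapsto\boldsymbol{\hat x}(s\wedge t)$. Set $\boldsymbol{\hat\Lambda}=[0,T]\times D([0,T];\mathbb R^d)$ and $\boldsymbol\Lambda=[0,T]\times C([0,T];\mathbb R^d)$. $\boldsymbol{\hat\Lambda}$ is endowed with the pseudometric $\hat d_\infty((t,\boldsymbol{\hat x}),(t',\boldsymbol{\hat x}'))=|t-t'|+\|\boldsymbol{\hat x}(\cdot\wedge t)-\boldsymbol{\hat x}'(\cdot\wedge t')\|_\infty$, and $\boldsymbol\Lambda$ with its restriction $d_\infty$; continuity and semicontinuity are with respect to these. A map $\hat u:\boldsymbol{\hat\Lambda}\to\mathbb R$ is non-anticipative if $\hat u(t,\boldsymbol{\hat x})=\hat u(t,\boldsymbol{\hat x}(\cdot\wedge t))$ for all $(t,\boldsymbol{\hat x})$ (automatic if $\hat u$ is continuous). For non-anticipative $\hat u$: the horizontal derivative is $\partial_t^H\hat u(t,\boldsymbol{\hat x})=\lim_{\delta\to0^+}\frac{\hat u(t+\delta,\boldsymbol{\hat x}(\cdot\wedge t))-\hat u(t,\boldsymbol{\hat x})}{\delta}$ for $t<T$, and $\partial_t^H\hat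 u(T,\boldsymbol{\hat x})=\lim_{t\to T^-}\partial_t^H\hat u(t,\boldsymbol{\hat x})$; the vertical derivatives are $\partial^V_{x_i}\hat u(t,\boldsymbol{\hat x})=\lim_{h\to0}\frac{\hat u(t,\boldsymbol{\hat x}+h\mathbf e_i1_{[t,T]})-\hat u(t,\boldsymbol{\hat x})}{h}$ and $\partial^V_{x_ix_j}\hat u=\partial^V_{x_j}(\partial^V_{x_i}\hat u)$, where $\mathbf e_1,\dots,\mathbf e_d$ is the standard basis; $\partial^V_{\boldsymbol x}\hat u=(\partial^V_{x_i}\hat u)_i$, $\partial^V_{\boldsymbol x\boldsymbol x}\hat u=(\partial^V_{x_ix_j}\hat u)_{i,j}$. $\boldsymbol C^{1,2}(\boldsymbol{\hat\Lambda})$ is the set of continuous $\hat u:\boldsymbol{\hat\Lambda}\to\mathbb R$ such that $\partial_t^H\hat u,\partial^V_{\boldsymbol x}\hat u,\partial^V_{\boldsymbol x\boldsymbol x}\hat u$ exist everywhere on $\boldsymbol{\hat\Lambda}$ and are continuous. A map $\varphi:\boldsymbol\Lambda\to\mathbb R$ belongs to $\boldsymbol C^{1,2}(\boldsymbol\Lambda)$ if there is $\hat\varphi\in\boldsymbol C^{1,2}(\boldsymbol{\hat\Lambda})$ with $\hat\varphi=\varphi$ on $\boldsymbol\Lambda$; its pathwise derivatives are the restrictions to $\boldsymbol\Lambda$ of those of $\hat\varphi$ (independent of the choice of $\hat\varphi$). $\boldsymbol C^{1,2}_{\mathrm{pol}}(\boldsymbol\Lambda)$ is the set of $\varphi\in\boldsymbol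 C^{1,2}(\boldsymbol\Lambda)$ such that $\varphi,\partial_t^H\varphi,\partial^V_{\boldsymbol x}\varphi,\partial^V_{\boldsymbol x\boldsymbol x}\varphi$ satisfy a polynomial growth condition (i.e. are bounded in norm by $K(1+\|\boldsymbol x\|_\infty^q)$ for some constants $K,q>0$). An upper semicontinuous $u:\boldsymbol\Lambda\to\mathbb R$ is a viscosity subsolution of the path-dependent heat equation with terminal condition $\xi$ if $u(T,\cdot)\le\xi$ and, for any $(t,\boldsymbol x)\in[0,T)\times C([0,T];\mathbb R^d)$ and $\varphi\in\boldsymbol C^{1,2}_{\mathrm{pol}}(\boldsymbol\Lambda)$ with $(u-\varphi)(t,\boldsymbol x)=\sup_{\boldsymbol\Lambda}(u-\varphi)$, one has $-\partial_t^H\varphi(t,\boldsymbol x)-\frac12\mathrm{tr}[\partial^V_{\boldsymbol x\boldsymbol x}\varphi(t,\boldsymbol x)]\le0$. A lower semicontinuous $u$ is a viscosity supersolution if $u(T,\cdot)\ge\xi$ and, for any such $(t,\boldsymbol x)$ and $\varphi$ with $(u-\varphi)(t,\boldsymbol x)=\inf_{\boldsymbol\Lambda}(u-\varphi)$, one has $-\partial_t^H\varphi(t,\boldsymbol x)-\frac12\mathrm{tr}[\partial^V_{\boldsymbol x\boldsymbol x}\varphi(t,\boldsymbol x)]\ge0$. *)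

theory Defs
  imports "HOL-Analysis.Analysis"
begin

text \<open>
  The dimension \<open>d \<ge> 1\<close> is the cardinality of the finite index type \<open>'n\<close>.  A path on \<open>[0,T]\<close> is a
  function that is \<open>undefined\<close> outside \<open>[0,T]\<close> (\<open>extensional\<close>), so that two paths agreeing on
  \<open>[0,T]\<close> are equal.  Path functionals are total HOL functions of which only the values on
  \<open>[0,T] \<times> D([0,T])\<close>, respectively \<open>[0,T] \<times> C([0,T])\<close>, are ever used.
\<close>

type_synonym 'n path = "real \<Rightarrow> real ^ 'n"

definition cadlag_paths :: "real \<Rightarrow> ('n::finite) path set" where
  "cadlag_paths T = {x \<in> extensional {0..T}.
     (\<forall>t\<in>{0..<T}. (x \<longlongrightarrow> x t) (at_right t)) \<and> (\<forall>t\<in>{0<..T}. \<exists>l. (x \<longlongrightarrow> l) (at_left t))}"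

definition cont_paths :: "real \<Rightarrow> ('n::finite) path set" where
  "cont_paths T = {x \<in> extensional {0..T}. continuous_on {0..T} x}"

definition Lambda_hat :: "real \<Rightarrow> (real \<times> ('n::finite) path) set" where
  "Lambda_hat T = {0..T} \<times> cadlag_paths T"

definition Lambda :: "real \<Rightarrow> (real \<times> ('n::finite) path) set" where
  "Lambda T = {0..T} \<times> cont_paths T"

definition sup_norm :: "real \<Rightarrow> ('n::finite) path \<Rightarrow> real" where
  "sup_norm T x = (SUP s\<in>{0..T}. norm (x s))"

definition sup_dist :: "real \<Rightarrow> ('n::finite) path \<Rightarrow> 'n path \<Rightarrow> real" where
  "sup_dist T x y = sup_norm T (\<lambda>s. x s - y s)"

definition stopped :: "real \<Rightarrow> real \<Rightarrow> ('n::finite) path \<Rightarrow> 'n path" where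
  "stopped T t x = (\<lambda>s\<in>{0..T}. x (min s t))"

definition bumped :: "real \<Rightarrow> real \<Rightarrow> real ^ 'n \<Rightarrow> ('n::finite) path \<Rightarrow> 'n path" where
  "bumped T t v x = (\<lambda>s\<in>{0..T}. x s + indicator {t..T} s *\<^sub>R v)"

definition d_inf :: "real \<Rightarrow> real \<times> ('n::finite) path \<Rightarrow> real \<times> 'n path \<Rightarrow> real" where
  "d_inf T = (\<lambda>(t, x) (t', x'). \<bar>t - t'\<bar> + sup_dist T (stopped T t x) (stopped T t' x'))"

text \<open>
  \<open>d_inf\<close> is only a pseudometric, so continuity and semicontinuity are spelled out for a set with
  a distance function.
\<close>

definition cont_wrt :: "('p \<Rightarrow> 'p \<Rightarrow> real) \<Rightarrow> 'p set \<Rightarrow> ('p \<Rightarrow> 'b::metric_space) \<Rightarrow> bool" where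
  "cont_wrt d S f \<longleftrightarrow> (\<forall>p\<in>S. \<forall>\<epsilon>>0. \<exists>\<delta>>0. \<forall>q\<in>S. d p q < \<delta> \<longrightarrow> dist (f q) (f p) < \<epsilon>)"

definition usc_wrt :: "('p \<Rightarrow> 'p \<Rightarrow> real) \<Rightarrow> 'p set \<Rightarrow> ('p \<Rightarrow> real) \<Rightarrow> bool" where
  "usc_wrt d S f \<longleftrightarrow> (\<forall>p\<in>S. \<forall>\<epsilon>>0. \<exists>\<delta>>0. \<forall>q\<in>S. d p q < \<delta> \<longrightarrow> f q < f p + \<epsilon>)"

definition lsc_wrt :: "('p \<Rightarrow> 'p \<Rightarrow> real) \<Rightarrow> 'p set \<Rightarrow> ('p \<Rightarrow> real) \<Rightarrow> bool" where
  "lsc_wrt d S f \<longleftrightarrow> (\<forall>p\<in>S. \<forall>\<epsilon>>0. \<exists>\<delta>>0. \<forall>q\<in>S. d p q < \<delta> \<longrightarrow> f q > f p - \<epsilon>)"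

text \<open>
  Pathwise derivatives are introduced relationally, in the style of \<open>has_field_derivative\<close>: the
  second functional is the derivative of the first everywhere on \<open>Lambda_hat T\<close>.  The values of
  the derivative there are unique, being limits.
\<close>

definition has_horizontal_derivative ::
  "real \<Rightarrow> (real \<times> ('n::finite) path \<Rightarrow> real) \<Rightarrow> (real \<times> 'n path \<Rightarrow> real) \<Rightarrow> bool" where
  "has_horizontal_derivative T u a \<longleftrightarrow>
     (\<forall>x\<in>cadlag_paths T.
        (\<forall>t\<in>{0..<T}. ((\<lambda>\<delta>. (u (t + \<delta>, stopped T t x) - u (t, x)) / \<delta>) \<longlongrightarrow> a (t, x)) (at_right 0)) \<and>
        ((\<lambda>t. a (t, x)) \<longlongrightarrow> a (T, x)) (at_left T))"

definition has_vertical_derivative ::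
  "real \<Rightarrow> 'n \<Rightarrow> (real \<times> ('n::finite) path \<Rightarrow> real) \<Rightarrow> (real \<times> 'n path \<Rightarrow> real) \<Rightarrow> bool" where
  "has_vertical_derivative T i u b \<longleftrightarrow>
     (\<forall>(t, x)\<in>Lambda_hat T.
        ((\<lambda>h. (u (t, bumped T t (h *\<^sub>R axis i 1) x) - u (t, x)) / h) \<longlongrightarrow> b (t, x)) (at 0))"

text \<open>
  \<open>C12_hat T u a b c\<close>: \<open>u\<close> is of class \<open>C\<^sup>1\<^sup>,\<^sup>2\<close> on \<open>Lambda_hat T\<close>, with horizontal derivative \<open>a\<close>,
  vertical gradient \<open>b\<close> and vertical Hessian \<open>c\<close>.  Non-anticipativity of \<open>u\<close> need not be required:
  it follows from continuity, as \<open>(t, x)\<close> and \<open>(t, stopped T t x)\<close> have distance \<open>0\<close>.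
\<close>

definition C12_hat :: "real \<Rightarrow> (real \<times> ('n::finite) path \<Rightarrow> real) \<Rightarrow> (real \<times> 'n path \<Rightarrow> real) \<Rightarrow>
    (real \<times> 'n path \<Rightarrow> real ^ 'n) \<Rightarrow> (real \<times> 'n path \<Rightarrow> real ^ 'n ^ 'n) \<Rightarrow> bool" where
  "C12_hat T u a b c \<longleftrightarrow>
     has_horizontal_derivative T u a \<and>
     (\<forall>i. has_vertical_derivative T i u (\<lambda>p. b p $ i)) \<and>
     (\<forall>i j. has_vertical_derivative T j (\<lambda>p. b p $ i) (\<lambda>p. c p $ i $ j)) \<and>
     cont_wrt (d_inf T) (Lambda_hat T) u \<and>
     cont_wrt (d_inf T) (Lambda_hat T) a \<and>
     cont_wrt (d_inf T) (Lambda_hat T) b \<and>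
     cont_wrt (d_inf T) (Lambda_hat T) c"

text \<open>
  \<open>C12 T \<phi> a b c\<close>: \<open>\<phi>\<close> is of class \<open>C\<^sup>1\<^sup>,\<^sup>2\<close> on \<open>Lambda T\<close>, with pathwise derivatives \<open>a\<close>, \<open>b\<close>, \<open>c\<close>
  inherited from some \<open>C\<^sup>1\<^sup>,\<^sup>2\<close> extension.  Since they do not depend on the extension, the relation
  determines \<open>a\<close>, \<open>b\<close>, \<open>c\<close> on \<open>Lambda T\<close>.
\<close>

definition C12 :: "real \<Rightarrow> (real \<times> ('n::finite) path \<Rightarrow> real) \<Rightarrow> (real \<times> 'n path \<Rightarrow> real) \<Rightarrow>
    (real \<times> 'n path \<Rightarrow> real ^ 'n) \<Rightarrow> (real \<times> 'n path \<Rightarrow> real ^ 'n ^ 'n) \<Rightarrow> bool" where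
  "C12 T \<phi> a b c \<longleftrightarrow>
     (\<exists>\<phi>' a' b' c'. C12_hat T \<phi>' a' b' c' \<and>
        (\<forall>p\<in>Lambda T. \<phi>' p = \<phi> p \<and> a' p = a p \<and> b' p = b p \<and> c' p = c p))"

definition poly_growth :: "real \<Rightarrow> (real \<times> ('n::finite) path \<Rightarrow> 'b::real_normed_vector) \<Rightarrow> bool" where
  "poly_growth T f \<longleftrightarrow>
     (\<exists>K>0. \<exists>q>0. \<forall>(t, x)\<in>Lambda T. norm (f (t, x)) \<le> K * (1 + sup_norm T x powr q))"

definition C12_pol :: "real \<Rightarrow> (real \<times> ('n::finite) path \<Rightarrow> real) \<Rightarrow> (real \<times> 'n path \<Rightarrow> real) \<Rightarrow>
    (real \<times> 'n path \<Rightarrow> real ^ 'n) \<Rightarrow> (real \<times> 'n path \<Rightarrow> real ^ 'n ^ 'n) \<Rightarrow> bool" where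
  "C12_pol T \<phi> a b c \<longleftrightarrow>
     C12 T \<phi> a b c \<and> poly_growth T \<phi> \<and> poly_growth T a \<and> poly_growth T b \<and> poly_growth T c"

text \<open>
  The supremum and infimum over \<open>Lambda T\<close> are taken in \<open>ereal\<close>, where they always exist.
\<close>

definition viscosity_subsolution ::
  "real \<Rightarrow> (('n::finite) path \<Rightarrow> real) \<Rightarrow> (real \<times> 'n path \<Rightarrow> real) \<Rightarrow> bool" where
  "viscosity_subsolution T \<xi> u \<longleftrightarrow>
     usc_wrt (d_inf T) (Lambda T) u \<and>
     (\<forall>x\<in>cont_paths T. u (T, x) \<le> \<xi> x) \<and>
     (\<forall>t\<in>{0..<T}. \<forall>x\<in>cont_paths T. \<forall>\<phi> a b c.
        C12_pol T \<phi> a b c \<longrightarrow>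
        ereal (u (t, x) - \<phi> (t, x)) = (SUP p\<in>Lambda T. ereal (u p - \<phi> p)) \<longrightarrow>
        - a (t, x) - 1 / 2 * trace (c (t, x)) \<le> 0)"

definition viscosity_supersolution ::
  "real \<Rightarrow> (('n::finite) path \<Rightarrow> real) \<Rightarrow> (real \<times> 'n path \<Rightarrow> real) \<Rightarrow> bool" where
  "viscosity_supersolution T \<xi> u \<longleftrightarrow>
     lsc_wrt (d_inf T) (Lambda T) u \<and>
     (\<forall>x\<in>cont_paths T. u (T, x) \<ge> \<xi> x) \<and>
     (\<forall>t\<in>{0..<T}. \<forall>x\<in>cont_paths T. \<forall>\<phi> a b c.
        C12_pol T \<phi> a b c \<longrightarrow>
        ereal (u (t, x) - \<phi> (t, x)) = (INF p\<in>Lambda T. ereal (u p - \<phi> p)) \<longrightarrow>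
        - a (t, x) - 1 / 2 * trace (c (t, x)) \<ge> 0)"

end

theory Submission imports Defs "HOL-Complex_Analysis.Great_Picard"
begin

text \<open>
  Write \<open>L = \<partial>\<^sub>t + (1/2) tr \<partial>\<^sub>x\<^sub>x\<close> for the heat operator built from the horizontal and the vertical
  derivatives. The comparison of \<open>u\<close> with \<open>w\<close> is reduced to the comparison of each of them with
  explicit smooth solutions \<open>v\<close> of \<open>L v = 0\<close>: if the terminal value of \<open>v\<close> is close to \<open>\<xi>\<close>, then
  \<open>u \<le> v\<close> and \<open>v \<le> w\<close> up to a small error.

  Exact solutions are abundant. For continuous \<open>\<eta>\<close>, the functional \<open>\<integral> \<eta> \<bullet> x\<close> evaluated at the
  path frozen at time \<open>t\<close> does not move horizontally, and its vertical gradient is the integral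
  \<open>f t\<close> of \<open>\<eta>\<close> over \<open>[t, T]\<close>. Hence the cosine of it, times the exponential of minus one half of
  the integral of \<open>|f|\<^sup>2\<close> over \<open>[t, T]\<close>, is annihilated by \<open>L\<close> (\<open>cosine_heat_solution\<close>). The
  terminal values so obtained span an algebra that separates continuous paths, so that they
  approximate \<open>\<xi>\<close> uniformly on every compact set of paths (\<open>trig_dense\<close>).

  A subsolution stays below a smooth supersolution \<open>\<phi>\<close> that dominates it at time \<open>T\<close>
  (\<open>comparison_smooth\<close>). The usual argument looks at a maximum of \<open>u - \<phi> - \<mu> (T - t)\<close>, which
  need not exist, since path space is not locally compact. It is produced by subtracting a small
  smooth functional with small vertical Hessian (\<open>perturbed_maximum\<close>): penalties on the
  oscillation at finer and finer scales are added one after the other, each vanishing at the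
  near-maximizer found so far; the near-maximizers are then equicontinuous and converge along a
  subsequence.

  Such penalties have to be smooth in the pathwise sense. The time axis is covered by a \<open>C\<^sup>1\<close>
  partition of unity at scale \<open>h\<close>, and the integrals \<open>y\<close> of these window functions against \<open>dx\<close>
  are small at all times if and, up to constants, only if the path oscillates little at that
  scale (\<open>window_modulus\<close>, \<open>window_small\<close>). The running maximum of \<open>|y|\<close> is not vertically
  differentiable, but it is comparable to a function of \<open>m = max |y|\<^sup>2\<close> and \<open>q = |y|\<^sup>2\<close> that is
  (\<open>gauge_fun\<close>, \<open>flat_C2_gauge\<close>). Since the windows sum to one, the derivatives of a penalty are
  bounded independently of \<open>h\<close> (\<open>flat_C2_pen\<close>), and infinitely many of them can be summed.

  The approximation of \<open>\<xi>\<close> holds on a compact set only, so a smooth functional is needed that is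
  a supersolution from shortly before a given point on, is small at this point, and is at least
  \<open>1\<close> at terminal paths that violate the oscillation bounds defining the compact set; it plays
  the part of the tightness of Wiener measure. It is a sum, over scales and windows, of the
  gauges corrected by multiples of \<open>A |y|\<^sup>2\<close> and \<open>A\<^sup>2\<close>, where \<open>A t\<close> is the quadratic variation
  that the window still expects after time \<open>t\<close> (\<open>smooth_martingale_bound\<close>, \<open>barrier_scale\<close>).
  Adding a multiple of the barrier to \<open>v\<close> gives \<open>u \<le> v\<close> up to a small error at the given point
  (\<open>subsolution_le_heat_solution\<close>). As \<open>- w\<close> is a subsolution for \<open>- \<xi>\<close>, the same applies to
  \<open>- w\<close> and \<open>- v\<close>, and the two inequalities add up.
\<close>

section \<open>Right-continuous paths with left limits\<close>

text \<open>
  Next to each point the one-sided limits serve as values of a step function, and bisection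
  glues these local approximations together.
\<close>

lemma regulated_step_approx:
  fixes f :: "real \<Rightarrow> 'a::banach"
  assumes R: "\<And>t. t \<in> {a..<b} \<Longrightarrow> \<exists>l. (f \<longlongrightarrow> l) (at_right t)"
    and L: "\<And>t. t \<in> {a<..b} \<Longrightarrow> \<exists>l. (f \<longlongrightarrow> l) (at_left t)"
    and ab: "a \<le> b" and e: "e > 0"
  shows "\<exists>g. g integrable_on {a..b} \<and> bounded (g ` {a..b}) \<and> (\<forall>s\<in>{a..b}. norm (f s - g s) \<le> e)"
proof -
  define P where "P c d \<longleftrightarrow> (a \<le> c \<and> d \<le> b \<longrightarrow> (\<exists>g. g integrable_on {c..d} \<and>
    bounded (g ` {c..d}) \<and> (\<forall>s\<in>{c..d}. norm (f s - g s) \<le> e)))" for c d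
  have "P a b"
  proof (rule Bolzano[OF ab])
    fix p q r assume pq: "P p q" and qr: "P q r" and le: "p \<le> q" "q \<le> r"
    show "P p r" unfolding P_def
    proof (intro impI)
      assume *: "a \<le> p \<and> r \<le> b"
      obtain g1 where g1: "g1 integrable_on {p..q}" "bounded (g1 ` {p..q})"
        "\<forall>s\<in>{p..q}. norm (f s - g1 s) \<le> e"
        using pq * le unfolding P_def by (meson order_trans)
      obtain g2 where g2: "g2 integrable_on {q..r}" "bounded (g2 ` {q..r})"
        "\<forall>s\<in>{q..r}. norm (f s - g2 s) \<le> e"
        using qr * le unfolding P_def by (meson order_trans)
      define g where "g s = (if s \<le> q then g1 s else g2 s)" for s
      have "g integrable_on {p..q}"
        by (rule integrable_eq[OF g1(1)]) (simp add: g_def)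
      moreover have "g integrable_on {q..r}"
        by (rule integrable_spike_finite[of "{q}", OF _ _ g2(1)]) (auto simp: g_def)
      ultimately have "g integrable_on {p..r}"
        using Henstock_Kurzweil_Integration.integrable_combine le by blast
      moreover have "bounded (g ` {p..r})"
        by (rule bounded_subset[OF bounded_Un[THEN iffD2, OF conjI[OF g1(2) g2(2)]]])
          (auto simp: g_def)
      moreover have "\<forall>s\<in>{p..r}. norm (f s - g s) \<le> e"
        using g1(3) g2(3) by (auto simp: g_def)
      ultimately show "\<exists>g. g integrable_on {p..r} \<and> bounded (g ` {p..r}) \<and>
        (\<forall>s\<in>{p..r}. norm (f s - g s) \<le> e)" by blast
    qed
  next
    fix t assume t: "a \<le> t" "t \<le> b"
    have "\<exists>d>0. \<exists>l. \<forall>s. t < s \<and> s < t + d \<and> s \<le> b \<longrightarrow> norm (f s - l) \<le> e"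
    proof (cases "t < b")
      case True
      then obtain l where "(f \<longlongrightarrow> l) (at_right t)" using R t by auto
      then have "eventually (\<lambda>s. dist (f s) l < e) (at_right t)" using e by (rule tendstoD)
      then obtain c where "c > t" "\<forall>s>t. s < c \<longrightarrow> dist (f s) l < e"
        unfolding eventually_at_right_field by auto
      then show ?thesis
        by (intro exI[of _ "c - t"] conjI exI[of _ l]) (auto simp: dist_norm less_imp_le)
    next
      case False then show ?thesis using t by (intro exI[of _ 1]) auto
    qed
    then obtain d1 lr where d1: "d1 > 0" "\<And>s. t < s \<Longrightarrow> s < t + d1 \<Longrightarrow> s \<le> b \<Longrightarrow> norm (f s - lr) \<le> e"
      by blast
    have "\<exists>d>0. \<exists>l. \<forall>s. s < t \<and> t - d < s \<and> a \<le> s \<longrightarrow> norm (f s - l) \<le> e"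
    proof (cases "a < t")
      case True
      then obtain l where "(f \<longlongrightarrow> l) (at_left t)" using L t by auto
      then have "eventually (\<lambda>s. dist (f s) l < e) (at_left t)" using e by (rule tendstoD)
      then obtain c where "c < t" "\<forall>s>c. s < t \<longrightarrow> dist (f s) l < e"
        unfolding eventually_at_left_field by auto
      then show ?thesis
        by (intro exI[of _ "t - c"] conjI exI[of _ l]) (auto simp: dist_norm less_imp_le)
    next
      case False then show ?thesis using t by (intro exI[of _ 1]) auto
    qed
    then obtain d2 ll where d2: "d2 > 0" "\<And>s. s < t \<Longrightarrow> t - d2 < s \<Longrightarrow> a \<le> s \<Longrightarrow> norm (f s - ll) \<le> e"
      by blast
    show "\<exists>d>0. \<forall>p q. p \<le> t \<and> t \<le> q \<and> q - p < d \<longrightarrow> P p q"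
    proof (intro exI[of _ "min d1 d2"] conjI allI impI)
      show "min d1 d2 > 0" using d1 d2 by simp
      fix p q assume pq: "p \<le> t \<and> t \<le> q \<and> q - p < min d1 d2"
      show "P p q" unfolding P_def
      proof (intro impI)
        assume *: "a \<le> p \<and> q \<le> b"
        define g where "g s = (if s < t then ll else if s = t then f t else lr)" for s
        have "g integrable_on {p..t}"
          by (rule integrable_spike_finite[of "{t}", OF _ _ integrable_const_ivl[of ll]]) (auto simp: g_def)
        moreover have "g integrable_on {t..q}"
          by (rule integrable_spike_finite[of "{t}", OF _ _ integrable_const_ivl[of lr]]) (auto simp: g_def)
        ultimately have "g integrable_on {p..q}"
          using Henstock_Kurzweil_Integration.integrable_combine pq by blast
        moreover have "bounded (g ` {p..q})"
          by (rule bounded_subset[of "{ll, f t, lr}"]) (auto simp: g_def)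
        moreover have "\<forall>s\<in>{p..q}. norm (f s - g s) \<le> e"
          using d1(2) d2(2) pq * e by (auto simp: g_def)
        ultimately show "\<exists>g. g integrable_on {p..q} \<and> bounded (g ` {p..q}) \<and>
          (\<forall>s\<in>{p..q}. norm (f s - g s) \<le> e)" by blast
      qed
    qed
  qed
  then show ?thesis by (simp add: P_def)
qed

lemma regulated_integrable_bounded:
  fixes f :: "real \<Rightarrow> 'a::banach"
  assumes R: "\<And>t. t \<in> {a..<b} \<Longrightarrow> \<exists>l. (f \<longlongrightarrow> l) (at_right t)"
    and L: "\<And>t. t \<in> {a<..b} \<Longrightarrow> \<exists>l. (f \<longlongrightarrow> l) (at_left t)"
    and ab: "a \<le> b"
  shows "f integrable_on {a..b}" and "bounded (f ` {a..b})"
proof -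
  note A = regulated_step_approx[OF R L ab]
  have "\<And>e. e > 0 \<Longrightarrow> \<exists>g. (\<forall>s\<in>cbox a b. norm (f s - g s) \<le> e) \<and> g integrable_on cbox a b"
    using A by (metis cbox_interval)
  then show "f integrable_on {a..b}"
    using integrable_uniform_limit[of a b f] by (simp add: cbox_interval)
  obtain g where g: "bounded (g ` {a..b})" "\<forall>s\<in>{a..b}. norm (f s - g s) \<le> 1" using A[of 1] by auto
  then obtain B where B: "\<forall>s\<in>{a..b}. norm (g s) \<le> B" by (auto simp: bounded_iff)
  have "norm (f s) \<le> B + 1" if "s \<in> {a..b}" for s
    using g(2) B that norm_triangle_ineq[of "f s - g s" "g s"] by fastforce
  then show "bounded (f ` {a..b})" unfolding bounded_iff by (intro exI[of _ "B + 1"]) auto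
qed

section \<open>A smooth substitute for the running maximum\<close>

lemma DERIV_pos_part_power:
  fixes x :: real
  shows "((\<lambda>x. (max 0 x) ^ Suc (Suc n)) has_real_derivative real (Suc (Suc n)) * (max 0 x) ^ Suc n) (at x)"
proof -
  consider "x > 0" | "x < 0" | "x = 0" by linarith
  then show ?thesis
  proof cases
    case 1
    have "((\<lambda>x. x ^ Suc (Suc n)) has_real_derivative real (Suc (Suc n)) * x ^ Suc n) (at x)"
      using DERIV_pow[of "Suc (Suc n)" x] by simp
    then have "((\<lambda>x. (max 0 x) ^ Suc (Suc n)) has_real_derivative real (Suc (Suc n)) * x ^ Suc n) (at x)"
      by (rule has_field_derivative_transform_within_open[of _ _ _ "{0<..}"]) (use 1 in auto)
    then show ?thesis using 1 by simp
  next
    case 2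
    have "((\<lambda>x. 0) has_real_derivative 0) (at x)" by simp
    then have "((\<lambda>x. (max 0 x) ^ Suc (Suc n)) has_real_derivative 0) (at x)"
      by (rule has_field_derivative_transform_within_open[of _ _ _ "{..<0}"]) (use 2 in auto)
    then show ?thesis using 2 by (simp add: max_def)
  next
    case 3
    have "((\<lambda>h::real. (max 0 h) ^ Suc n) \<longlongrightarrow> (max 0 0) ^ Suc n) (at 0)"
      by (intro tendsto_intros)
    moreover have "eventually (\<lambda>h::real. (max 0 h) ^ Suc n = ((max 0 (0 + h)) ^ Suc (Suc n) - (max 0 0) ^ Suc (Suc n)) / h) (at 0)"
      by (rule eventually_at_ball[of 1, THEN eventually_mono]) (auto simp: max_def)
    ultimately have "((\<lambda>h::real. ((max 0 (0 + h)) ^ Suc (Suc n) - (max 0 0) ^ Suc (Suc n)) / h) \<longlongrightarrow> 0) (at 0)"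
      using Lim_transform_eventually by fastforce
    then show ?thesis using 3 by (simp add: DERIV_def)
  qed
qed

text \<open>
  With \<open>m\<close> the square of a running maximum and \<open>q \<le> m\<close> the square of the current position, \<open>m\<close>
  itself is not differentiable at the moments when \<open>q = m\<close>. Here \<open>m\<close> enters only through the
  positive part of \<open>m - q\<close>, which vanishes to third order at these moments. For \<open>m = 0\<close> the
  quotient is \<open>0\<close>, which is the limit value, because \<open>q \<le> m\<close>.
\<close>

definition gauge_fun :: "real \<Rightarrow> real \<Rightarrow> real" where
  "gauge_fun m q = 3 * q\<^sup>2 + (max 0 (m - q)) ^ 3 / m"

definition gauge_fun' :: "real \<Rightarrow> real \<Rightarrow> real" where
  "gauge_fun' m q = 6 * q - 3 * (max 0 (m - q))\<^sup>2 / m"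

definition gauge_fun'' :: "real \<Rightarrow> real \<Rightarrow> real" where
  "gauge_fun'' m q = 6 + 6 * max 0 (m - q) / m"

lemma DERIV_gauge_fun: "(gauge_fun m has_real_derivative gauge_fun' m q) (at q)"
proof -
  have D: "((\<lambda>q. m - q) has_real_derivative - 1) (at q)" by (auto intro!: derivative_eq_intros)
  have "((\<lambda>q. (max 0 (m - q)) ^ 3) has_real_derivative 3 * (max 0 (m - q))\<^sup>2 * (- 1)) (at q)"
    using DERIV_chain2[OF DERIV_pos_part_power[of 1] D] by (simp add: eval_nat_numeral)
  then have "((\<lambda>q. 3 * q\<^sup>2 + (max 0 (m - q)) ^ 3 / m) has_real_derivative
     3 * (2 * q) + (3 * (max 0 (m - q))\<^sup>2 * (- 1)) / m) (at q)"
    by (intro DERIV_add DERIV_cdivide DERIV_cmult) (auto intro!: derivative_eq_intros)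
  then show ?thesis by (simp add: gauge_fun_def[abs_def] gauge_fun'_def)
qed

lemma DERIV_gauge_fun': "(gauge_fun' m has_real_derivative gauge_fun'' m q) (at q)"
proof -
  have D: "((\<lambda>q. m - q) has_real_derivative - 1) (at q)" by (auto intro!: derivative_eq_intros)
  have "((\<lambda>q. (max 0 (m - q))\<^sup>2) has_real_derivative 2 * (max 0 (m - q)) * (- 1)) (at q)"
    using DERIV_chain2[OF DERIV_pos_part_power[of 0] D] by (simp add: eval_nat_numeral)
  then have "((\<lambda>q. 6 * q - 3 * (max 0 (m - q))\<^sup>2 / m) has_real_derivative
     6 * 1 - 3 * (2 * (max 0 (m - q)) * (- 1)) / m) (at q)"
    by (intro DERIV_diff DERIV_cdivide DERIV_cmult DERIV_ident)
  then show ?thesis by (simp add: gauge_fun'_def[abs_def] gauge_fun''_def)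
qed

text \<open>
  A jump of the current position replaces \<open>m\<close> by \<open>max m q\<close>. The gauge does not notice, so it can
  be differentiated with \<open>m\<close> held fixed.
\<close>

lemma gauge_fun_max: "gauge_fun (max m q) q = gauge_fun m q" "gauge_fun' (max m q) q = gauge_fun' m q" "gauge_fun'' (max m q) q = gauge_fun'' m q"
  by (auto simp: gauge_fun_def gauge_fun'_def gauge_fun''_def max_def)

text \<open>
  The two-sided comparison with \<open>m\<^sup>2\<close> gives control of the running maximum. The bound of the
  first derivative by \<open>6 q\<close>, without \<open>m\<close>, is what allows a supersolution to dominate the gauge
  later on.
\<close>

lemma gauge_fun_bounds:
  assumes "0 \<le> q" "q \<le> m"
  shows "m\<^sup>2 / 2 \<le> gauge_fun m q" "gauge_fun m q \<le> 4 * m\<^sup>2" "0 \<le> gauge_fun m q" "gauge_fun' m q \<le> 6 * q" "\<bar>gauge_fun' m q\<bar> \<le> 9 * m"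
    "6 \<le> gauge_fun'' m q" "gauge_fun'' m q \<le> 12"
proof -
  show "6 \<le> gauge_fun'' m q" "gauge_fun' m q \<le> 6 * q" "0 \<le> gauge_fun m q"
    using assms by (auto simp: gauge_fun''_def gauge_fun'_def gauge_fun_def)
  show "gauge_fun'' m q \<le> 12" using assms by (cases "m = 0") (auto simp: gauge_fun''_def max_def divide_le_eq)
  show "m\<^sup>2 / 2 \<le> gauge_fun m q"
  proof (cases "m = 0")
    case False
    then have m: "m > 0" using assms by simp
    (* This is m times the claimed difference; the quadratic form in the bracket is positive
       definite. *)
    have "0 \<le> m * (m\<^sup>2 / 2 - 3 * m * q + 5 * q\<^sup>2) + q\<^sup>2 * (m - q)"
    proof -
      have "m\<^sup>2 / 2 - 3 * m * q + 5 * q\<^sup>2 = (m - 3 * q)\<^sup>2 / 2 + q\<^sup>2 / 2"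
        by (simp add: power2_eq_square field_simps)
      then have "0 \<le> m\<^sup>2 / 2 - 3 * m * q + 5 * q\<^sup>2" by simp
      then have "0 \<le> m * (m\<^sup>2 / 2 - 3 * m * q + 5 * q\<^sup>2)" using m by (intro mult_nonneg_nonneg) auto
      moreover have "0 \<le> q\<^sup>2 * (m - q)" using assms by simp
      ultimately show ?thesis by linarith
    qed
    also have "\<dots> = m * (3 * q\<^sup>2) + (m - q) ^ 3 - m * (m\<^sup>2 / 2)"
      by (simp add: power2_eq_square power3_eq_cube field_simps)
    finally have "m * (m\<^sup>2 / 2) \<le> m * (3 * q\<^sup>2 + (m - q) ^ 3 / m)" using m by (simp add: distrib_left)
    then show ?thesis using m assms by (simp add: gauge_fun_def max_def)
  qed (use assms in \<open>simp add: gauge_fun_def\<close>)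
  have d: "0 \<le> max 0 (m - q)" "max 0 (m - q) \<le> m" using assms by auto
  have "(max 0 (m - q)) ^ 3 / m \<le> m ^ 3 / m"
    using d assms by (intro divide_right_mono power_mono) auto
  also have "\<dots> = m\<^sup>2" by (simp add: power2_eq_square power3_eq_cube)
  finally have "(max 0 (m - q)) ^ 3 / m \<le> m\<^sup>2" .
  moreover have "q\<^sup>2 \<le> m\<^sup>2" using assms by (intro power_mono)
  ultimately show "gauge_fun m q \<le> 4 * m\<^sup>2" unfolding gauge_fun_def by linarith
  have "(max 0 (m - q))\<^sup>2 / m \<le> m\<^sup>2 / m"
    using d assms by (intro divide_right_mono power_mono) auto
  also have "\<dots> = m" by (simp add: power2_eq_square)
  finally have "(max 0 (m - q))\<^sup>2 / m \<le> m" .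
  moreover have "0 \<le> (max 0 (m - q))\<^sup>2 / m" using assms by simp
  ultimately show "\<bar>gauge_fun' m q\<bar> \<le> 9 * m" using assms unfolding gauge_fun'_def by linarith
qed

text \<open>
  Only the point \<open>m = 0\<close> needs care: there the quotients degenerate, and the bounds force the
  limits to be \<open>0\<close>. The second derivative is discontinuous at this point, but it occurs only
  together with a factor that is bounded by \<open>m\<close>.
\<close>

lemma tendsto_gauge_fun:
  assumes m: "(mf \<longlongrightarrow> m) F" and q: "(qf \<longlongrightarrow> q) F" and le: "eventually (\<lambda>x. 0 \<le> qf x \<and> qf x \<le> mf x) F"
    and mq: "0 \<le> q" "q \<le> m"
  shows "((\<lambda>x. gauge_fun (mf x) (qf x)) \<longlongrightarrow> gauge_fun m q) F" "((\<lambda>x. gauge_fun' (mf x) (qf x)) \<longlongrightarrow> gauge_fun' m q) F"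
    "(w \<longlongrightarrow> w0) F \<Longrightarrow> eventually (\<lambda>x. \<bar>w x\<bar> \<le> mf x) F \<Longrightarrow> \<bar>w0\<bar> \<le> m \<Longrightarrow> ((\<lambda>x. gauge_fun'' (mf x) (qf x) * w x) \<longlongrightarrow> gauge_fun'' m q * w0) F"
proof -
  have "((\<lambda>x. gauge_fun (mf x) (qf x)) \<longlongrightarrow> gauge_fun m q) F \<and> ((\<lambda>x. gauge_fun' (mf x) (qf x)) \<longlongrightarrow> gauge_fun' m q) F \<and>
    ((w \<longlongrightarrow> w0) F \<longrightarrow> eventually (\<lambda>x. \<bar>w x\<bar> \<le> mf x) F \<longrightarrow> \<bar>w0\<bar> \<le> m \<longrightarrow> ((\<lambda>x. gauge_fun'' (mf x) (qf x) * w x) \<longlongrightarrow> gauge_fun'' m q * w0) F)"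
  proof (cases "m = 0")
    case False
    then show ?thesis unfolding gauge_fun_def gauge_fun'_def gauge_fun''_def
      by (intro conjI impI tendsto_intros m q) auto
  next
    case True
    then have 0: "m = 0" "q = 0" using mq by auto
    have m2: "((\<lambda>x. 4 * (mf x)\<^sup>2) \<longlongrightarrow> 0) F" "((\<lambda>x. 9 * mf x) \<longlongrightarrow> 0) F" "((\<lambda>x. 12 * mf x) \<longlongrightarrow> 0) F"
      using m True by (auto intro!: tendsto_eq_intros)
    have "((\<lambda>x. gauge_fun (mf x) (qf x)) \<longlongrightarrow> 0) F"
      by (rule Lim_null_comparison[OF _ m2(1)])
         (use le in eventually_elim, use gauge_fun_bounds in auto)
    moreover have "((\<lambda>x. gauge_fun' (mf x) (qf x)) \<longlongrightarrow> 0) F"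
      by (rule Lim_null_comparison[OF _ m2(2)])
         (use le in eventually_elim, use gauge_fun_bounds in auto)
    moreover have "((\<lambda>x. gauge_fun'' (mf x) (qf x) * w x) \<longlongrightarrow> 0) F" if "eventually (\<lambda>x. \<bar>w x\<bar> \<le> mf x) F"
    proof (rule Lim_null_comparison[OF _ m2(3)])
      show "\<forall>\<^sub>F x in F. norm (gauge_fun'' (mf x) (qf x) * w x) \<le> 12 * mf x"
        using le that
      proof eventually_elim
        case (elim x)
        have "\<bar>gauge_fun'' (mf x) (qf x)\<bar> * \<bar>w x\<bar> \<le> 12 * mf x"
          using gauge_fun_bounds(6,7)[of "qf x" "mf x"] elim by (intro mult_mono) auto
        then show ?case by (simp add: abs_mult)
      qed
    qed
    ultimately show ?thesis using 0 by (simp add: gauge_fun_def gauge_fun'_def)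
  qed
  then show "((\<lambda>x. gauge_fun (mf x) (qf x)) \<longlongrightarrow> gauge_fun m q) F" "((\<lambda>x. gauge_fun' (mf x) (qf x)) \<longlongrightarrow> gauge_fun' m q) F"
    "(w \<longlongrightarrow> w0) F \<Longrightarrow> eventually (\<lambda>x. \<bar>w x\<bar> \<le> mf x) F \<Longrightarrow> \<bar>w0\<bar> \<le> m \<Longrightarrow> ((\<lambda>x. gauge_fun'' (mf x) (qf x) * w x) \<longlongrightarrow> gauge_fun'' m q * w0) F"
    by auto
qed

locale horizon =
  fixes T :: real
  assumes T_pos: "0 < T"
begin

lemma cadlagD:
  assumes "x \<in> cadlag_paths T"
  shows "x \<in> extensional {0..T}"
    and "t \<in> {0..<T} \<Longrightarrow> (x \<longlongrightarrow> x t) (at_right t)"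
    and "t \<in> {0<..T} \<Longrightarrow> \<exists>l. (x \<longlongrightarrow> l) (at_left t)"
  using assms by (auto simp: cadlag_paths_def)

lemma cadlag_bounded:
  assumes "x \<in> cadlag_paths T" shows "bounded (x ` {0..T})"
  using regulated_integrable_bounded(2)[of 0 T x] cadlagD[OF assms] T_pos by (metis less_imp_le)

lemma cadlag_inner_integrable:
  fixes x :: "('n::finite) path"
  assumes x: "x \<in> cadlag_paths T" and g: "continuous_on {0..T} g" and t: "t \<in> {0..T}"
  shows "(\<lambda>s. g s \<bullet> x s) integrable_on {0..t}"
proof -
  have "(\<lambda>s. g s \<bullet> x s) integrable_on {0..T}"
  proof (rule regulated_integrable_bounded(1))
    fix r assume r: "r \<in> {0..<T}"
    have "(g \<longlongrightarrow> g r) (at_right r)"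
      using g r by (metis atLeastLessThan_iff continuous_on_Icc_at_rightD continuous_on_subset
          atLeastatMost_subset_iff order_refl)
    then show "\<exists>l. ((\<lambda>s. g s \<bullet> x s) \<longlongrightarrow> l) (at_right r)"
      using cadlagD(2)[OF x r] tendsto_inner by blast
  next
    fix r assume r: "r \<in> {0<..T}"
    have "(g \<longlongrightarrow> g r) (at_left r)"
      using g r by (metis greaterThanAtMost_iff continuous_on_Icc_at_leftD continuous_on_subset
          atLeastatMost_subset_iff order_refl)
    then show "\<exists>l. ((\<lambda>s. g s \<bullet> x s) \<longlongrightarrow> l) (at_left r)"
      using cadlagD(3)[OF x r] tendsto_inner by blast
  qed (use T_pos in simp)
  then show ?thesis by (rule integrable_on_subinterval) (use t in auto)
qed

lemma cont_cadlag: "cont_paths T \<subseteq> cadlag_paths T"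
proof
  fix x :: "('n::finite) path" assume "x \<in> cont_paths T"
  then have x: "x \<in> extensional {0..T}" "continuous_on {0..T} x" by (auto simp: cont_paths_def)
  have "(x \<longlongrightarrow> x t) (at_right t)" if "t \<in> {0..<T}" for t
    using x(2) that by (metis atLeastLessThan_iff continuous_on_Icc_at_rightD continuous_on_subset
          atLeastatMost_subset_iff order_refl)
  moreover have "(x \<longlongrightarrow> x t) (at_left t)" if "t \<in> {0<..T}" for t
    using x(2) that by (metis greaterThanAtMost_iff continuous_on_Icc_at_leftD continuous_on_subset
          atLeastatMost_subset_iff order_refl)
  ultimately show "x \<in> cadlag_paths T" using x(1) unfolding cadlag_paths_def by blast
qed

lemma Lambda_subset: "Lambda T \<subseteq> Lambda_hat T"
  using cont_cadlag by (auto simp: Lambda_def Lambda_hat_def)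

subsection \<open>Stopping and bumping\<close>

lemma stopped_apply: "s \<in> {0..T} \<Longrightarrow> stopped T t x s = x (min s t)"
  by (simp add: stopped_def)

lemma bumped_apply: "s \<in> {0..T} \<Longrightarrow> bumped T t v x s = x s + (if t \<le> s then v else 0)"
  by (auto simp: bumped_def)

lemma path_eqI: "x \<in> extensional {0..T} \<Longrightarrow> y \<in> extensional {0..T} \<Longrightarrow>
    (\<And>s. s \<in> {0..T} \<Longrightarrow> x s = y s) \<Longrightarrow> x = y"
  by (rule extensionalityI)

lemma stopped_ext [simp]: "stopped T t x \<in> extensional {0..T}"
  by (simp add: stopped_def)

lemma bumped_ext [simp]: "bumped T t v x \<in> extensional {0..T}"
  by (simp add: bumped_def)

lemma stopped_stopped:
  "r \<in> {0..T} \<Longrightarrow> stopped T r (stopped T t x) = stopped T (min r t) x"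
  by (rule path_eqI) (auto simp: stopped_apply min.assoc)

lemma stopped_bumped_less:
  "r < t \<Longrightarrow> r \<in> {0..T} \<Longrightarrow> stopped T r (bumped T t v x) = stopped T r x"
  by (rule path_eqI) (auto simp: stopped_apply bumped_apply min_def)

lemma bumped_bumped: "bumped T t v (bumped T t w x) = bumped T t (w + v) x"
  by (rule path_eqI) (auto simp: bumped_apply)

lemma bumped_0: "x \<in> extensional {0..T} \<Longrightarrow> bumped T t 0 x = x"
  by (rule path_eqI) (auto simp: bumped_apply)

lemma stopped_T: "x \<in> extensional {0..T} \<Longrightarrow> stopped T T x = x"
  by (rule path_eqI) (auto simp: stopped_apply min_def)

lemma stopped_cadlag:
  assumes x: "x \<in> cadlag_paths T" and t: "t \<in> {0..T}"
  shows "stopped T t x \<in> cadlag_paths T"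
  unfolding cadlag_paths_def
proof (intro CollectI conjI ballI stopped_ext)
  fix r assume r: "r \<in> {0..<T}"
  show "(stopped T t x \<longlongrightarrow> stopped T t x r) (at_right r)"
  proof (cases "r < t")
    case True
    then have ev: "eventually (\<lambda>s. x s = stopped T t x s) (at_right r)"
      unfolding eventually_at_right_field using r t
      by (intro exI[of _ t]) (auto simp: stopped_apply min_def)
    have "(x \<longlongrightarrow> stopped T t x r) (at_right r)"
      using cadlagD(2)[OF x r] True r by (simp add: stopped_apply min_def)
    then show ?thesis using ev by (rule Lim_transform_eventually)
  next
    case False
    then have ev: "eventually (\<lambda>s. x t = stopped T t x s) (at_right r)"
      unfolding eventually_at_right_field using r t
      by (intro exI[of _ T]) (auto simp: stopped_apply min_def)
    have "((\<lambda>s. x t) \<longlongrightarrow> stopped T t x r) (at_right r)"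
      using False r by (simp add: stopped_apply min_def)
    then show ?thesis using ev by (rule Lim_transform_eventually)
  qed
next
  fix r assume r: "r \<in> {0<..T}"
  show "\<exists>l. (stopped T t x \<longlongrightarrow> l) (at_left r)"
  proof (cases "r \<le> t")
    case True
    then have ev: "eventually (\<lambda>s. x s = stopped T t x s) (at_left r)"
      unfolding eventually_at_left_field using r t
      by (intro exI[of _ 0]) (auto simp: stopped_apply min_def)
    show ?thesis using cadlagD(3)[OF x r] Lim_transform_eventually[OF _ ev] by blast
  next
    case False
    then have ev: "eventually (\<lambda>s. x t = stopped T t x s) (at_left r)"
      unfolding eventually_at_left_field using r t
      by (intro exI[of _ t]) (auto simp: stopped_apply min_def)
    show ?thesis using Lim_transform_eventually[OF tendsto_const ev] by blast
  qed
qed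

lemma bumped_cadlag:
  assumes x: "x \<in> cadlag_paths T" and t: "t \<in> {0..T}"
  shows "bumped T t v x \<in> cadlag_paths T"
  unfolding cadlag_paths_def
proof (intro CollectI conjI ballI bumped_ext)
  fix r assume r: "r \<in> {0..<T}"
  have ev: "eventually (\<lambda>s. x s + (if t \<le> r then v else 0) = bumped T t v x s) (at_right r)"
    unfolding eventually_at_right_field using r t
    by (intro exI[of _ "if t \<le> r then T else t"]) (auto simp: bumped_apply)
  have "((\<lambda>s. x s + (if t \<le> r then v else 0)) \<longlongrightarrow> x r + (if t \<le> r then v else 0)) (at_right r)"
    by (intro tendsto_add cadlagD(2)[OF x r] tendsto_const)
  then show "(bumped T t v x \<longlongrightarrow> bumped T t v x r) (at_right r)"
    using Lim_transform_eventually[OF _ ev] r by (simp add: bumped_apply)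
next
  fix r assume r: "r \<in> {0<..T}"
  have ev: "eventually (\<lambda>s. x s + (if t < r then v else 0) = bumped T t v x s) (at_left r)"
    unfolding eventually_at_left_field using r t
    by (intro exI[of _ "if t < r then t else 0"]) (auto simp: bumped_apply)
  obtain l where "(x \<longlongrightarrow> l) (at_left r)" using cadlagD(3)[OF x r] by blast
  then have "((\<lambda>s. x s + (if t < r then v else 0)) \<longlongrightarrow> l + (if t < r then v else 0)) (at_left r)"
    by (intro tendsto_add tendsto_const)
  then show "\<exists>l. (bumped T t v x \<longlongrightarrow> l) (at_left r)"
    using Lim_transform_eventually[OF _ ev] by blast
qed

subsection \<open>The supremum distance\<close>

lemma cadlag_diff_bdd:
  assumes "x \<in> cadlag_paths T" "y \<in> cadlag_paths T"
  shows "bdd_above ((\<lambda>s. norm (x s - y s)) ` {0..T})"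
proof -
  obtain A B where "\<forall>s\<in>{0..T}. norm (x s) \<le> A" "\<forall>s\<in>{0..T}. norm (y s) \<le> B"
    using cadlag_bounded[OF assms(1)] cadlag_bounded[OF assms(2)] by (auto simp: bounded_iff)
  then have "norm (x s - y s) \<le> A + B" if "s \<in> {0..T}" for s
    using that norm_triangle_ineq4[of "x s" "y s"] by fastforce
  then show ?thesis unfolding bdd_above_def by (intro exI[of _ "A + B"]) auto
qed

lemma sup_dist_upper:
  assumes "x \<in> cadlag_paths T" "y \<in> cadlag_paths T" "s \<in> {0..T}"
  shows "norm (x s - y s) \<le> sup_dist T x y"
  unfolding sup_dist_def sup_norm_def
  by (rule cSUP_upper[OF assms(3) cadlag_diff_bdd[OF assms(1,2)]])

lemma sup_dist_least:
  assumes "\<And>s. s \<in> {0..T} \<Longrightarrow> norm (x s - y s) \<le> B"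
  shows "sup_dist T x y \<le> B"
  unfolding sup_dist_def sup_norm_def
  by (rule cSUP_least) (use assms T_pos in auto)

lemma sup_norm_upper:
  assumes "x \<in> cadlag_paths T" "s \<in> {0..T}"
  shows "norm (x s) \<le> sup_norm T x"
proof -
  have "bdd_above ((\<lambda>s. norm (x s)) ` {0..T})"
    using cadlag_bounded[OF assms(1)] by (auto simp: bounded_iff bdd_above_def)
  then show ?thesis unfolding sup_norm_def using cSUP_upper assms(2) by fast
qed

lemma sup_norm_nonneg: "x \<in> cadlag_paths T \<Longrightarrow> 0 \<le> sup_norm T x"
  using sup_norm_upper[of x 0] T_pos order_trans[OF norm_ge_zero] by force

lemma d_inf_upper:
  assumes "(t, x) \<in> Lambda_hat T" "(t', x') \<in> Lambda_hat T" "s \<in> {0..T}"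
  shows "\<bar>t - t'\<bar> + norm (x (min s t) - x' (min s t')) \<le> d_inf T (t, x) (t', x')"
proof -
  have "norm (stopped T t x s - stopped T t' x' s) \<le> sup_dist T (stopped T t x) (stopped T t' x')"
    by (rule sup_dist_upper) (use assms stopped_cadlag in \<open>auto simp: Lambda_hat_def\<close>)
  then show ?thesis using assms(3) by (simp add: d_inf_def stopped_apply)
qed

lemma d_inf_least:
  assumes "\<bar>t - t'\<bar> \<le> A" "\<And>s. s \<in> {0..T} \<Longrightarrow> norm (x (min s t) - x' (min s t')) \<le> B"
  shows "d_inf T (t, x) (t', x') \<le> A + B"
proof -
  have "sup_dist T (stopped T t x) (stopped T t' x') \<le> B"
    by (rule sup_dist_least) (use assms in \<open>simp add: stopped_apply\<close>)
  then show ?thesis using assms(1) by (simp add: d_inf_def)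
qed

lemma d_inf_ge_time:
  assumes "(t, x) \<in> Lambda_hat T" "(t', x') \<in> Lambda_hat T"
  shows "\<bar>t - t'\<bar> \<le> d_inf T (t, x) (t', x')"
  using d_inf_upper[OF assms, of 0] T_pos norm_ge_zero[of "x (min 0 t) - x' (min 0 t')"]
  by (simp del: norm_ge_zero)

subsection \<open>Continuity as convergence along a filter\<close>

text \<open>
  Neighbourhoods for the pseudometric on the set of points with right-continuous paths.
  Convergence along this filter makes the usual rules for limits applicable to path functionals.
\<close>

definition nb :: "real \<times> ('n::finite) path \<Rightarrow> (real \<times> 'n path) filter" where
  "nb p = (INF \<delta>\<in>{0<..}. principal {q\<in>Lambda_hat T. d_inf T p q < \<delta>})"

lemma eventually_nb:
  "eventually Q (nb p) \<longleftrightarrow> (\<exists>\<delta>>0. \<forall>q\<in>Lambda_hat T. d_inf T p q < \<delta> \<longrightarrow> Q q)"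
proof -
  have "eventually Q (nb p) \<longleftrightarrow>
     (\<exists>\<delta>\<in>{0<..}. eventually Q (principal {q\<in>Lambda_hat T. d_inf T p q < \<delta>}))"
    unfolding nb_def
  proof (rule eventually_INF_base)
    fix a b :: real assume "a \<in> {0<..}" "b \<in> {0<..}"
    then show "\<exists>c\<in>{0<..}. principal {q\<in>Lambda_hat T. d_inf T p q < c}
      \<le> inf (principal {q\<in>Lambda_hat T. d_inf T p q < a}) (principal {q\<in>Lambda_hat T. d_inf T p q < b})"
      by (intro bexI[of _ "min a b"]) auto
  qed auto
  then show ?thesis by (auto simp: eventually_principal)
qed

lemma cont_hat_iff:
  "cont_wrt (d_inf T) (Lambda_hat T) f \<longleftrightarrow> (\<forall>p\<in>Lambda_hat T. (f \<longlongrightarrow> f p) (nb p))"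
  unfolding cont_wrt_def tendsto_iff eventually_nb by blast

lemma d_inf_nonneg: "p \<in> Lambda_hat T \<Longrightarrow> q \<in> Lambda_hat T \<Longrightarrow> 0 \<le> d_inf T p q"
  by (cases p, cases q) (metis abs_ge_zero d_inf_ge_time order_trans)

lemma nb_lipschitz:
  fixes F :: "real \<times> ('n::finite) path \<Rightarrow> 'b::real_normed_vector"
  assumes p: "p \<in> Lambda_hat T"
    and F: "\<And>q. q \<in> Lambda_hat T \<Longrightarrow> norm (F q - F p) \<le> C * d_inf T p q"
  shows "(F \<longlongrightarrow> F p) (nb p)"
  unfolding tendsto_iff eventually_nb
proof (intro allI impI)
  fix e :: real assume e: "e > 0"
  show "\<exists>\<delta>>0. \<forall>q\<in>Lambda_hat T. d_inf T p q < \<delta> \<longrightarrow> dist (F q) (F p) < e"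
  proof (intro exI[of _ "e / (\<bar>C\<bar> + 1)"] conjI ballI impI)
    show "0 < e / (\<bar>C\<bar> + 1)" using e by (simp add: add_nonneg_pos)
    fix q assume q: "q \<in> Lambda_hat T" "d_inf T p q < e / (\<bar>C\<bar> + 1)"
    have "norm (F q - F p) \<le> (\<bar>C\<bar> + 1) * d_inf T p q"
      using F[OF q(1)] d_inf_nonneg[OF p q(1)] mult_right_mono[of C "\<bar>C\<bar> + 1" "d_inf T p q"]
      by linarith
    also have "\<dots> < e" using q(2) by (simp add: field_simps add_nonneg_pos)
    finally show "dist (F q) (F p) < e" by (simp add: dist_norm)
  qed
qed

lemma tendsto_time_nb:
  assumes "p \<in> Lambda_hat T" shows "(fst \<longlongrightarrow> fst p) (nb p)"
proof (rule nb_lipschitz[of _ _ 1])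
  fix q :: "real \<times> 'a path" assume "q \<in> Lambda_hat T"
  then show "norm (fst q - fst p) \<le> 1 * d_inf T p q"
    using d_inf_ge_time[of "fst p" "snd p" "fst q" "snd q"] assms by (simp add: abs_minus_commute)
qed (fact assms)

lemma tendsto_time_fun_nb:
  assumes f: "continuous_on {0..T} f" and p: "p \<in> Lambda_hat T"
  shows "((\<lambda>p. f (fst p)) \<longlongrightarrow> f (fst p)) (nb p)"
proof -
  have "fst p \<in> {0..T}" using p by (auto simp: Lambda_hat_def)
  moreover have "eventually (\<lambda>q. fst q \<in> {0..T}) (nb p)"
    unfolding eventually_nb by (intro exI[of _ 1]) (auto simp: Lambda_hat_def)
  ultimately show ?thesis
    using tendsto_time_nb[OF p] f continuous_on_tendsto_compose by blast
qed

section \<open>Calculus of pathwise derivatives\<close>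

lemma has_vertical_iff:
  "has_vertical_derivative T i u b \<longleftrightarrow> (\<forall>(t, x)\<in>Lambda_hat T.
     ((\<lambda>h. u (t, bumped T t (h *\<^sub>R axis i 1) x)) has_real_derivative b (t, x)) (at 0))"
proof -
  have "((\<lambda>h. (u (t, bumped T t (h *\<^sub>R axis i 1) x) - u (t, x)) / h) \<longlongrightarrow> b (t, x)) (at 0) \<longleftrightarrow>
     ((\<lambda>h. u (t, bumped T t (h *\<^sub>R axis i 1) x)) has_real_derivative b (t, x)) (at 0)"
    if "(t, x) \<in> Lambda_hat T" for t x
  proof -
    have "x \<in> extensional {0..T}" using that cadlagD(1) by (auto simp: Lambda_hat_def)
    then show ?thesis by (simp add: DERIV_def bumped_0)
  qed
  then show ?thesis unfolding has_vertical_derivative_def by blast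
qed

text \<open>
  Jumps at the same time add up, so a vertical derivative is an ordinary derivative along the
  whole line of bumped paths, and not only at the origin.
\<close>

lemma has_verticalD:
  assumes "has_vertical_derivative T i u b" "(t, x) \<in> Lambda_hat T"
  shows "((\<lambda>h. u (t, bumped T t (h *\<^sub>R axis i 1) x)) has_real_derivative
     b (t, bumped T t (s *\<^sub>R axis i 1) x)) (at s)"
proof -
  have m: "(t, bumped T t (s *\<^sub>R axis i 1) x) \<in> Lambda_hat T"
    using assms(2) bumped_cadlag by (auto simp: Lambda_hat_def)
  have "((\<lambda>h. u (t, bumped T t (h *\<^sub>R axis i 1) (bumped T t (s *\<^sub>R axis i 1) x)))
     has_real_derivative b (t, bumped T t (s *\<^sub>R axis i 1) x)) (at 0)"
    using assms(1) m unfolding has_vertical_iff by blast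
  then have "((\<lambda>h. u (t, bumped T t ((s + h) *\<^sub>R axis i 1) x))
     has_real_derivative b (t, bumped T t (s *\<^sub>R axis i 1) x)) (at 0)"
    by (simp add: bumped_bumped scaleR_add_left)
  then show ?thesis
    using DERIV_shift[of "\<lambda>h. u (t, bumped T t (h *\<^sub>R axis i 1) x)"
        "b (t, bumped T t (s *\<^sub>R axis i 1) x)" 0 s] by (simp add: add.commute)
qed

lemma bumped_0_hat: "(t, x) \<in> Lambda_hat T \<Longrightarrow> bumped T t (0 *\<^sub>R v) x = x"
  by (auto simp: Lambda_hat_def intro!: bumped_0 cadlagD(1))

text \<open>
  At the terminal time a horizontal derivative is prescribed as a left limit along the path.  For
  a path that jumps at \<open>T\<close>, this is the value at the path whose jump at \<open>T\<close> has been removed.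
\<close>

definition unjump :: "real \<times> ('n::finite) path \<Rightarrow> real \<times> 'n path" where
  "unjump p = (fst p, if fst p = T then (snd p)(T := Lim (at_left T) (snd p)) else snd p)"

lemma cadlag_left_Lim:
  assumes "x \<in> cadlag_paths T"
  shows "(x \<longlongrightarrow> Lim (at_left T) x) (at_left T)"
  using cadlagD(3)[OF assms, of T] T_pos
  by (metis greaterThanAtMost_iff order_refl tendsto_Lim trivial_limit_at_left_real)

lemma at_left_T: "eventually (\<lambda>s. s \<in> {0<..<T}) (at_left T)"
  unfolding eventually_at_left_field using T_pos by (intro exI[of _ 0]) auto

lemma unjump_cadlag:
  assumes x: "x \<in> cadlag_paths T"
  shows "x(T := l) \<in> cadlag_paths T"
  unfolding cadlag_paths_def
proof (intro CollectI conjI ballI)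
  show "x(T := l) \<in> extensional {0..T}"
    using cadlagD(1)[OF x] T_pos by (auto simp: extensional_def)
  fix r assume r: "r \<in> {0..<T}"
  have "eventually (\<lambda>s. x s = (x(T := l)) s) (at_right r)"
    unfolding eventually_at_right_field using r by (intro exI[of _ T]) auto
  then show "(x(T := l) \<longlongrightarrow> (x(T := l)) r) (at_right r)"
    using Lim_transform_eventually cadlagD(2)[OF x r] r by force
next
  fix r assume r: "r \<in> {0<..T}"
  have "eventually (\<lambda>s. x s = (x(T := l)) s) (at_left r)"
    unfolding eventually_at_left_field using r by (intro exI[of _ 0]) auto
  then show "\<exists>k. (x(T := l) \<longlongrightarrow> k) (at_left r)"
    using Lim_transform_eventually cadlagD(3)[OF x r] by blast
qed

lemma unjump_hat: "p \<in> Lambda_hat T \<Longrightarrow> unjump p \<in> Lambda_hat T"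
  by (auto simp: unjump_def Lambda_hat_def unjump_cadlag)

lemma unjump_Lambda:
  assumes "p \<in> Lambda T" shows "unjump p = p"
proof -
  obtain t x where p: "p = (t, x)" "x \<in> cont_paths T" using assms by (auto simp: Lambda_def)
  have "continuous_on {0..T} x" using p by (simp add: cont_paths_def)
  then have "(x \<longlongrightarrow> x T) (at_left T)" using T_pos continuous_on_Icc_at_leftD by blast
  then have "Lim (at_left T) x = x T" by (intro tendsto_Lim) simp_all
  then show ?thesis by (auto simp: unjump_def p)
qed

text \<open>
  A bound that holds at all times before \<open>T\<close> passes to the left limits at \<open>T\<close>.
\<close>

lemma unjump_d_inf:
  assumes p: "p \<in> Lambda_hat T" and q: "q \<in> Lambda_hat T"
  shows "d_inf T (unjump p) (unjump q) \<le> d_inf T p q"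
proof -
  obtain t x t' x' where pq: "p = (t, x)" "q = (t', x')" by (cases p, cases q)
  define y where "y = snd (unjump p)"
  define y' where "y' = snd (unjump q)"
  define D where "D = d_inf T p q"
  have x: "x \<in> cadlag_paths T" "x' \<in> cadlag_paths T" and t: "t \<in> {0..T}" "t' \<in> {0..T}"
    using p q by (auto simp: pq Lambda_hat_def)
  have up: "norm (x (min s t) - x' (min s t')) \<le> D - \<bar>t - t'\<bar>" if "s \<in> {0..T}" for s
    using d_inf_upper[of t x t' x' s] p q that by (simp add: D_def pq)
  have lim: "((\<lambda>s. x (min s t)) \<longlongrightarrow> y (min T t)) (at_left T)" (is "?A")
    and lim': "((\<lambda>s. x' (min s t')) \<longlongrightarrow> y' (min T t')) (at_left T)" (is "?B")
  proof -
    have G: "((\<lambda>s. z (min s r)) \<longlongrightarrow> (snd (unjump (r, z))) (min T r)) (at_left T)"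
      if z: "z \<in> cadlag_paths T" and r: "r \<in> {0..T}" for z :: "'a path" and r
    proof (cases "r = T")
      case True
      have "eventually (\<lambda>s. z s = z (min s r)) (at_left T)"
        using at_left_T by eventually_elim (simp add: True)
      then show ?thesis using Lim_transform_eventually[OF cadlag_left_Lim[OF z]] True
        by (simp add: unjump_def)
    next
      case False
      then have "eventually (\<lambda>s. z r = z (min s r)) (at_left T)"
        unfolding eventually_at_left_field using r by (intro exI[of _ r]) auto
      then show ?thesis using Lim_transform_eventually[OF tendsto_const] False r
        by (simp add: unjump_def)
    qed
    show ?A using G[OF x(1) t(1)] by (simp add: y_def pq)
    show ?B using G[OF x(2) t(2)] by (simp add: y'_def pq)
  qed
  have "norm (y (min s t) - y' (min s t')) \<le> D - \<bar>t - t'\<bar>" if s: "s \<in> {0..T}" for s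
  proof (cases "s = T")
    case False
    then have "y (min s t) = x (min s t)" "y' (min s t') = x' (min s t')"
      using s by (auto simp: y_def y'_def unjump_def pq min_def)
    then show ?thesis using up[OF s] by simp
  next
    case True
    have "norm (y (min T t) - y' (min T t')) \<le> D - \<bar>t - t'\<bar>"
    proof (rule tendsto_upperbound[OF tendsto_norm[OF tendsto_diff[OF lim lim']]])
      show "\<forall>\<^sub>F s in at_left T. norm (x (min s t) - x' (min s t')) \<le> D - \<bar>t - t'\<bar>"
        using at_left_T by eventually_elim (rule up, auto)
    qed simp
    then show ?thesis using True by simp
  qed
  then have "d_inf T (t, y) (t', y') \<le> \<bar>t - t'\<bar> + (D - \<bar>t - t'\<bar>)"
    by (intro d_inf_least) auto
  moreover have "unjump p = (t, y)" "unjump q = (t', y')"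
    by (simp_all add: y_def y'_def unjump_def pq)
  ultimately show ?thesis by (simp add: D_def)
qed

lemma tendsto_unjump:
  assumes "cont_wrt (d_inf T) (Lambda_hat T) u" "p \<in> Lambda_hat T"
  shows "((\<lambda>q. u (unjump q)) \<longlongrightarrow> u (unjump p)) (nb p)"
  unfolding tendsto_iff eventually_nb
proof (intro allI impI)
  fix e :: real assume "e > 0"
  then obtain d where d: "d > 0" "\<forall>q\<in>Lambda_hat T. d_inf T (unjump p) q < d \<longrightarrow> dist (u q) (u (unjump p)) < e"
    using assms unjump_hat unfolding cont_wrt_def by blast
  then show "\<exists>d>0. \<forall>q\<in>Lambda_hat T. d_inf T p q < d \<longrightarrow> dist (u (unjump q)) (u (unjump p)) < e"
    using unjump_d_inf[OF assms(2)] unjump_hat by (meson le_less_trans)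
qed

lemma tendsto_left_unjump:
  assumes u: "cont_wrt (d_inf T) (Lambda_hat T) u" and x: "x \<in> cadlag_paths T"
  shows "((\<lambda>t. u (t, x)) \<longlongrightarrow> u (unjump (T, x))) (at_left T)"
  unfolding tendsto_iff
proof (intro allI impI)
  fix e :: real assume e: "e > 0"
  define l where "l = Lim (at_left T) x"
  have TT: "unjump (T, x) = (T, x(T := l))" by (simp add: unjump_def l_def)
  have m: "(T, x(T := l)) \<in> Lambda_hat T" using unjump_cadlag[OF x] T_pos by (auto simp: Lambda_hat_def)
  obtain d where d: "d > 0" "\<forall>q\<in>Lambda_hat T. d_inf T (T, x(T := l)) q < d \<longrightarrow> dist (u q) (u (T, x(T := l))) < e"
    using u m e unfolding cont_wrt_def by blast
  have "eventually (\<lambda>s. dist (x s) l < d / 6) (at_left T)"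
    using cadlag_left_Lim[OF x] d(1) unfolding l_def by (intro tendstoD) auto
  then obtain c where c: "c < T" "\<forall>s>c. s < T \<longrightarrow> dist (x s) l < d / 6"
    unfolding eventually_at_left_field by auto
  have "eventually (\<lambda>t. t \<in> {max (max 0 c) (T - d / 3)<..<T}) (at_left T)"
    by (rule eventually_at_left_real) (use c T_pos d in auto)
  then show "eventually (\<lambda>t. dist (u (t, x)) (u (unjump (T, x))) < e) (at_left T)"
  proof eventually_elim
    case (elim t)
    have "norm ((x(T := l)) (min s T) - x (min s t)) \<le> d / 3" if s: "s \<in> {0..T}" for s
    proof -
      consider "s \<le> t" | "t < s" "s < T" | "s = T" using s by fastforce
      then show ?thesis
      proof cases
        case 1 then show ?thesis using elim d(1) by (auto simp: min_def)
      next
        case 2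
        then have "dist (x s) l < d / 6" "dist (x t) l < d / 6" using c elim by auto
        then have "dist (x s) (x t) < d / 3" using dist_triangle2[of "x s" "x t" l] by linarith
        then show ?thesis using 2 by (simp add: dist_norm min_def)
      next
        case 3
        have "dist l (x t) < d / 6" using c elim by (auto simp: dist_commute)
        then have "dist l (x t) \<le> d / 3" using d(1) by linarith
        then show ?thesis using 3 elim by (simp add: dist_norm min_def)
      qed
    qed
    then have "d_inf T (T, x(T := l)) (t, x) \<le> d / 3 + d / 3"
      by (intro d_inf_least) (use elim in auto)
    moreover have "(t, x) \<in> Lambda_hat T" using x elim by (auto simp: Lambda_hat_def)
    ultimately show ?case using d unfolding TT by fastforce
  qed
qed

subsection \<open>Horizontally constant functionals\<close>

text \<open>
  Functionals that do not change while the path is frozen. Their horizontal derivative is \<open>0\<close>,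
  so that compositions and series only require the vertical derivatives to be followed.
\<close>

definition flat_C2 :: "(real \<times> ('n::finite) path \<Rightarrow> real) \<Rightarrow> (real \<times> 'n path \<Rightarrow> real ^ 'n) \<Rightarrow>
    (real \<times> 'n path \<Rightarrow> real ^ 'n ^ 'n) \<Rightarrow> bool" where
  "flat_C2 u b c \<longleftrightarrow>
     (\<forall>x\<in>cadlag_paths T. \<forall>t\<in>{0..T}. \<forall>s\<in>{t..T}. u (s, stopped T t x) = u (t, x)) \<and>
     (\<forall>i. has_vertical_derivative T i u (\<lambda>p. b p $ i)) \<and>
     (\<forall>i j. has_vertical_derivative T j (\<lambda>p. b p $ i) (\<lambda>p. c p $ i $ j)) \<and>
     cont_wrt (d_inf T) (Lambda_hat T) u \<and>
     cont_wrt (d_inf T) (Lambda_hat T) b \<and>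
     cont_wrt (d_inf T) (Lambda_hat T) c"

lemma flat_C2D:
  assumes "flat_C2 u b c"
  shows "x \<in> cadlag_paths T \<Longrightarrow> t \<in> {0..T} \<Longrightarrow> s \<in> {t..T} \<Longrightarrow> u (s, stopped T t x) = u (t, x)"
    and "(t, x) \<in> Lambda_hat T \<Longrightarrow>
     ((\<lambda>h. u (t, bumped T t (h *\<^sub>R axis i 1) x)) has_real_derivative b (t, x) $ i) (at 0)"
    and "(t, x) \<in> Lambda_hat T \<Longrightarrow>
     ((\<lambda>h. b (t, bumped T t (h *\<^sub>R axis j 1) x) $ i) has_real_derivative c (t, x) $ i $ j) (at 0)"
    and "p \<in> Lambda_hat T \<Longrightarrow> (u \<longlongrightarrow> u p) (nb p)"
    and "p \<in> Lambda_hat T \<Longrightarrow> (b \<longlongrightarrow> b p) (nb p)"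
    and "p \<in> Lambda_hat T \<Longrightarrow> (c \<longlongrightarrow> c p) (nb p)"
  using assms unfolding flat_C2_def has_vertical_iff cont_hat_iff by blast+

lemma flat_C2I:
  assumes "\<And>x t s. x \<in> cadlag_paths T \<Longrightarrow> t \<in> {0..T} \<Longrightarrow> s \<in> {t..T} \<Longrightarrow> u (s, stopped T t x) = u (t, x)"
    and "\<And>t x i. (t, x) \<in> Lambda_hat T \<Longrightarrow>
     ((\<lambda>h. u (t, bumped T t (h *\<^sub>R axis i 1) x)) has_real_derivative b (t, x) $ i) (at 0)"
    and "\<And>t x i j. (t, x) \<in> Lambda_hat T \<Longrightarrow>
     ((\<lambda>h. b (t, bumped T t (h *\<^sub>R axis j 1) x) $ i) has_real_derivative c (t, x) $ i $ j) (at 0)"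
    and "\<And>p. p \<in> Lambda_hat T \<Longrightarrow> (u \<longlongrightarrow> u p) (nb p)"
    and "\<And>p. p \<in> Lambda_hat T \<Longrightarrow> (b \<longlongrightarrow> b p) (nb p)"
    and "\<And>p. p \<in> Lambda_hat T \<Longrightarrow> (c \<longlongrightarrow> c p) (nb p)"
  shows "flat_C2 u b c"
  using assms unfolding flat_C2_def has_vertical_iff cont_hat_iff by blast

lemma flat_C2_const: "flat_C2 (\<lambda>_. k) (\<lambda>_. 0) (\<lambda>_. 0)"
  by (rule flat_C2I) (auto intro!: derivative_eq_intros)

lemma flat_C2_add:
  assumes 1: "flat_C2 u b c" and 2: "flat_C2 u' b' c'"
  shows "flat_C2 (\<lambda>p. u p + u' p) (\<lambda>p. b p + b' p) (\<lambda>p. c p + c' p)"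
  by (rule flat_C2I)
     (auto intro!: derivative_eq_intros tendsto_add flat_C2D[OF 1] flat_C2D[OF 2]
       simp: flat_C2D(1)[OF 1] flat_C2D(1)[OF 2])

lemma flat_C2_sum:
  assumes "finite I" "\<And>i. i \<in> I \<Longrightarrow> flat_C2 (u i) (b i) (c i)"
  shows "flat_C2 (\<lambda>p. \<Sum>i\<in>I. u i p) (\<lambda>p. \<Sum>i\<in>I. b i p) (\<lambda>p. \<Sum>i\<in>I. c i p)"
  using assms
proof (induction I rule: finite_induct)
  case empty then show ?case using flat_C2_const[of 0] by simp
next
  case (insert i I)
  then show ?case using flat_C2_add[of "u i" "b i" "c i"] by simp
qed

lemma flat_C2_compose:
  assumes u: "flat_C2 u b c"
    and F1: "\<And>s. (F has_real_derivative F1 s) (at s)"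
    and F2: "\<And>s. (F1 has_real_derivative F2 s) (at s)"
    and F2c: "continuous_on UNIV F2"
  shows "flat_C2 (\<lambda>p. F (u p)) (\<lambda>p. F1 (u p) *\<^sub>R b p)
    (\<lambda>p. \<chi> i j. F2 (u p) * b p $ i * b p $ j + F1 (u p) * c p $ i $ j)"
proof (rule flat_C2I)
  fix t :: real and x :: "'a path" and i j
  assume tx: "(t, x) \<in> Lambda_hat T"
  note [simp] = bumped_0_hat[OF tx] bumped_0_hat[OF tx, of 0, simplified]
  show "((\<lambda>h. F (u (t, bumped T t (h *\<^sub>R axis i 1) x))) has_real_derivative
     (F1 (u (t, x)) *\<^sub>R b (t, x)) $ i) (at 0)"
    using DERIV_chain2[OF F1 flat_C2D(2)[OF u tx, of i]] by simp
  have "((\<lambda>h. F1 (u (t, bumped T t (h *\<^sub>R axis j 1) x))) has_real_derivative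
     F2 (u (t, x)) * b (t, x) $ j) (at 0)"
    using DERIV_chain2[OF F2 flat_C2D(2)[OF u tx, of j]] by simp
  from DERIV_mult'[OF this flat_C2D(3)[OF u tx, of j i]]
  show "((\<lambda>h. (F1 (u (t, bumped T t (h *\<^sub>R axis j 1) x)) *\<^sub>R b (t, bumped T t (h *\<^sub>R axis j 1) x)) $ i)
     has_real_derivative (\<chi> i j. F2 (u (t, x)) * b (t, x) $ i * b (t, x) $ j + F1 (u (t, x)) * c (t, x) $ i $ j) $ i $ j) (at 0)"
    by (simp add: algebra_simps)
next
  fix p :: "real \<times> 'a path" assume p: "p \<in> Lambda_hat T"
  have c: "isCont F s" "isCont F1 s" "isCont F2 s" for s
    using DERIV_isCont[OF F1] DERIV_isCont[OF F2] F2c by (auto simp: continuous_on_eq_continuous_at)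
  note cc = isCont_tendsto_compose[OF c(1) flat_C2D(4)[OF u p]]
    isCont_tendsto_compose[OF c(2) flat_C2D(4)[OF u p]]
    isCont_tendsto_compose[OF c(3) flat_C2D(4)[OF u p]]
  show "((\<lambda>p. F (u p)) \<longlongrightarrow> F (u p)) (nb p)" by (rule cc)
  show "((\<lambda>p. F1 (u p) *\<^sub>R b p) \<longlongrightarrow> F1 (u p) *\<^sub>R b p) (nb p)"
    by (intro tendsto_scaleR cc flat_C2D(5)[OF u p])
  show "((\<lambda>p. \<chi> i j. F2 (u p) * b p $ i * b p $ j + F1 (u p) * c p $ i $ j) \<longlongrightarrow>
    (\<chi> i j. F2 (u p) * b p $ i * b p $ j + F1 (u p) * c p $ i $ j)) (nb p)"
    by (intro vec_tendstoI)
      (auto intro!: tendsto_add tendsto_mult cc tendsto_vec_nth flat_C2D(5,6)[OF u p])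
qed (use flat_C2D(1)[OF u] in auto)

lemma flat_C2_scale:
  assumes u: "flat_C2 u b c"
  shows "flat_C2 (\<lambda>p. k * u p) (\<lambda>p. k *\<^sub>R b p) (\<lambda>p. k *\<^sub>R c p)"
  by (rule flat_C2I)
     (auto intro!: derivative_eq_intros tendsto_mult tendsto_scaleR tendsto_const flat_C2D[OF u]
       simp: flat_C2D(1)[OF u])

lemma nb_suminf:
  fixes f :: "nat \<Rightarrow> real \<times> ('n::finite) path \<Rightarrow> 'b::banach"
  assumes f: "\<And>k. (f k \<longlongrightarrow> f k p) (nb p)"
    and M: "\<And>k q. q \<in> Lambda_hat T \<Longrightarrow> norm (f k q) \<le> M k" "summable M"
    and p: "p \<in> Lambda_hat T"
  shows "((\<lambda>q. \<Sum>k. f k q) \<longlongrightarrow> (\<Sum>k. f k p)) (nb p)"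
proof (rule swap_uniform_limit')
  show "\<forall>\<^sub>F n in sequentially. ((\<lambda>q. \<Sum>k<n. f k q) \<longlongrightarrow> (\<Sum>k<n. f k p)) (nb p)"
    by (intro always_eventually allI tendsto_sum f)
  have U: "uniform_limit (Lambda_hat T) (\<lambda>n q. \<Sum>k<n. f k q) (\<lambda>q. \<Sum>k. f k q) sequentially"
    by (rule Weierstrass_m_test[OF M])
  show "((\<lambda>n. \<Sum>k<n. f k p) \<longlongrightarrow> (\<Sum>k. f k p)) sequentially"
    by (rule tendsto_uniform_limitI[OF U p])
  show "uniform_limit (Lambda_hat T) (\<lambda>n q. \<Sum>k<n. f k q) (\<lambda>q. \<Sum>k. f k q) sequentially" by (rule U)
  show "\<forall>\<^sub>F q in nb p. q \<in> Lambda_hat T" unfolding eventually_nb by (intro exI[of _ 1]) auto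
qed simp

text \<open>
  Vertical derivatives are derivatives along a line, so the series may be differentiated term by
  term.
\<close>

lemma flat_C2_suminf:
  assumes u: "\<And>k. flat_C2 (u k) (b k) (c k)"
    and M: "\<And>k p. p \<in> Lambda_hat T \<Longrightarrow> \<bar>u k p\<bar> \<le> M k"
       "\<And>k p. p \<in> Lambda_hat T \<Longrightarrow> norm (b k p) \<le> M k"
       "\<And>k p. p \<in> Lambda_hat T \<Longrightarrow> norm (c k p) \<le> M k" "summable M"
  shows "flat_C2 (\<lambda>p. \<Sum>k. u k p) (\<lambda>p. \<Sum>k. b k p) (\<lambda>p. \<Sum>k. c k p)"
proof (rule flat_C2I)
  have sb: "summable (\<lambda>k. b k p)" and sc: "summable (\<lambda>k. c k p)" if "p \<in> Lambda_hat T" for p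
    using M(2,3)[OF that] by (auto intro!: summable_comparison_test'[OF M(4), of 0])
  have bi: "(\<Sum>k. b k p) $ i = (\<Sum>k. b k p $ i)" if "p \<in> Lambda_hat T" for p i
    using bounded_linear.suminf[OF bounded_linear_vec_nth sb[OF that]] by simp
  have ci: "(\<Sum>k. c k p) $ i $ j = (\<Sum>k. c k p $ i $ j)" if "p \<in> Lambda_hat T" for p i j
    using bounded_linear.suminf[OF bounded_linear_compose[OF bounded_linear_vec_nth bounded_linear_vec_nth] sc[OF that]]
    by simp
  have D: "((\<lambda>h. \<Sum>k. f k (t, bumped T t (h *\<^sub>R axis i 1) x)) has_real_derivative (\<Sum>k. f' k (t, x))) (at 0)"
    if tx: "(t, x) \<in> Lambda_hat T" and f: "\<And>k. has_vertical_derivative T i (f k) (f' k)"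
      and B: "\<And>k p. p \<in> Lambda_hat T \<Longrightarrow> \<bar>f k p\<bar> \<le> M k" "\<And>k p. p \<in> Lambda_hat T \<Longrightarrow> \<bar>f' k p\<bar> \<le> M k"
    for f f' :: "nat \<Rightarrow> real \<times> 'a path \<Rightarrow> real" and t x i
  proof -
    have m: "(t, bumped T t (h *\<^sub>R axis i 1) x) \<in> Lambda_hat T" for h
      using tx bumped_cadlag by (auto simp: Lambda_hat_def)
    have "((\<lambda>h. \<Sum>k. f k (t, bumped T t (h *\<^sub>R axis i 1) x)) has_real_derivative
      (\<Sum>k. f' k (t, bumped T t (0 *\<^sub>R axis i 1) x))) (at 0)"
    proof (rule has_field_derivative_series'(2)[where S = UNIV and x0 = 0])
      show "uniformly_convergent_on UNIV (\<lambda>n h. \<Sum>k<n. f' k (t, bumped T t (h *\<^sub>R axis i 1) x))"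
        by (rule Weierstrass_m_test'[OF _ M(4)]) (use B(2)[OF m] in auto)
      show "summable (\<lambda>k. f k (t, bumped T t (0 *\<^sub>R axis i 1) x))"
        by (rule summable_comparison_test'[OF M(4), of 0]) (use B(1)[OF m[of 0]] in simp)
    qed (auto intro: has_verticalD[OF f tx])
    then show ?thesis using bumped_0_hat[OF tx] by simp
  qed
  fix t :: real and x :: "'a path" and i j
  assume tx: "(t, x) \<in> Lambda_hat T"
  have m: "(t, bumped T t (h *\<^sub>R axis j 1) x) \<in> Lambda_hat T" for h
    using tx bumped_cadlag by (auto simp: Lambda_hat_def)
  have le: "\<bar>b k p $ i\<bar> \<le> M k" "\<bar>c k p $ i $ j\<bar> \<le> M k" if "p \<in> Lambda_hat T" for k p i j
    using M(2,3)[OF that] component_le_norm_cart[of "b k p" i] component_le_norm_cart[of "c k p $ i" j]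
      Finite_Cartesian_Product.norm_nth_le[of "c k p" i] by (auto intro: order_trans)
  show "((\<lambda>h. \<Sum>k. u k (t, bumped T t (h *\<^sub>R axis i 1) x)) has_real_derivative (\<Sum>k. b k (t, x)) $ i) (at 0)"
    unfolding bi[OF tx] by (rule D[OF tx]) (use u M le in \<open>auto simp: flat_C2_def\<close>)
  show "((\<lambda>h. (\<Sum>k. b k (t, bumped T t (h *\<^sub>R axis j 1) x)) $ i) has_real_derivative (\<Sum>k. c k (t, x)) $ i $ j) (at 0)"
    unfolding bi[OF m] ci[OF tx]
    by (rule D[OF tx, of j "\<lambda>k p. b k p $ i" "\<lambda>k p. c k p $ i $ j"]) (use u M le in \<open>auto simp: flat_C2_def\<close>)
next
  fix p :: "real \<times> 'a path" assume p: "p \<in> Lambda_hat T"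
  show "((\<lambda>p. \<Sum>k. u k p) \<longlongrightarrow> (\<Sum>k. u k p)) (nb p)"
    by (rule nb_suminf[where M = M]) (use M p flat_C2D(4)[OF u] in auto)
  show "((\<lambda>p. \<Sum>k. b k p) \<longlongrightarrow> (\<Sum>k. b k p)) (nb p)"
    by (rule nb_suminf[where M = M]) (use M p flat_C2D(5)[OF u] in auto)
  show "((\<lambda>p. \<Sum>k. c k p) \<longlongrightarrow> (\<Sum>k. c k p)) (nb p)"
    by (rule nb_suminf[where M = M]) (use M p flat_C2D(6)[OF u] in auto)
qed (use flat_C2D(1)[OF u] in auto)

subsection \<open>Test functions\<close>

text \<open>
  Polynomial growth with one fixed exponent is stable under sums without comparing exponents.
  The gauge is of fourth order in the path.
\<close>

definition quartic :: "(real \<times> ('n::finite) path \<Rightarrow> 'b::real_normed_vector) \<Rightarrow> bool" where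
  "quartic f \<longleftrightarrow> (\<exists>K. \<forall>p\<in>Lambda T. norm (f p) \<le> K * (1 + sup_norm T (snd p)) ^ 4)"

lemma Lambda_sup_norm_nonneg: "p \<in> Lambda T \<Longrightarrow> 0 \<le> sup_norm T (snd p)"
  by (rule sup_norm_nonneg, rule subsetD[OF cont_cadlag]) (auto simp: Lambda_def)

lemma quarticI: "(\<And>p. p \<in> Lambda T \<Longrightarrow> norm (f p) \<le> K * (1 + sup_norm T (snd p)) ^ 4) \<Longrightarrow> quartic f"
  unfolding quartic_def by blast

lemma quartic_bounded:
  assumes "\<And>p. p \<in> Lambda T \<Longrightarrow> norm (f p) \<le> K" shows "quartic f"
proof (rule quarticI)
  fix p :: "real \<times> 'a path" assume p: "p \<in> Lambda T"
  have "norm (f p) \<le> \<bar>K\<bar> * 1" using assms[OF p] by simp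
  also have "\<dots> \<le> \<bar>K\<bar> * (1 + sup_norm T (snd p)) ^ 4"
    using Lambda_sup_norm_nonneg[OF p] by (intro mult_left_mono one_le_power) auto
  finally show "norm (f p) \<le> \<bar>K\<bar> * (1 + sup_norm T (snd p)) ^ 4" .
qed

lemma quartic_add:
  assumes "quartic f" "quartic g" shows "quartic (\<lambda>p. f p + g p)"
proof -
  obtain K K' where K: "\<And>p. p \<in> Lambda T \<Longrightarrow> norm (f p) \<le> K * (1 + sup_norm T (snd p)) ^ 4"
    "\<And>p. p \<in> Lambda T \<Longrightarrow> norm (g p) \<le> K' * (1 + sup_norm T (snd p)) ^ 4"
    using assms by (auto simp: quartic_def)
  show ?thesis
  proof (rule quarticI[of _ "K + K'"])
    fix p :: "real \<times> 'a path" assume p: "p \<in> Lambda T"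
    show "norm (f p + g p) \<le> (K + K') * (1 + sup_norm T (snd p)) ^ 4"
      using norm_triangle_ineq[of "f p" "g p"] K(1)[OF p] K(2)[OF p] unfolding distrib_right by linarith
  qed
qed

lemma quartic_scale:
  assumes f: "quartic f" and k: "\<And>t. t \<in> {0..T} \<Longrightarrow> \<bar>k t\<bar> \<le> B"
  shows "quartic (\<lambda>p. k (fst p) *\<^sub>R f p)"
proof -
  obtain K where K: "\<And>p. p \<in> Lambda T \<Longrightarrow> norm (f p) \<le> K * (1 + sup_norm T (snd p)) ^ 4"
    using f by (auto simp: quartic_def)
  show ?thesis
  proof (rule quarticI[of _ "B * K"])
    fix p :: "real \<times> 'a path" assume p: "p \<in> Lambda T"
    then have "\<bar>k (fst p)\<bar> \<le> B" using k by (auto simp: Lambda_def)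
    then have "\<bar>k (fst p)\<bar> * norm (f p) \<le> B * (K * (1 + sup_norm T (snd p)) ^ 4)"
      by (intro mult_mono K[OF p]) auto
    then show "norm (k (fst p) *\<^sub>R f p) \<le> B * K * (1 + sup_norm T (snd p)) ^ 4"
      by (simp add: mult.assoc)
  qed
qed

lemma quartic_cong: "(\<And>p. p \<in> Lambda T \<Longrightarrow> f p = g p) \<Longrightarrow> quartic f \<longleftrightarrow> quartic g"
  by (simp add: quartic_def)

lemma quartic_poly_growth:
  assumes "quartic f" shows "poly_growth T f"
proof -
  obtain K where K: "\<And>p. p \<in> Lambda T \<Longrightarrow> norm (f p) \<le> K * (1 + sup_norm T (snd p)) ^ 4"
    using assms by (auto simp: quartic_def)
  have main: "norm (f p) \<le> (16 * \<bar>K\<bar> + 1) * (1 + sup_norm T (snd p) powr 4)"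
    if p: "p \<in> Lambda T" for p
  proof -
    define S where "S = sup_norm T (snd p)"
    have S: "S \<ge> 0" using Lambda_sup_norm_nonneg[OF p] by (simp add: S_def)
    have p4: "(1 + S) ^ 4 \<le> 16 * (1 + S ^ 4)"
    proof (cases "S \<le> 1")
      case True
      have "(1 + S) ^ 4 \<le> 2 ^ 4" by (rule power_mono) (use S True in auto)
      also have "\<dots> = 16 * 1" by simp
      also have "\<dots> \<le> 16 * (1 + S ^ 4)" using zero_le_power[OF S, of 4] by (intro mult_left_mono) auto
      finally show ?thesis .
    next
      case False
      have "(1 + S) ^ 4 \<le> (2 * S) ^ 4" by (rule power_mono) (use S False in auto)
      also have "\<dots> = 16 * S ^ 4" by (simp add: power_mult_distrib)
      also have "\<dots> \<le> 16 * (1 + S ^ 4)" by (intro mult_left_mono) auto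
      finally show ?thesis .
    qed
    have "norm (f p) \<le> K * (1 + S) ^ 4" using K[OF p] by (simp add: S_def)
    also have "\<dots> \<le> \<bar>K\<bar> * (1 + S) ^ 4" using S by (intro mult_right_mono zero_le_power) auto
    also have "\<dots> \<le> \<bar>K\<bar> * (16 * (1 + S ^ 4))" by (intro mult_left_mono p4) auto
    also have "\<dots> = (16 * \<bar>K\<bar>) * (1 + S ^ 4)" by (simp only: ac_simps)
    also have "\<dots> \<le> (16 * \<bar>K\<bar> + 1) * (1 + S ^ 4)"
      using zero_le_power[OF S, of 4] by (intro mult_right_mono) auto
    also have "S ^ 4 = S powr 4" using S by simp
    finally show ?thesis unfolding S_def .
  qed
  show ?thesis unfolding poly_growth_def
  proof (rule exI[of _ "16 * \<bar>K\<bar> + 1"], rule conjI)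
    show "\<exists>q>0. \<forall>(t, x)\<in>Lambda T. norm (f (t, x)) \<le> (16 * \<bar>K\<bar> + 1) * (1 + sup_norm T x powr q)"
      using main by (intro exI[of _ 4]) (simp add: split_beta)
  qed linarith
qed

text \<open>
  The test functions: admissible in the definition of viscosity solutions, and closed under the
  operations below.
\<close>

definition smooth :: "(real \<times> ('n::finite) path \<Rightarrow> real) \<Rightarrow> (real \<times> 'n path \<Rightarrow> real) \<Rightarrow>
    (real \<times> 'n path \<Rightarrow> real ^ 'n) \<Rightarrow> (real \<times> 'n path \<Rightarrow> real ^ 'n ^ 'n) \<Rightarrow> bool" where
  "smooth u a b c \<longleftrightarrow> C12_hat T u a b c \<and> quartic u \<and> quartic a \<and> quartic b \<and> quartic c"

lemma smooth_C12_pol: "smooth u a b c \<Longrightarrow> C12_pol T u a b c"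
  unfolding smooth_def C12_pol_def C12_def
  by (elim conjE, intro conjI quartic_poly_growth exI[of _ u] exI[of _ a] exI[of _ b] exI[of _ c]) auto

lemma C12_hatI:
  assumes "\<And>x t. x \<in> cadlag_paths T \<Longrightarrow> t \<in> {0..<T} \<Longrightarrow>
      ((\<lambda>\<delta>. (u (t + \<delta>, stopped T t x) - u (t, x)) / \<delta>) \<longlongrightarrow> a (t, x)) (at_right 0)"
    and "\<And>x. x \<in> cadlag_paths T \<Longrightarrow> ((\<lambda>t. a (t, x)) \<longlongrightarrow> a (T, x)) (at_left T)"
    and "\<And>t x i. (t, x) \<in> Lambda_hat T \<Longrightarrow>
     ((\<lambda>h. u (t, bumped T t (h *\<^sub>R axis i 1) x)) has_real_derivative b (t, x) $ i) (at 0)"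
    and "\<And>t x i j. (t, x) \<in> Lambda_hat T \<Longrightarrow>
     ((\<lambda>h. b (t, bumped T t (h *\<^sub>R axis j 1) x) $ i) has_real_derivative c (t, x) $ i $ j) (at 0)"
    and "\<And>p. p \<in> Lambda_hat T \<Longrightarrow> (u \<longlongrightarrow> u p) (nb p)"
    and "\<And>p. p \<in> Lambda_hat T \<Longrightarrow> (a \<longlongrightarrow> a p) (nb p)"
    and "\<And>p. p \<in> Lambda_hat T \<Longrightarrow> (b \<longlongrightarrow> b p) (nb p)"
    and "\<And>p. p \<in> Lambda_hat T \<Longrightarrow> (c \<longlongrightarrow> c p) (nb p)"
  shows "C12_hat T u a b c"
  using assms unfolding C12_hat_def has_horizontal_derivative_def has_vertical_iff cont_hat_iff by blast

lemma C12_hatD: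
  assumes "C12_hat T u a b c"
  shows "x \<in> cadlag_paths T \<Longrightarrow> t \<in> {0..<T} \<Longrightarrow>
      ((\<lambda>\<delta>. (u (t + \<delta>, stopped T t x) - u (t, x)) / \<delta>) \<longlongrightarrow> a (t, x)) (at_right 0)"
    and "x \<in> cadlag_paths T \<Longrightarrow> ((\<lambda>t. a (t, x)) \<longlongrightarrow> a (T, x)) (at_left T)"
    and "(t, x) \<in> Lambda_hat T \<Longrightarrow>
     ((\<lambda>h. u (t, bumped T t (h *\<^sub>R axis i 1) x)) has_real_derivative b (t, x) $ i) (at 0)"
    and "(t, x) \<in> Lambda_hat T \<Longrightarrow>
     ((\<lambda>h. b (t, bumped T t (h *\<^sub>R axis j 1) x) $ i) has_real_derivative c (t, x) $ i $ j) (at 0)"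
    and "p \<in> Lambda_hat T \<Longrightarrow> (u \<longlongrightarrow> u p) (nb p)"
    and "p \<in> Lambda_hat T \<Longrightarrow> (a \<longlongrightarrow> a p) (nb p)"
    and "p \<in> Lambda_hat T \<Longrightarrow> (b \<longlongrightarrow> b p) (nb p)"
    and "p \<in> Lambda_hat T \<Longrightarrow> (c \<longlongrightarrow> c p) (nb p)"
  using assms unfolding C12_hat_def has_horizontal_derivative_def has_vertical_iff cont_hat_iff by blast+

lemma flat_C2_C12_hat:
  assumes u: "flat_C2 u b c" shows "C12_hat T u (\<lambda>_. 0) b c"
proof (rule C12_hatI)
  fix x :: "'a path" and t assume x: "x \<in> cadlag_paths T" and t: "t \<in> {0..<T}"
  have "eventually (\<lambda>\<delta>. 0 = (u (t + \<delta>, stopped T t x) - u (t, x)) / \<delta>) (at_right 0)"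
    unfolding eventually_at_right_field using t
    by (intro exI[of _ "T - t"]) (auto simp: flat_C2D(1)[OF u x])
  then show "((\<lambda>\<delta>. (u (t + \<delta>, stopped T t x) - u (t, x)) / \<delta>) \<longlongrightarrow> 0) (at_right 0)"
    by (rule Lim_transform_eventually[OF tendsto_const])
qed (simp_all add: flat_C2D(2-6)[OF u])

lemma smooth_flat:
  assumes "flat_C2 u b c" "quartic u" "quartic b" "quartic c"
  shows "smooth u (\<lambda>_. 0) b c"
  unfolding smooth_def
  by (intro conjI flat_C2_C12_hat[OF assms(1)] assms(2-4) quartic_bounded[of _ 0]) simp

lemma smooth_const: "smooth (\<lambda>_. k) (\<lambda>_. 0) (\<lambda>_. 0) (\<lambda>_. 0)"
  by (intro smooth_flat flat_C2_const quartic_bounded) (rule order_refl)+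

lemma smooth_add:
  assumes 1: "smooth u a b c" and 2: "smooth u' a' b' c'"
  shows "smooth (\<lambda>p. u p + u' p) (\<lambda>p. a p + a' p) (\<lambda>p. b p + b' p) (\<lambda>p. c p + c' p)"
proof -
  have 1: "C12_hat T u a b c" "quartic u" "quartic a" "quartic b" "quartic c"
    and 2: "C12_hat T u' a' b' c'" "quartic u'" "quartic a'" "quartic b'" "quartic c'"
    using assms by (auto simp: smooth_def)
  have "C12_hat T (\<lambda>p. u p + u' p) (\<lambda>p. a p + a' p) (\<lambda>p. b p + b' p) (\<lambda>p. c p + c' p)"
  proof (rule C12_hatI)
    fix x :: "'a path" and t assume x: "x \<in> cadlag_paths T" and t: "t \<in> {0..<T}"
    show "((\<lambda>\<delta>. (u (t + \<delta>, stopped T t x) + u' (t + \<delta>, stopped T t x) - (u (t, x) + u' (t, x))) / \<delta>)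
       \<longlongrightarrow> a (t, x) + a' (t, x)) (at_right 0)"
      using tendsto_add[OF C12_hatD(1)[OF 1(1) x t] C12_hatD(1)[OF 2(1) x t]]
      by (simp add: add_divide_distrib[symmetric] algebra_simps)
  next
    fix t x i j assume tx: "(t, x :: 'a path) \<in> Lambda_hat T"
    show "((\<lambda>h. u (t, bumped T t (h *\<^sub>R axis i 1) x) + u' (t, bumped T t (h *\<^sub>R axis i 1) x))
      has_real_derivative (b (t, x) + b' (t, x)) $ i) (at 0)"
      using DERIV_add[OF C12_hatD(3)[OF 1(1) tx] C12_hatD(3)[OF 2(1) tx]] by simp
    show "((\<lambda>h. (b (t, bumped T t (h *\<^sub>R axis j 1) x) + b' (t, bumped T t (h *\<^sub>R axis j 1) x)) $ i)
      has_real_derivative (c (t, x) + c' (t, x)) $ i $ j) (at 0)"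
      using DERIV_add[OF C12_hatD(4)[OF 1(1) tx] C12_hatD(4)[OF 2(1) tx]] by simp
  qed (intro tendsto_add C12_hatD[OF 1(1)] C12_hatD[OF 2(1)], assumption+)+
  then show ?thesis using 1 2 by (simp add: smooth_def quartic_add)
qed

lemma smooth_sum:
  assumes "finite I" "\<And>i. i \<in> I \<Longrightarrow> smooth (u i) (a i) (b i) (c i)"
  shows "smooth (\<lambda>p. \<Sum>i\<in>I. u i p) (\<lambda>p. \<Sum>i\<in>I. a i p) (\<lambda>p. \<Sum>i\<in>I. b i p) (\<lambda>p. \<Sum>i\<in>I. c i p)"
  using assms
proof (induction I rule: finite_induct)
  case empty then show ?case using smooth_const[of 0] by simp
next
  case (insert i I)
  then show ?case using smooth_add[of "u i" "a i" "b i" "c i"] by simp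
qed

text \<open>
  The product rule in time. At the terminal time the horizontal derivative is a left limit along
  the path, so the factor of \<open>k'\<close> there is the left limit of \<open>u\<close> along the path; this differs
  from \<open>u\<close> when the path jumps at \<open>T\<close>, hence \<open>unjump\<close>.
\<close>

lemma smooth_time_mult:
  assumes u: "smooth u a b c"
    and k: "\<And>t. t \<in> {0..T} \<Longrightarrow> (k has_real_derivative k' t) (at t within {0..T})"
    and k': "continuous_on {0..T} k'"
  shows "smooth (\<lambda>p. k (fst p) * u p) (\<lambda>p. k' (fst p) * u (unjump p) + k (fst p) * a p)
    (\<lambda>p. k (fst p) *\<^sub>R b p) (\<lambda>p. k (fst p) *\<^sub>R c p)"
proof -
  have h: "C12_hat T u a b c" and q: "quartic u" "quartic a" "quartic b" "quartic c"
    using u by (auto simp: smooth_def)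
  have kc: "continuous_on {0..T} k" using k DERIV_continuous_on by blast
  have "C12_hat T (\<lambda>p. k (fst p) * u p) (\<lambda>p. k' (fst p) * u (unjump p) + k (fst p) * a p)
    (\<lambda>p. k (fst p) *\<^sub>R b p) (\<lambda>p. k (fst p) *\<^sub>R c p)"
  proof (rule C12_hatI)
    fix x :: "'a path" and t assume x: "x \<in> cadlag_paths T" and t: "t \<in> {0..<T}"
    have t': "t \<in> {0..T}" using t by auto
    have r: "at t within {t..T} = at_right t" using t by (intro at_within_Icc_at_right) auto
    have "((\<lambda>s. (k s - k t) / (s - t)) \<longlongrightarrow> k' t) (at t within {0..T})"
      using k[OF t'] by (simp add: has_field_derivative_iff)
    then have "((\<lambda>s. (k s - k t) / (s - t)) \<longlongrightarrow> k' t) (at t within {t..T})"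
      by (rule tendsto_within_subset) (use t in auto)
    then have q1: "((\<lambda>\<delta>. (k (\<delta> + t) - k t) / \<delta>) \<longlongrightarrow> k' t) (at_right 0)"
      unfolding r filterlim_at_right_to_0[of _ _ t] by simp
    have "(k \<longlongrightarrow> k t) (at t within {0..T})" using kc t' by (simp add: continuous_on_def)
    then have "(k \<longlongrightarrow> k t) (at t within {t..T})"
      by (rule tendsto_within_subset) (use t in auto)
    then have q2: "((\<lambda>\<delta>. k (\<delta> + t)) \<longlongrightarrow> k t) (at_right 0)"
      unfolding r filterlim_at_right_to_0[of _ _ t] by simp
    have "unjump (t, x) = (t, x)" using t by (simp add: unjump_def)
    moreover have "((\<lambda>\<delta>. (k (\<delta> + t) - k t) / \<delta> * u (t, x) + k (\<delta> + t) * ((u (t + \<delta>, stopped T t x) - u (t, x)) / \<delta>))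
       \<longlongrightarrow> k' t * u (t, x) + k t * a (t, x)) (at_right 0)"
      by (intro tendsto_add tendsto_mult tendsto_const q1 q2 C12_hatD(1)[OF h x t])
    moreover have "(\<lambda>\<delta>. (k (\<delta> + t) - k t) / \<delta> * u (t, x) + k (\<delta> + t) * ((u (t + \<delta>, stopped T t x) - u (t, x)) / \<delta>))
       = (\<lambda>\<delta>. (k (t + \<delta>) * u (t + \<delta>, stopped T t x) - k t * u (t, x)) / \<delta>)"
      by (rule ext) (simp add: add.commute algebra_simps diff_divide_distrib)
    ultimately show "((\<lambda>\<delta>. (k (fst (t + \<delta>, stopped T t x)) * u (t + \<delta>, stopped T t x) - k (fst (t, x)) * u (t, x)) / \<delta>)
       \<longlongrightarrow> k' (fst (t, x)) * u (unjump (t, x)) + k (fst (t, x)) * a (t, x)) (at_right 0)"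
      by simp
  next
    fix x :: "'a path" assume x: "x \<in> cadlag_paths T"
    have uc: "cont_wrt (d_inf T) (Lambda_hat T) u" using h by (simp add: C12_hat_def)
    have "((\<lambda>t. k' t * u (t, x) + k t * a (t, x)) \<longlongrightarrow> k' T * u (unjump (T, x)) + k T * a (T, x)) (at_left T)"
      by (intro tendsto_add tendsto_mult tendsto_left_unjump[OF uc x] C12_hatD(2)[OF h x]
          continuous_on_Icc_at_leftD[OF kc T_pos] continuous_on_Icc_at_leftD[OF k' T_pos])
    moreover have "eventually (\<lambda>t. k' t * u (t, x) + k t * a (t, x) =
       k' (fst (t, x)) * u (unjump (t, x)) + k (fst (t, x)) * a (t, x)) (at_left T)"
      using at_left_T by eventually_elim (simp add: unjump_def)
    ultimately show "((\<lambda>t. k' (fst (t, x)) * u (unjump (t, x)) + k (fst (t, x)) * a (t, x)) \<longlongrightarrow>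
      k' (fst (T, x)) * u (unjump (T, x)) + k (fst (T, x)) * a (T, x)) (at_left T)"
      by (rule Lim_transform_eventually[THEN tendsto_eq_rhs]) simp_all
  next
    fix p :: "real \<times> 'a path" assume p: "p \<in> Lambda_hat T"
    have uc: "cont_wrt (d_inf T) (Lambda_hat T) u" using h by (simp add: C12_hat_def)
    show "((\<lambda>p. k' (fst p) * u (unjump p) + k (fst p) * a p) \<longlongrightarrow> k' (fst p) * u (unjump p) + k (fst p) * a p) (nb p)"
      by (intro tendsto_add tendsto_mult tendsto_time_fun_nb[OF k' p] tendsto_time_fun_nb[OF kc p] tendsto_unjump[OF uc p] C12_hatD(6)[OF h p])
    show "((\<lambda>p. k (fst p) * u p) \<longlongrightarrow> k (fst p) * u p) (nb p)"
      by (intro tendsto_mult tendsto_time_fun_nb[OF kc p] C12_hatD(5)[OF h p])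
    show "((\<lambda>p. k (fst p) *\<^sub>R b p) \<longlongrightarrow> k (fst p) *\<^sub>R b p) (nb p)"
      by (intro tendsto_scaleR tendsto_time_fun_nb[OF kc p] C12_hatD(7)[OF h p])
    show "((\<lambda>p. k (fst p) *\<^sub>R c p) \<longlongrightarrow> k (fst p) *\<^sub>R c p) (nb p)"
      by (intro tendsto_scaleR tendsto_time_fun_nb[OF kc p] C12_hatD(8)[OF h p])
  next
    fix t x i j assume tx: "(t, x :: 'a path) \<in> Lambda_hat T"
    show "((\<lambda>h. k (fst (t, bumped T t (h *\<^sub>R axis i 1) x)) * u (t, bumped T t (h *\<^sub>R axis i 1) x)) has_real_derivative
      (k (fst (t, x)) *\<^sub>R b (t, x)) $ i) (at 0)"
      using DERIV_cmult[OF C12_hatD(3)[OF h tx, of i]] by simp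
    show "((\<lambda>h. (k (fst (t, bumped T t (h *\<^sub>R axis j 1) x)) *\<^sub>R b (t, bumped T t (h *\<^sub>R axis j 1) x)) $ i) has_real_derivative
      (k (fst (t, x)) *\<^sub>R c (t, x)) $ i $ j) (at 0)"
      using DERIV_cmult[OF C12_hatD(4)[OF h tx, of j i]] by simp
  qed
  moreover have bk: "\<exists>B. \<forall>t\<in>{0..T}. \<bar>f t\<bar> \<le> B" if "continuous_on {0..T} f" for f :: "real \<Rightarrow> real"
    using compact_imp_bounded[OF compact_continuous_image[OF that compact_Icc]] by (auto simp: bounded_iff)
  obtain B where B: "\<And>t. t \<in> {0..T} \<Longrightarrow> \<bar>k t\<bar> \<le> B" using bk[OF kc] by blast
  obtain B' where B': "\<And>t. t \<in> {0..T} \<Longrightarrow> \<bar>k' t\<bar> \<le> B'" using bk[OF k'] by blast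
  have "quartic (\<lambda>p. k' (fst p) * u p + k (fst p) * a p)"
    using quartic_add[OF quartic_scale[OF q(1) B'] quartic_scale[OF q(2) B]] by simp
  then have "quartic (\<lambda>p. k' (fst p) * u (unjump p) + k (fst p) * a p)"
    by (subst quartic_cong[of _ "\<lambda>p. k' (fst p) * u p + k (fst p) * a p"]) (simp_all add: unjump_Lambda)
  moreover have "quartic (\<lambda>p. k (fst p) * u p)" "quartic (\<lambda>p. k (fst p) *\<^sub>R b p)" "quartic (\<lambda>p. k (fst p) *\<^sub>R c p)"
    using quartic_scale[OF q(1) B] quartic_scale[OF q(3) B]
      quartic_scale[OF q(4) B] by simp_all
  ultimately show ?thesis by (simp add: smooth_def)
qed

lemma smooth_time:
  assumes k: "\<And>t. t \<in> {0..T} \<Longrightarrow> (k has_real_derivative k' t) (at t within {0..T})"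
    and k': "continuous_on {0..T} k'"
  shows "smooth (\<lambda>p. k (fst p)) (\<lambda>p. k' (fst p)) (\<lambda>_. 0) (\<lambda>_. 0)"
  using smooth_time_mult[OF smooth_const[of 1] assms] by simp

lemma smooth_scale:
  assumes "smooth u a b c"
  shows "smooth (\<lambda>p. k * u p) (\<lambda>p. k * a p) (\<lambda>p. k *\<^sub>R b p) (\<lambda>p. k *\<^sub>R c p)"
  using smooth_time_mult[OF assms, of "\<lambda>_. k" "\<lambda>_. 0"] by simp

section \<open>Linear functionals of the stopped path\<close>

text \<open>
  Functions of class \<open>C\<^sup>1\<close>, paired with their derivative for use in integrations by parts.
\<close>

definition primitive :: "(real \<Rightarrow> 'b::real_normed_vector) \<Rightarrow> (real \<Rightarrow> 'b) \<Rightarrow> bool" where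
  "primitive f g \<longleftrightarrow> continuous_on {0..T} g \<and>
     (\<forall>t\<in>{0..T}. (f has_vector_derivative g t) (at t within {0..T}))"

lemma primitiveD:
  assumes "primitive f g"
  shows "continuous_on {0..T} g" "t \<in> {0..T} \<Longrightarrow> (f has_vector_derivative g t) (at t within {0..T})"
    "continuous_on {0..T} f"
proof -
  show 1: "continuous_on {0..T} g" "t \<in> {0..T} \<Longrightarrow> (f has_vector_derivative g t) (at t within {0..T})" for t
    using assms by (auto simp: primitive_def)
  show "continuous_on {0..T} f"
    unfolding continuous_on_eq_continuous_within
    using 1(2) has_vector_derivative_continuous by blast
qed

lemma primitive_integral:
  fixes f :: "real \<Rightarrow> 'b::banach"
  assumes "primitive f g" "0 \<le> s" "s \<le> t" "t \<le> T"
  shows "(g has_integral f t - f s) {s..t}"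
proof (rule fundamental_theorem_of_calculus[OF assms(3)])
  fix r assume r: "r \<in> {s..t}"
  have "(f has_vector_derivative g r) (at r within {0..T})"
    using primitiveD(2)[OF assms(1)] r assms by auto
  then show "(f has_vector_derivative g r) (at r within {s..t})"
    by (rule has_vector_derivative_within_subset) (use assms in auto)
qed

text \<open>
  Integration by parts of \<open>f 0 \<bullet> x 0\<close> plus the integral of \<open>f\<close> against \<open>dx\<close>, with \<open>g\<close> the
  derivative of \<open>f\<close>: in this form it makes sense for every right-continuous path with left
  limits.
\<close>

definition ell :: "(real \<Rightarrow> real ^ 'n) \<Rightarrow> (real \<Rightarrow> real ^ 'n) \<Rightarrow> ('n::finite) path \<Rightarrow> real" where
  "ell f g x = f T \<bullet> x T - integral {0..T} (\<lambda>s. g s \<bullet> x s)"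

lemma ell_stopped:
  assumes fg: "primitive f g" and x: "x \<in> cadlag_paths T" and t: "t \<in> {0..T}"
  shows "ell f g (stopped T t x) = f t \<bullet> x t - integral {0..t} (\<lambda>s. g s \<bullet> x s)"
proof -
  let ?h = "\<lambda>s. g s \<bullet> stopped T t x s"
  have "?h integrable_on {0..T}"
    by (rule cadlag_inner_integrable[OF stopped_cadlag[OF x t] primitiveD(1)[OF fg]]) (use T_pos in auto)
  then have "integral {0..T} ?h = integral {0..t} ?h + integral {t..T} ?h"
    using t by (simp add: Henstock_Kurzweil_Integration.integral_combine)
  also have "integral {0..t} ?h = integral {0..t} (\<lambda>s. g s \<bullet> x s)"
    by (rule Henstock_Kurzweil_Integration.integral_cong) (use t in \<open>auto simp: stopped_apply min_def\<close>)
  also have "integral {t..T} ?h = integral {t..T} (\<lambda>s. g s \<bullet> x t)"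
    by (rule Henstock_Kurzweil_Integration.integral_cong) (use t in \<open>auto simp: stopped_apply min_def\<close>)
  also have "\<dots> = (f T - f t) \<bullet> x t"
    using has_integral_linear[OF primitive_integral[OF fg, of t T] bounded_linear_inner_left[of "x t"]] t
    by (auto simp: o_def intro: integral_unique)
  finally show ?thesis
    using t T_pos by (simp add: ell_def stopped_apply inner_diff_left min_absorb2)
qed

lemma ell_bumped:
  assumes fg: "primitive f g" and x: "x \<in> cadlag_paths T" and t: "t \<in> {0..T}"
  shows "ell f g (stopped T t (bumped T t v x)) = ell f g (stopped T t x) + f t \<bullet> v"
proof -
  have "integral {0..t} (\<lambda>s. g s \<bullet> bumped T t v x s) = integral {0..t} (\<lambda>s. g s \<bullet> x s)"
    by (rule integral_spike[of "{t}"]) (use t in \<open>auto simp: bumped_apply\<close>)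
  then show ?thesis
    using t by (simp add: ell_stopped[OF fg] bumped_cadlag[OF x t] x bumped_apply inner_add_right)
qed

lemma ell_lipschitz:
  assumes fg: "primitive f g"
  shows "\<exists>C\<ge>0. \<forall>x\<in>cadlag_paths T. \<forall>y\<in>cadlag_paths T. \<bar>ell f g x - ell f g y\<bar> \<le> C * sup_dist T x y"
proof -
  have "bounded (g ` {0..T})"
    by (rule compact_imp_bounded[OF compact_continuous_image[OF primitiveD(1)[OF fg] compact_Icc]])
  then obtain B where B: "\<And>s. s \<in> {0..T} \<Longrightarrow> norm (g s) \<le> B" unfolding bounded_iff by blast
  have B0: "0 \<le> B" by (rule order_trans[OF norm_ge_zero B[of 0]]) (use T_pos in simp)
  show ?thesis
  proof (intro exI[of _ "norm (f T) + B * T"] conjI ballI)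
    show "0 \<le> norm (f T) + B * T" using B0 T_pos by simp
    fix x y :: "'a path" assume x: "x \<in> cadlag_paths T" and y: "y \<in> cadlag_paths T"
    let ?D = "sup_dist T x y"
    note up = sup_dist_upper[OF x y]
    have D0: "0 \<le> ?D" by (rule order_trans[OF norm_ge_zero up[of 0]]) (use T_pos in simp)
    have ix: "(\<lambda>s. g s \<bullet> x s) integrable_on {0..T}" "(\<lambda>s. g s \<bullet> y s) integrable_on {0..T}"
      using cadlag_inner_integrable[OF x primitiveD(1)[OF fg], of T]
        cadlag_inner_integrable[OF y primitiveD(1)[OF fg], of T] T_pos by auto
    have "((\<lambda>s. g s \<bullet> x s - g s \<bullet> y s) has_integral
      (integral {0..T} (\<lambda>s. g s \<bullet> x s) - integral {0..T} (\<lambda>s. g s \<bullet> y s))) (cbox 0 T)"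
      using has_integral_diff[OF integrable_integral[OF ix(1)] integrable_integral[OF ix(2)]]
      by (simp add: cbox_interval)
    then have "norm (integral {0..T} (\<lambda>s. g s \<bullet> x s) - integral {0..T} (\<lambda>s. g s \<bullet> y s))
       \<le> (B * ?D) * measure lborel (cbox 0 T)"
    proof (rule has_integral_bound[rotated])
      show "0 \<le> B * ?D" using B0 D0 by simp
      fix s assume s: "s \<in> cbox 0 T"
      have "norm (g s \<bullet> (x s - y s)) \<le> norm (g s) * norm (x s - y s)"
        by (simp add: Cauchy_Schwarz_ineq2)
      also have "\<dots> \<le> B * ?D" using B up s B0 by (intro mult_mono) auto
      finally show "norm (g s \<bullet> x s - g s \<bullet> y s) \<le> B * ?D" by (simp add: inner_diff_right)
    qed
    then have i: "\<bar>integral {0..T} (\<lambda>s. g s \<bullet> x s) - integral {0..T} (\<lambda>s. g s \<bullet> y s)\<bar> \<le> B * T * ?D"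
      using T_pos by (simp add: ac_simps)
    have "\<bar>f T \<bullet> (x T - y T)\<bar> \<le> norm (f T) * norm (x T - y T)" by (rule Cauchy_Schwarz_ineq2)
    also have "\<dots> \<le> norm (f T) * ?D" using up[of T] T_pos by (intro mult_left_mono) auto
    finally have "\<bar>f T \<bullet> x T - f T \<bullet> y T\<bar> \<le> norm (f T) * ?D" by (simp add: inner_diff_right)
    then show "\<bar>ell f g x - ell f g y\<bar> \<le> (norm (f T) + B * T) * ?D"
      using i unfolding ell_def distrib_right by linarith
  qed
qed

lemma sup_dist_d_inf:
  assumes "p \<in> Lambda_hat T" "q \<in> Lambda_hat T"
  shows "sup_dist T (stopped T (fst q) (snd q)) (stopped T (fst p) (snd p)) \<le> d_inf T p q"
proof (rule sup_dist_least)
  fix s assume s: "s \<in> {0..T}"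
  show "norm (stopped T (fst q) (snd q) s - stopped T (fst p) (snd p) s) \<le> d_inf T p q"
    using d_inf_upper[of "fst p" "snd p" "fst q" "snd q" s] assms s
    by (simp add: stopped_apply norm_minus_commute)
qed

text \<open>
  A frozen path has no increments, and a jump by \<open>v\<close> at time \<open>t\<close> contributes \<open>f t \<bullet> v\<close>.
\<close>

lemma flat_C2_ell:
  assumes fg: "primitive f g"
  shows "flat_C2 (\<lambda>p. ell f g (stopped T (fst p) (snd p))) (\<lambda>p. f (fst p)) (\<lambda>_. 0)"
proof (rule flat_C2I)
  fix x :: "'a path" and t s assume "x \<in> cadlag_paths T" "t \<in> {0..T}" "s \<in> {t..T}"
  then show "ell f g (stopped T (fst (s, stopped T t x)) (snd (s, stopped T t x))) =
     ell f g (stopped T (fst (t, x)) (snd (t, x)))"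
    by (simp add: stopped_stopped min_absorb2)
next
  fix t :: real and x :: "'a path" and i j assume tx: "(t, x) \<in> Lambda_hat T"
  then have x: "x \<in> cadlag_paths T" and t: "t \<in> {0..T}" by (auto simp: Lambda_hat_def)
  have "((\<lambda>h. ell f g (stopped T t x) + f t \<bullet> (h *\<^sub>R axis i 1)) has_real_derivative f t $ i) (at 0)"
    by (auto intro!: derivative_eq_intros simp: inner_axis)
  then show "((\<lambda>h. ell f g (stopped T (fst (t, bumped T t (h *\<^sub>R axis i 1) x))
      (snd (t, bumped T t (h *\<^sub>R axis i 1) x)))) has_real_derivative f (fst (t, x)) $ i) (at 0)"
    by (simp add: ell_bumped[OF fg x t])
next
  fix p :: "real \<times> 'a path" assume p: "p \<in> Lambda_hat T"
  obtain C where C: "C \<ge> 0" "\<And>x y. x \<in> cadlag_paths T \<Longrightarrow> y \<in> cadlag_paths T \<Longrightarrow>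
     \<bar>ell f g x - ell f g y\<bar> \<le> C * sup_dist T x y" using ell_lipschitz[OF fg] by blast
  show "((\<lambda>p. ell f g (stopped T (fst p) (snd p))) \<longlongrightarrow> ell f g (stopped T (fst p) (snd p))) (nb p)"
  proof (rule nb_lipschitz[OF p])
    fix q :: "real \<times> 'a path" assume q: "q \<in> Lambda_hat T"
    have "\<bar>ell f g (stopped T (fst q) (snd q)) - ell f g (stopped T (fst p) (snd p))\<bar>
       \<le> C * sup_dist T (stopped T (fst q) (snd q)) (stopped T (fst p) (snd p))"
      using p q by (intro C(2) stopped_cadlag) (auto simp: Lambda_hat_def)
    also have "\<dots> \<le> C * d_inf T p q" using C(1) sup_dist_d_inf[OF p q] by (intro mult_left_mono)
    finally show "norm (ell f g (stopped T (fst q) (snd q)) - ell f g (stopped T (fst p) (snd p)))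
       \<le> C * d_inf T p q" by simp
  qed
  show "((\<lambda>p. f (fst p)) \<longlongrightarrow> f (fst p)) (nb p)" by (rule tendsto_time_fun_nb[OF primitiveD(3)[OF fg] p])
qed auto

subsection \<open>Stochastic integrals of deterministic functions, pathwise\<close>

text \<open>
  The integral of a scalar function \<open>\<phi>\<close> with derivative \<open>\<gamma>\<close> against all components of the path
  at once, again by parts.
\<close>

definition win :: "(real \<Rightarrow> real) \<Rightarrow> (real \<Rightarrow> real) \<Rightarrow> ('n::finite) path \<Rightarrow> real ^ 'n" where
  "win \<phi> \<gamma> x = (\<chi> l. ell (\<lambda>t. axis l (\<phi> t)) (\<lambda>t. axis l (\<gamma> t)) x)"

lemma axis_scale: "axis l (a::real) = a *\<^sub>R axis l 1"
  by (simp add: vec_eq_iff axis_def)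

lemma primitive_axis:
  fixes l :: "'n::finite"
  assumes "primitive \<phi> \<gamma>"
  shows "primitive (\<lambda>t. axis l (\<phi> t :: real)) (\<lambda>t. axis l (\<gamma> t))"
  unfolding primitive_def axis_scale[of l "\<phi> _"] axis_scale[of l "\<gamma> _"]
  using assms unfolding primitive_def
  by (auto intro!: continuous_intros bounded_linear.has_vector_derivative[OF bounded_linear_scaleR_left])

lemma cadlag_scale_integrable:
  fixes x :: "('n::finite) path"
  assumes x: "x \<in> cadlag_paths T" and g: "continuous_on {0..T} g" and t: "t \<in> {0..T}"
  shows "(\<lambda>s. g s *\<^sub>R x s) integrable_on {0..t}"
proof (rule integrable_componentwise)
  fix b :: "real ^ 'n" assume "b \<in> Basis"
  have "continuous_on {0..T} (\<lambda>s. g s *\<^sub>R b)" using g by (intro continuous_intros)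
  from cadlag_inner_integrable[OF x this t]
  show "(\<lambda>s. g s *\<^sub>R x s \<bullet> b) integrable_on {0..t}" by (simp add: inner_commute)
qed

lemma win_stopped:
  assumes pg: "primitive \<phi> \<gamma>" and x: "x \<in> cadlag_paths T" and t: "t \<in> {0..T}"
  shows "win \<phi> \<gamma> (stopped T t x) = \<phi> t *\<^sub>R x t - integral {0..t} (\<lambda>s. \<gamma> s *\<^sub>R x s)"
proof -
  have i: "(\<lambda>s. \<gamma> s *\<^sub>R x s) integrable_on {0..t}"
    by (rule cadlag_scale_integrable[OF x primitiveD(1)[OF pg] t])
  show ?thesis
    by (simp add: vec_eq_iff win_def ell_stopped[OF primitive_axis[OF pg] x t] inner_axis'
        flip: integral_component_eq_cart[OF i])
qed

lemma win_bumped: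
  assumes pg: "primitive \<phi> \<gamma>" and x: "x \<in> cadlag_paths T" and t: "t \<in> {0..T}"
  shows "win \<phi> \<gamma> (stopped T t (bumped T t v x)) = win \<phi> \<gamma> (stopped T t x) + \<phi> t *\<^sub>R v"
  by (simp add: vec_eq_iff win_def ell_bumped[OF primitive_axis[OF pg] x t] inner_axis')

lemma win_lipschitz:
  assumes pg: "primitive \<phi> \<gamma>"
  shows "\<exists>C\<ge>0. \<forall>x\<in>cadlag_paths T. \<forall>y\<in>cadlag_paths T.
    norm (win \<phi> \<gamma> x - win \<phi> \<gamma> y :: real ^ 'n::finite) \<le> C * sup_dist T x y"
proof -
  have "\<forall>l::'n. \<exists>C\<ge>0. \<forall>x\<in>cadlag_paths T. \<forall>y\<in>cadlag_paths T.
     \<bar>win \<phi> \<gamma> x $ l - win \<phi> \<gamma> y $ l\<bar> \<le> C * sup_dist T x y"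
    using ell_lipschitz[OF primitive_axis[OF pg]] unfolding win_def vec_lambda_beta by (intro allI)
  then obtain C where C: "\<And>l::'n. C l \<ge> 0" "\<And>(l::'n) x y. x \<in> cadlag_paths T \<Longrightarrow> y \<in> cadlag_paths T \<Longrightarrow>
     \<bar>win \<phi> \<gamma> x $ l - win \<phi> \<gamma> y $ l\<bar> \<le> C l * sup_dist T x y" by metis
  show ?thesis
  proof (intro exI[of _ "\<Sum>l\<in>UNIV. C l"] conjI ballI sum_nonneg C(1))
    fix x y :: "'n path" assume "x \<in> cadlag_paths T" "y \<in> cadlag_paths T"
    then have "(\<Sum>l\<in>UNIV. \<bar>(win \<phi> \<gamma> x - win \<phi> \<gamma> y) $ l\<bar>) \<le> (\<Sum>l\<in>UNIV. C l * sup_dist T x y)"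
      by (intro sum_mono) (simp add: C(2))
    then show "norm (win \<phi> \<gamma> x - win \<phi> \<gamma> y) \<le> (\<Sum>l\<in>UNIV. C l) * sup_dist T x y"
      using norm_le_l1_cart[of "win \<phi> \<gamma> x - win \<phi> \<gamma> y"] by (simp add: sum_distrib_right)
  qed
qed

lemma zero_path: "(\<lambda>s\<in>{0..T}. 0) \<in> (cadlag_paths T :: ('n::finite) path set)"
proof -
  have "continuous_on {0..T} (\<lambda>s\<in>{0..T}. 0 :: real ^ 'n)"
    by (rule continuous_on_eq[of _ "\<lambda>_. 0"]) auto
  then have "(\<lambda>s\<in>{0..T}. 0) \<in> (cont_paths T :: 'n path set)" by (simp add: cont_paths_def)
  then show ?thesis using cont_cadlag by blast
qed

lemma win_bound:
  assumes pg: "primitive \<phi> \<gamma>"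
  shows "\<exists>C\<ge>0. \<forall>x\<in>cadlag_paths T. \<forall>t\<in>{0..T}.
    norm (win \<phi> \<gamma> (stopped T t x) :: real ^ 'n::finite) \<le> C * sup_norm T x"
proof -
  let ?z = "(\<lambda>s\<in>{0..T}. 0) :: 'n path"
  obtain C where C: "C \<ge> 0" "\<And>x y. x \<in> cadlag_paths T \<Longrightarrow> y \<in> cadlag_paths T \<Longrightarrow>
     norm (win \<phi> \<gamma> x - win \<phi> \<gamma> y :: real ^ 'n) \<le> C * sup_dist T x y"
    using win_lipschitz[OF pg, where ?'n = 'n] by blast
  have "integral {0..T} (\<lambda>s. axis l (\<gamma> s) \<bullet> ?z s) = integral {0..T} (\<lambda>s. 0)" for l
    by (rule Henstock_Kurzweil_Integration.integral_cong) simp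
  then have z: "win \<phi> \<gamma> ?z = 0" using T_pos by (simp add: vec_eq_iff win_def ell_def)
  show ?thesis
  proof (intro exI[of _ C] conjI ballI C(1))
    fix x :: "'n path" and t assume x: "x \<in> cadlag_paths T" and t: "t \<in> {0..T}"
    have "norm (win \<phi> \<gamma> (stopped T t x) - win \<phi> \<gamma> ?z) \<le> C * sup_dist T (stopped T t x) ?z"
      by (intro C(2) stopped_cadlag x t zero_path)
    also have "\<dots> \<le> C * sup_norm T x"
      by (intro mult_left_mono C(1) sup_dist_least)
         (use t in \<open>auto simp: stopped_apply intro!: sup_norm_upper[OF x]\<close>)
    finally show "norm (win \<phi> \<gamma> (stopped T t x)) \<le> C * sup_norm T x" by (simp add: z)
  qed
qed

subsection \<open>The gauge of a window integral\<close>

definition pos :: "(real \<Rightarrow> real) \<Rightarrow> (real \<Rightarrow> real) \<Rightarrow> real ^ 'n \<Rightarrow> real \<times> ('n::finite) path \<Rightarrow> real ^ 'n" where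
  "pos \<phi> \<gamma> v p = win \<phi> \<gamma> (stopped T (fst p) (snd p)) - v"

text \<open>
  The path is stopped at time \<open>fst p\<close>, so the supremum over all of \<open>[0, T]\<close> is the running
  maximum up to that time.
\<close>

definition rmax :: "(real \<Rightarrow> real) \<Rightarrow> (real \<Rightarrow> real) \<Rightarrow> real ^ 'n \<Rightarrow> real \<times> ('n::finite) path \<Rightarrow> real" where
  "rmax \<phi> \<gamma> v p = (SUP r\<in>{0..T}. norm (pos \<phi> \<gamma> v (r, stopped T (fst p) (snd p))))"

text \<open>
  The vertical gradient and Hessian are those that the chain rule gives with the running maximum
  held fixed.
\<close>

definition gauge where
  "gauge \<phi> \<gamma> v p = gauge_fun ((rmax \<phi> \<gamma> v p)\<^sup>2) ((norm (pos \<phi> \<gamma> v p))\<^sup>2)"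

definition gauge_b where
  "gauge_b \<phi> \<gamma> v p = (2 * gauge_fun' ((rmax \<phi> \<gamma> v p)\<^sup>2) ((norm (pos \<phi> \<gamma> v p))\<^sup>2) * \<phi> (fst p)) *\<^sub>R pos \<phi> \<gamma> v p"

definition gauge_c :: "(real \<Rightarrow> real) \<Rightarrow> (real \<Rightarrow> real) \<Rightarrow> real ^ 'n \<Rightarrow> real \<times> ('n::finite) path \<Rightarrow> real ^ 'n ^ 'n" where
  "gauge_c \<phi> \<gamma> v p = (\<chi> i j. (\<phi> (fst p))\<^sup>2 *
     (2 * gauge_fun' ((rmax \<phi> \<gamma> v p)\<^sup>2) ((norm (pos \<phi> \<gamma> v p))\<^sup>2) * (if i = j then 1 else 0) +
      4 * (gauge_fun'' ((rmax \<phi> \<gamma> v p)\<^sup>2) ((norm (pos \<phi> \<gamma> v p))\<^sup>2) * (pos \<phi> \<gamma> v p $ i * pos \<phi> \<gamma> v p $ j))))"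

context
  fixes \<phi> \<gamma> :: "real \<Rightarrow> real" and v :: "real ^ 'n::finite"
  assumes pg: "primitive \<phi> \<gamma>"
begin

lemma pos_bump:
  assumes "(t, x) \<in> Lambda_hat T"
  shows "pos \<phi> \<gamma> v (t, bumped T t w x) = pos \<phi> \<gamma> v (t, x) + \<phi> t *\<^sub>R w"
  using assms by (simp add: pos_def win_bumped[OF pg] Lambda_hat_def)

lemma pos_stopped: "r \<in> {0..T} \<Longrightarrow> t \<in> {0..T} \<Longrightarrow> pos \<phi> \<gamma> v (r, stopped T t x) = pos \<phi> \<gamma> v (min r t, x)"
  by (simp add: pos_def stopped_stopped)

lemma pos_bound:
  "\<exists>C\<ge>0. \<forall>x\<in>cadlag_paths T. \<forall>t\<in>{0..T}. norm (pos \<phi> \<gamma> v (t, x)) \<le> C * (1 + sup_norm T x)"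
proof -
  obtain C where C: "C \<ge> 0" "\<And>x t. x \<in> cadlag_paths T \<Longrightarrow> t \<in> {0..T} \<Longrightarrow>
    norm (win \<phi> \<gamma> (stopped T t x) :: real ^ 'n) \<le> C * sup_norm T x"
    using win_bound[OF pg, where ?'n = 'n] by blast
  show ?thesis
  proof (intro exI[of _ "C + norm v"] conjI ballI)
    fix x :: "'n path" and t assume *: "x \<in> cadlag_paths T" "t \<in> {0..T}"
    have "0 \<le> norm v * sup_norm T x" using sup_norm_nonneg[OF *(1)] by simp
    then show "norm (pos \<phi> \<gamma> v (t, x)) \<le> (C + norm v) * (1 + sup_norm T x)"
      using C(2)[OF *] norm_triangle_ineq4[of "win \<phi> \<gamma> (stopped T t x)" v] C(1)
      by (simp add: pos_def algebra_simps)
  qed (use C in simp)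
qed

lemma rmax_image:
  assumes t: "t \<in> {0..T}"
  shows "(\<lambda>r. norm (pos \<phi> \<gamma> v (r, stopped T t x))) ` {0..T} =
    insert (norm (pos \<phi> \<gamma> v (t, x))) ((\<lambda>r. norm (pos \<phi> \<gamma> v (r, x))) ` {0..<t})" (is "?L = ?R")
proof
  show "?L \<subseteq> ?R"
  proof
    fix z assume "z \<in> ?L"
    then obtain r where r: "r \<in> {0..T}" "z = norm (pos \<phi> \<gamma> v (min r t, x))" using t by (auto simp: pos_stopped)
    show "z \<in> ?R" by (cases "r < t") (use r in \<open>auto simp: min_def\<close>)
  qed
  have "norm (pos \<phi> \<gamma> v (t, x)) \<in> ?L"
    using t by (intro image_eqI[of _ _ t]) (auto simp: pos_stopped)
  moreover have "norm (pos \<phi> \<gamma> v (r, x)) \<in> ?L" if "r \<in> {0..<t}" for r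
    using t that by (intro image_eqI[of _ _ r]) (auto simp: pos_stopped min_def)
  ultimately show "?R \<subseteq> ?L" by auto
qed

lemma pos_image_bdd:
  assumes x: "x \<in> cadlag_paths T" and I: "I \<subseteq> {0..T}"
  shows "bdd_above ((\<lambda>r. norm (pos \<phi> \<gamma> v (r, x))) ` I)"
proof -
  obtain C where "\<forall>x\<in>cadlag_paths T. \<forall>t\<in>{0..T}. norm (pos \<phi> \<gamma> v (t, x)) \<le> C * (1 + sup_norm T x)"
    using pos_bound by blast
  then show ?thesis using x I by (intro bdd_aboveI[of _ "C * (1 + sup_norm T x)"]) auto
qed

lemma rmax_upper:
  assumes x: "x \<in> cadlag_paths T" and t: "t \<in> {0..T}" and r: "r \<in> {0..t}"
  shows "norm (pos \<phi> \<gamma> v (r, x)) \<le> rmax \<phi> \<gamma> v (t, x)"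
proof -
  have "norm (pos \<phi> \<gamma> v (r, x)) = norm (pos \<phi> \<gamma> v (r, stopped T t x))"
    using r t by (simp add: pos_stopped min_def)
  also have "\<dots> \<le> rmax \<phi> \<gamma> v (t, x)"
    unfolding rmax_def fst_conv snd_conv
    using r t by (intro cSUP_upper pos_image_bdd stopped_cadlag x) auto
  finally show ?thesis .
qed

lemma rmax_least:
  assumes "t \<in> {0..T}" "\<And>r. r \<in> {0..t} \<Longrightarrow> norm (pos \<phi> \<gamma> v (r, x)) \<le> B"
  shows "rmax \<phi> \<gamma> v (t, x) \<le> B"
  unfolding rmax_def fst_conv snd_conv rmax_image[OF assms(1)]
  by (rule cSup_least) (use assms in auto)

lemma rmax_nonneg: "(t, x) \<in> Lambda_hat T \<Longrightarrow> 0 \<le> rmax \<phi> \<gamma> v (t, x)"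
  using rmax_upper[of x t t] by (auto simp: Lambda_hat_def intro: order_trans[OF norm_ge_zero])

lemma pos_le_rmax: "p \<in> Lambda_hat T \<Longrightarrow> norm (pos \<phi> \<gamma> v p) \<le> rmax \<phi> \<gamma> v p"
  using rmax_upper[of "snd p" "fst p" "fst p"] by (auto simp: Lambda_hat_def)

lemma pos2_le_rmax2: "p \<in> Lambda_hat T \<Longrightarrow> (norm (pos \<phi> \<gamma> v p))\<^sup>2 \<le> (rmax \<phi> \<gamma> v p)\<^sup>2"
  by (rule power_mono[OF pos_le_rmax]) auto

lemma rmax_stopped:
  assumes "x \<in> cadlag_paths T" "t \<in> {0..T}" "s \<in> {t..T}"
  shows "rmax \<phi> \<gamma> v (s, stopped T t x) = rmax \<phi> \<gamma> v (t, x)"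
  using assms by (simp add: rmax_def stopped_stopped min_absorb2)

text \<open>
  A jump at time \<open>t\<close> leaves the earlier positions alone: \<open>M\<close> is the maximum over the past.
\<close>

lemma rmax_bump:
  assumes tx: "(t, x) \<in> Lambda_hat T"
  shows "\<exists>M\<ge>0. \<forall>w. (rmax \<phi> \<gamma> v (t, bumped T t w x))\<^sup>2 = max (M\<^sup>2) ((norm (pos \<phi> \<gamma> v (t, bumped T t w x)))\<^sup>2)"
proof -
  have x: "x \<in> cadlag_paths T" and t: "t \<in> {0..T}" using tx by (auto simp: Lambda_hat_def)
  define S where "S = (\<lambda>r. norm (pos \<phi> \<gamma> v (r, x))) ` {0..<t}"
  define M where "M = Sup (insert 0 S)"
  have bdd: "bdd_above S" unfolding S_def using t by (intro pos_image_bdd x) auto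
  have M0: "0 \<le> M" unfolding M_def using bdd by (intro cSup_upper) auto
  have "rmax \<phi> \<gamma> v (t, bumped T t w x) = max M (norm (pos \<phi> \<gamma> v (t, bumped T t w x)))" for w
  proof -
    let ?a = "norm (pos \<phi> \<gamma> v (t, bumped T t w x))"
    have "(\<lambda>r. norm (pos \<phi> \<gamma> v (r, bumped T t w x))) ` {0..<t} = S"
      unfolding S_def using t by (intro image_cong refl) (simp add: pos_def stopped_bumped_less)
    then have e: "rmax \<phi> \<gamma> v (t, bumped T t w x) = Sup (insert ?a S)"
      using rmax_image[OF t, of "bumped T t w x"] by (simp add: rmax_def)
    show ?thesis
    proof (cases "S = {}")
      case True then show ?thesis using e by (simp add: M_def)
    next
      case False
      then have "Sup (insert ?a S) = max ?a (Sup S)" "M = max 0 (Sup S)"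
        using cSup_insert[OF False bdd] by (auto simp: M_def sup_max)
      moreover have "0 \<le> Sup S"
      proof -
        obtain z where "z \<in> S" using False by blast
        then have "0 \<le> z" "z \<le> Sup S" using bdd by (auto simp: S_def intro: cSup_upper)
        then show ?thesis by simp
      qed
      ultimately show ?thesis using e by (simp add: max.commute)
    qed
  qed
  moreover have "(max M a)\<^sup>2 = max (M\<^sup>2) (a\<^sup>2)" if "0 \<le> a" for a
    using M0 that by (auto simp: max_def power_mono intro: antisym dest: power2_le_imp_le)
  ultimately show ?thesis using M0 by auto
qed

lemma pos_lipschitz:
  "\<exists>C\<ge>0. \<forall>p\<in>Lambda_hat T. \<forall>q\<in>Lambda_hat T. norm (pos \<phi> \<gamma> v q - pos \<phi> \<gamma> v p) \<le> C * d_inf T p q \<and>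
    \<bar>rmax \<phi> \<gamma> v q - rmax \<phi> \<gamma> v p\<bar> \<le> C * d_inf T p q"
proof -
  obtain C where C: "C \<ge> 0" "\<And>x y. x \<in> cadlag_paths T \<Longrightarrow> y \<in> cadlag_paths T \<Longrightarrow>
     norm (win \<phi> \<gamma> x - win \<phi> \<gamma> y :: real ^ 'n) \<le> C * sup_dist T x y"
    using win_lipschitz[OF pg, where ?'n = 'n] by blast
  have P: "norm (pos \<phi> \<gamma> v (r, stopped T (fst q) (snd q)) - pos \<phi> \<gamma> v (r, stopped T (fst p) (snd p))) \<le> C * d_inf T p q"
    if p: "p \<in> Lambda_hat T" and q: "q \<in> Lambda_hat T" and r: "r \<in> {0..T}" for p q r
  proof -
    let ?x = "stopped T (fst q) (snd q)" and ?y = "stopped T (fst p) (snd p)"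
    have xy: "?x \<in> cadlag_paths T" "?y \<in> cadlag_paths T"
      using p q by (auto simp: Lambda_hat_def intro: stopped_cadlag)
    have "norm (pos \<phi> \<gamma> v (r, ?x) - pos \<phi> \<gamma> v (r, ?y)) \<le> C * sup_dist T (stopped T r ?x) (stopped T r ?y)"
      using C(2)[OF stopped_cadlag[OF xy(1) r] stopped_cadlag[OF xy(2) r]] by (simp add: pos_def)
    also have "sup_dist T (stopped T r ?x) (stopped T r ?y) \<le> sup_dist T ?x ?y"
      by (rule sup_dist_least)
        (use r sup_dist_upper[OF xy] in \<open>auto simp: stopped_apply[of _ r]\<close>)
    also have "\<dots> \<le> d_inf T p q" by (rule sup_dist_d_inf[OF p q])
    finally show ?thesis using C(1) by (simp add: mult_left_mono)
  qed
  have R: "rmax \<phi> \<gamma> v q \<le> rmax \<phi> \<gamma> v p + C * d_inf T p q"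
    if p: "p \<in> Lambda_hat T" and q: "q \<in> Lambda_hat T"
      and d: "\<And>r. r \<in> {0..T} \<Longrightarrow> norm (pos \<phi> \<gamma> v (r, stopped T (fst q) (snd q)) -
        pos \<phi> \<gamma> v (r, stopped T (fst p) (snd p))) \<le> C * d_inf T p' q'" "d_inf T p' q' = d_inf T p q" for p q p' q'
  proof -
    have "norm (pos \<phi> \<gamma> v (r, stopped T (fst q) (snd q))) \<le> rmax \<phi> \<gamma> v p + C * d_inf T p q" if r: "r \<in> {0..T}" for r
    proof -
      have "stopped T (fst p) (snd p) \<in> cadlag_paths T" using p by (auto simp: Lambda_hat_def intro: stopped_cadlag)
      then have "norm (pos \<phi> \<gamma> v (r, stopped T (fst p) (snd p))) \<le> rmax \<phi> \<gamma> v p"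
        unfolding rmax_def using r by (intro cSUP_upper pos_image_bdd) auto
      then show ?thesis
        using d(1)[OF r] norm_triangle_sub[of "pos \<phi> \<gamma> v (r, stopped T (fst q) (snd q))" "pos \<phi> \<gamma> v (r, stopped T (fst p) (snd p))"]
        unfolding d(2) by linarith
    qed
    then show ?thesis unfolding rmax_def[of _ _ _ q] by (intro cSUP_least) (use T_pos in auto)
  qed
  have sym: "d_inf T q p = d_inf T p q" for p q :: "real \<times> 'n path"
    by (cases p, cases q) (simp add: d_inf_def sup_dist_def sup_norm_def abs_minus_commute norm_minus_commute)
  show ?thesis
  proof (intro exI[of _ C] conjI ballI C(1))
    fix p q :: "real \<times> 'n path" assume p: "p \<in> Lambda_hat T" and q: "q \<in> Lambda_hat T"
    show "norm (pos \<phi> \<gamma> v q - pos \<phi> \<gamma> v p) \<le> C * d_inf T p q"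
    proof -
      have "pos \<phi> \<gamma> v (T, stopped T (fst z) (snd z)) = pos \<phi> \<gamma> v z" if "z \<in> Lambda_hat T" for z
        using that pos_stopped[of T "fst z" "snd z"] T_pos by (auto simp: Lambda_hat_def min_absorb2)
      then show ?thesis using P[OF p q, of T] p q T_pos by simp
    qed
    show "\<bar>rmax \<phi> \<gamma> v q - rmax \<phi> \<gamma> v p\<bar> \<le> C * d_inf T p q"
    proof -
      have "rmax \<phi> \<gamma> v q \<le> rmax \<phi> \<gamma> v p + C * d_inf T p q" by (rule R[OF p q P[OF p q] refl])
      moreover have "rmax \<phi> \<gamma> v p \<le> rmax \<phi> \<gamma> v q + C * d_inf T q p" by (rule R[OF q p P[OF q p] refl])
      ultimately show ?thesis using sym[of q p] by simp
    qed
  qed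
qed

lemma tendsto_pos_nb: "p \<in> Lambda_hat T \<Longrightarrow> (pos \<phi> \<gamma> v \<longlongrightarrow> pos \<phi> \<gamma> v p) (nb p)"
  using pos_lipschitz nb_lipschitz[of p "pos \<phi> \<gamma> v"] by blast

lemma tendsto_rmax_nb: "p \<in> Lambda_hat T \<Longrightarrow> (rmax \<phi> \<gamma> v \<longlongrightarrow> rmax \<phi> \<gamma> v p) (nb p)"
  using pos_lipschitz nb_lipschitz[of p "rmax \<phi> \<gamma> v"] by (metis real_norm_def)

text \<open>
  Along bumped paths the gauge is a function of the current position only: by \<open>rmax_bump\<close> and
  \<open>gauge_fun_max\<close> the running maximum may be replaced by the maximum over the past, which does
  not depend on the jump.
\<close>

lemma flat_C2_gauge: "flat_C2 (gauge \<phi> \<gamma> v) (gauge_b \<phi> \<gamma> v) (gauge_c \<phi> \<gamma> v)"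
proof (rule flat_C2I)
  fix x :: "'n path" and t s assume *: "x \<in> cadlag_paths T" "t \<in> {0..T}" "s \<in> {t..T}"
  then show "gauge \<phi> \<gamma> v (s, stopped T t x) = gauge \<phi> \<gamma> v (t, x)"
    by (simp add: gauge_def rmax_stopped pos_stopped min_absorb2)
next
  fix t :: real and x :: "'n path" and i j assume tx: "(t, x) \<in> Lambda_hat T"
  obtain M where M: "M \<ge> 0" "\<And>w. (rmax \<phi> \<gamma> v (t, bumped T t w x))\<^sup>2 = max (M\<^sup>2) ((norm (pos \<phi> \<gamma> v (t, bumped T t w x)))\<^sup>2)"
    using rmax_bump[OF tx] by blast
  define y where "y = pos \<phi> \<gamma> v (t, x)"
  have b0: "bumped T t 0 x = x" using bumped_0_hat[OF tx, of 0] by simp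
  have bp: "pos \<phi> \<gamma> v (t, bumped T t (h *\<^sub>R axis i 1) x) = y + (\<phi> t * h) *\<^sub>R axis i 1" for h i
    by (simp add: pos_bump[OF tx] y_def)
  have m0: "max (M\<^sup>2) ((norm y)\<^sup>2) = (rmax \<phi> \<gamma> v (t, x))\<^sup>2" using M(2)[of 0] by (simp add: b0 y_def)
  have n2: "(norm (y + (\<phi> t * h) *\<^sub>R axis i 1))\<^sup>2 = (norm y)\<^sup>2 + 2 * \<phi> t * y $ i * h + (\<phi> t)\<^sup>2 * h\<^sup>2" for h i
    by (simp only: power2_norm_eq_inner inner_add_left inner_add_right inner_scaleR_left inner_scaleR_right)
       (simp add: inner_axis inner_axis' power2_eq_square algebra_simps)
  have q: "((\<lambda>h. (norm (y + (\<phi> t * h) *\<^sub>R axis i 1))\<^sup>2) has_real_derivative 2 * \<phi> t * y $ i) (at 0)" for i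
    unfolding n2 by (auto intro!: derivative_eq_intros)
  have g1: "gauge_fun' (M\<^sup>2) ((norm y)\<^sup>2) = gauge_fun' ((rmax \<phi> \<gamma> v (t, x))\<^sup>2) ((norm y)\<^sup>2)"
    and g2: "gauge_fun'' (M\<^sup>2) ((norm y)\<^sup>2) = gauge_fun'' ((rmax \<phi> \<gamma> v (t, x))\<^sup>2) ((norm y)\<^sup>2)"
    by (simp_all add: gauge_fun_max flip: m0)
  have "((\<lambda>h. gauge_fun (M\<^sup>2) ((norm (y + (\<phi> t * h) *\<^sub>R axis i 1))\<^sup>2)) has_real_derivative
      gauge_fun' (M\<^sup>2) ((norm y)\<^sup>2) * (2 * \<phi> t * y $ i)) (at 0)"
    using DERIV_chain2[OF DERIV_gauge_fun q, of "M\<^sup>2" i] by simp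
  then show "((\<lambda>h. gauge \<phi> \<gamma> v (t, bumped T t (h *\<^sub>R axis i 1) x)) has_real_derivative gauge_b \<phi> \<gamma> v (t, x) $ i) (at 0)"
    unfolding gauge_def M(2) bp gauge_fun_max gauge_b_def g1
    by (simp add: y_def mult.assoc mult.left_commute)
  have "((\<lambda>h. gauge_fun' (M\<^sup>2) ((norm (y + (\<phi> t * h) *\<^sub>R axis j 1))\<^sup>2)) has_real_derivative
      gauge_fun'' (M\<^sup>2) ((norm y)\<^sup>2) * (2 * \<phi> t * y $ j)) (at 0)"
    using DERIV_chain2[OF DERIV_gauge_fun' q, of "M\<^sup>2" j] by simp
  moreover have "((\<lambda>h. 2 * \<phi> t * (y $ i + (\<phi> t * h) * (if i = j then 1 else 0))) has_real_derivative
      2 * \<phi> t * (\<phi> t * (if i = j then 1 else 0))) (at 0)"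
    by (auto intro!: derivative_eq_intros)
  ultimately have "((\<lambda>h. gauge_fun' (M\<^sup>2) ((norm (y + (\<phi> t * h) *\<^sub>R axis j 1))\<^sup>2) *
      (2 * \<phi> t * (y $ i + (\<phi> t * h) * (if i = j then 1 else 0)))) has_real_derivative
      gauge_fun' (M\<^sup>2) ((norm y)\<^sup>2) * (2 * \<phi> t * (\<phi> t * (if i = j then 1 else 0))) + gauge_fun'' (M\<^sup>2) ((norm y)\<^sup>2) * (2 * \<phi> t * y $ j) * (2 * \<phi> t * y $ i)) (at 0)"
    by (rule DERIV_mult'[THEN DERIV_cong]) simp
  moreover have "gauge_b \<phi> \<gamma> v (t, bumped T t (h *\<^sub>R axis j 1) x) $ i =
     gauge_fun' (M\<^sup>2) ((norm (y + (\<phi> t * h) *\<^sub>R axis j 1))\<^sup>2) * (2 * \<phi> t * (y $ i + (\<phi> t * h) * (if i = j then 1 else 0)))" for h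
    unfolding gauge_b_def M(2) bp gauge_fun_max by (simp add: axis_def ac_simps)
  moreover have "gauge_c \<phi> \<gamma> v (t, x) $ i $ j = gauge_fun' (M\<^sup>2) ((norm y)\<^sup>2) * (2 * \<phi> t * (\<phi> t * (if i = j then 1 else 0))) + gauge_fun'' (M\<^sup>2) ((norm y)\<^sup>2) * (2 * \<phi> t * y $ j) * (2 * \<phi> t * y $ i)"
    unfolding gauge_c_def g1 g2 by (simp add: y_def power2_eq_square algebra_simps)
  ultimately show "((\<lambda>h. gauge_b \<phi> \<gamma> v (t, bumped T t (h *\<^sub>R axis j 1) x) $ i) has_real_derivative
      gauge_c \<phi> \<gamma> v (t, x) $ i $ j) (at 0)" by simp
next
  fix p :: "real \<times> 'n path" assume p: "p \<in> Lambda_hat T"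
  have m: "((\<lambda>p. (rmax \<phi> \<gamma> v p)\<^sup>2) \<longlongrightarrow> (rmax \<phi> \<gamma> v p)\<^sup>2) (nb p)"
    by (intro tendsto_intros tendsto_rmax_nb p)
  have q: "((\<lambda>p. (norm (pos \<phi> \<gamma> v p))\<^sup>2) \<longlongrightarrow> (norm (pos \<phi> \<gamma> v p))\<^sup>2) (nb p)"
    by (intro tendsto_intros tendsto_pos_nb p)
  have ev: "eventually (\<lambda>q. q \<in> Lambda_hat T) (nb p)" unfolding eventually_nb by (intro exI[of _ 1]) auto
  have le: "eventually (\<lambda>p. 0 \<le> (norm (pos \<phi> \<gamma> v p))\<^sup>2 \<and> (norm (pos \<phi> \<gamma> v p))\<^sup>2 \<le> (rmax \<phi> \<gamma> v p)\<^sup>2) (nb p)"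
    using ev by eventually_elim (simp add: pos2_le_rmax2)
  note tg = tendsto_gauge_fun[OF m q le zero_le_power2 pos2_le_rmax2[OF p]]
  have ft: "((\<lambda>p. \<phi> (fst p)) \<longlongrightarrow> \<phi> (fst p)) (nb p)" by (rule tendsto_time_fun_nb[OF primitiveD(3)[OF pg] p])
  show "(gauge \<phi> \<gamma> v \<longlongrightarrow> gauge \<phi> \<gamma> v p) (nb p)" unfolding gauge_def[abs_def] by (rule tg(1))
  show "(gauge_b \<phi> \<gamma> v \<longlongrightarrow> gauge_b \<phi> \<gamma> v p) (nb p)"
    unfolding gauge_b_def[abs_def] by (intro tendsto_intros tg(2) ft tendsto_pos_nb p)
  have w: "\<bar>pos \<phi> \<gamma> v p $ i * pos \<phi> \<gamma> v p $ j\<bar> \<le> (rmax \<phi> \<gamma> v p)\<^sup>2" if "p \<in> Lambda_hat T" for p i j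
  proof -
    have "\<bar>pos \<phi> \<gamma> v p $ i\<bar> * \<bar>pos \<phi> \<gamma> v p $ j\<bar> \<le> rmax \<phi> \<gamma> v p * rmax \<phi> \<gamma> v p"
      using pos_le_rmax[OF that] component_le_norm_cart[of "pos \<phi> \<gamma> v p"]
      by (intro mult_mono) (auto intro: order_trans order_trans[OF norm_ge_zero])
    then show ?thesis by (simp add: abs_mult power2_eq_square)
  qed
  show "(gauge_c \<phi> \<gamma> v \<longlongrightarrow> gauge_c \<phi> \<gamma> v p) (nb p)"
  proof (intro vec_tendstoI)
    fix i j
    have "((\<lambda>p. pos \<phi> \<gamma> v p $ i * pos \<phi> \<gamma> v p $ j) \<longlongrightarrow> pos \<phi> \<gamma> v p $ i * pos \<phi> \<gamma> v p $ j) (nb p)"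
      by (intro tendsto_intros tendsto_pos_nb p)
    moreover have "eventually (\<lambda>p. \<bar>pos \<phi> \<gamma> v p $ i * pos \<phi> \<gamma> v p $ j\<bar> \<le> (rmax \<phi> \<gamma> v p)\<^sup>2) (nb p)"
      using ev by eventually_elim (rule w)
    ultimately have t3: "((\<lambda>p. gauge_fun'' ((rmax \<phi> \<gamma> v p)\<^sup>2) ((norm (pos \<phi> \<gamma> v p))\<^sup>2) * (pos \<phi> \<gamma> v p $ i * pos \<phi> \<gamma> v p $ j)) \<longlongrightarrow>
        gauge_fun'' ((rmax \<phi> \<gamma> v p)\<^sup>2) ((norm (pos \<phi> \<gamma> v p))\<^sup>2) * (pos \<phi> \<gamma> v p $ i * pos \<phi> \<gamma> v p $ j)) (nb p)"
      by (rule tg(3)[OF _ _ w[OF p]])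
    show "((\<lambda>p. gauge_c \<phi> \<gamma> v p $ i $ j) \<longlongrightarrow> gauge_c \<phi> \<gamma> v p $ i $ j) (nb p)"
      unfolding gauge_c_def vec_lambda_beta
      by (rule tendsto_mult[OF tendsto_power[OF ft] tendsto_add[OF tendsto_mult[OF tendsto_mult[OF
          tendsto_const tg(2)] tendsto_const] tendsto_mult[OF tendsto_const t3]]])
  qed
qed

end

subsection \<open>Estimates for the gauge\<close>

lemma norm_matrix_le:
  fixes c :: "real ^ 'n ^ 'm"
  assumes "\<And>i j. \<bar>c $ i $ j\<bar> \<le> B"
  shows "norm c \<le> real CARD('m) * (real CARD('n) * B)"
proof -
  have "norm (c $ i) \<le> real CARD('n) * B" for i
  proof -
    have "norm (c $ i) \<le> (\<Sum>j\<in>UNIV. \<bar>c $ i $ j\<bar>)" by (rule norm_le_l1_cart)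
    also have "\<dots> \<le> (\<Sum>j\<in>(UNIV :: 'n set). B)" by (intro sum_mono assms)
    finally show ?thesis by simp
  qed
  then have "(\<Sum>i\<in>UNIV. norm (c $ i)) \<le> (\<Sum>i\<in>(UNIV :: 'm set). real CARD('n) * B)" by (intro sum_mono)
  moreover have "norm c \<le> (\<Sum>i\<in>UNIV. norm (c $ i))"
    unfolding norm_vec_def by (rule L2_set_le_sum) simp
  ultimately show ?thesis by simp
qed

context
  fixes \<phi> \<gamma> :: "real \<Rightarrow> real" and v :: "real ^ 'n::finite"
  assumes pg: "primitive \<phi> \<gamma>"
begin

text \<open>
  The last estimate involves the current position and not the running maximum. A multiple of
  \<open>|y|\<^sup>2\<close> that decreases in time can therefore compensate for the Hessian of the gauge.
\<close>

lemma gauge_estimates: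
  assumes p: "p \<in> Lambda_hat T"
  shows "(rmax \<phi> \<gamma> v p) ^ 4 / 2 \<le> gauge \<phi> \<gamma> v p" "gauge \<phi> \<gamma> v p \<le> 4 * (rmax \<phi> \<gamma> v p) ^ 4"
    "0 \<le> gauge \<phi> \<gamma> v p"
    "norm (gauge_b \<phi> \<gamma> v p) \<le> 18 * \<bar>\<phi> (fst p)\<bar> * (rmax \<phi> \<gamma> v p) ^ 3"
    "\<bar>gauge_c \<phi> \<gamma> v p $ i $ j\<bar> \<le> 66 * (\<phi> (fst p))\<^sup>2 * (rmax \<phi> \<gamma> v p)\<^sup>2"
    "1 / 2 * trace (gauge_c \<phi> \<gamma> v p) \<le>
      (6 * real CARD('n) + 24) * (\<phi> (fst p))\<^sup>2 * (norm (pos \<phi> \<gamma> v p))\<^sup>2"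
proof -
  define R where "R = rmax \<phi> \<gamma> v p"
  define y where "y = pos \<phi> \<gamma> v p"
  define f where "f = \<phi> (fst p)"
  have R: "norm y \<le> R" unfolding R_def y_def by (rule pos_le_rmax[OF pg p])
  have R0: "0 \<le> R" using R norm_ge_zero order_trans by blast
  have yR: "(norm y)\<^sup>2 \<le> R\<^sup>2" using R by (intro power_mono) auto
  have p4: "(R\<^sup>2)\<^sup>2 = R ^ 4" by simp
  note g = gauge_fun_bounds[OF zero_le_power2 yR]
  show "(rmax \<phi> \<gamma> v p) ^ 4 / 2 \<le> gauge \<phi> \<gamma> v p" "gauge \<phi> \<gamma> v p \<le> 4 * (rmax \<phi> \<gamma> v p) ^ 4"
    "0 \<le> gauge \<phi> \<gamma> v p"
    using g(1-3) unfolding p4 gauge_def R_def y_def by auto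
  have "norm (gauge_b \<phi> \<gamma> v p) = 2 * \<bar>gauge_fun' (R\<^sup>2) ((norm y)\<^sup>2)\<bar> * \<bar>f\<bar> * norm y"
    by (simp add: gauge_b_def R_def y_def f_def abs_mult)
  also have "\<dots> \<le> 2 * (9 * R\<^sup>2) * \<bar>f\<bar> * R"
    using g(5) R R0 by (intro mult_mono mult_nonneg_nonneg) auto
  also have "\<dots> = 18 * \<bar>f\<bar> * R ^ 3" by (simp add: power2_eq_square power3_eq_cube)
  finally show "norm (gauge_b \<phi> \<gamma> v p) \<le> 18 * \<bar>\<phi> (fst p)\<bar> * (rmax \<phi> \<gamma> v p) ^ 3"
    by (simp add: R_def f_def)
  have yy: "\<bar>y $ i * y $ j\<bar> \<le> R\<^sup>2"
  proof -
    have "\<bar>y $ i\<bar> * \<bar>y $ j\<bar> \<le> R * R"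
      using R R0 component_le_norm_cart[of y] by (intro mult_mono) (auto intro: order_trans)
    then show ?thesis by (simp add: abs_mult power2_eq_square)
  qed
  have "\<bar>2 * gauge_fun' (R\<^sup>2) ((norm y)\<^sup>2) * (if i = j then 1 else 0) + 4 * (gauge_fun'' (R\<^sup>2) ((norm y)\<^sup>2) * (y $ i * y $ j))\<bar>
     \<le> 2 * (9 * R\<^sup>2) + 4 * (12 * R\<^sup>2)"
  proof (rule order_trans[OF abs_triangle_ineq add_mono])
    show "\<bar>2 * gauge_fun' (R\<^sup>2) ((norm y)\<^sup>2) * (if i = j then 1 else 0)\<bar> \<le> 2 * (9 * R\<^sup>2)"
      using g(5) R0 by auto
    have "\<bar>gauge_fun'' (R\<^sup>2) ((norm y)\<^sup>2)\<bar> * \<bar>y $ i * y $ j\<bar> \<le> 12 * R\<^sup>2"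
      using g(6,7) yy by (intro mult_mono) auto
    then show "\<bar>4 * (gauge_fun'' (R\<^sup>2) ((norm y)\<^sup>2) * (y $ i * y $ j))\<bar> \<le> 4 * (12 * R\<^sup>2)" by (simp add: abs_mult ac_simps)
  qed
  then have "f\<^sup>2 * \<bar>2 * gauge_fun' (R\<^sup>2) ((norm y)\<^sup>2) * (if i = j then 1 else 0) + 4 * (gauge_fun'' (R\<^sup>2) ((norm y)\<^sup>2) * (y $ i * y $ j))\<bar>
     \<le> f\<^sup>2 * (66 * R\<^sup>2)" by (intro mult_left_mono) auto
  then show "\<bar>gauge_c \<phi> \<gamma> v p $ i $ j\<bar> \<le> 66 * (\<phi> (fst p))\<^sup>2 * (rmax \<phi> \<gamma> v p)\<^sup>2"
    unfolding gauge_c_def R_def[symmetric] y_def[symmetric] f_def[symmetric] vec_lambda_beta abs_mult[of "f\<^sup>2"] by simp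
  have nn: "(norm y)\<^sup>2 = (\<Sum>i\<in>UNIV. y $ i * y $ i)" by (simp add: power2_norm_eq_inner inner_vec_def)
  have "trace (gauge_c \<phi> \<gamma> v p) = (\<Sum>i\<in>(UNIV :: 'n set). f\<^sup>2 * (2 * gauge_fun' (R\<^sup>2) ((norm y)\<^sup>2) + 4 * (gauge_fun'' (R\<^sup>2) ((norm y)\<^sup>2) * (y $ i * y $ i))))"
    by (simp add: trace_def gauge_c_def R_def y_def f_def)
  also have "\<dots> = f\<^sup>2 * (real CARD('n) * (2 * gauge_fun' (R\<^sup>2) ((norm y)\<^sup>2)) + 4 * (gauge_fun'' (R\<^sup>2) ((norm y)\<^sup>2) * (norm y)\<^sup>2))"
    by (simp add: sum.distrib nn flip: sum_distrib_left)
  finally have "1 / 2 * trace (gauge_c \<phi> \<gamma> v p) =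
      f\<^sup>2 * (real CARD('n) * gauge_fun' (R\<^sup>2) ((norm y)\<^sup>2) + 2 * (gauge_fun'' (R\<^sup>2) ((norm y)\<^sup>2) * (norm y)\<^sup>2))"
    by (simp add: algebra_simps)
  also have "\<dots> \<le> f\<^sup>2 * (real CARD('n) * (6 * (norm y)\<^sup>2) + 2 * (12 * (norm y)\<^sup>2))"
    using g by (intro mult_left_mono add_mono mult_right_mono) auto
  also have "\<dots> = (6 * real CARD('n) + 24) * f\<^sup>2 * (norm y)\<^sup>2" by (simp add: algebra_simps)
  finally show "1 / 2 * trace (gauge_c \<phi> \<gamma> v p) \<le>
      (6 * real CARD('n) + 24) * (\<phi> (fst p))\<^sup>2 * (norm (pos \<phi> \<gamma> v p))\<^sup>2"
    by (simp add: f_def y_def)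
qed

lemma rmax_growth: "\<exists>C\<ge>0. \<forall>p\<in>Lambda T. 0 \<le> rmax \<phi> \<gamma> v p \<and> rmax \<phi> \<gamma> v p \<le> C * (1 + sup_norm T (snd p))"
proof -
  obtain C where C: "C \<ge> 0" "\<And>x t. x \<in> cadlag_paths T \<Longrightarrow> t \<in> {0..T} \<Longrightarrow> norm (pos \<phi> \<gamma> v (t, x)) \<le> C * (1 + sup_norm T x)"
    using pos_bound[OF pg] by blast
  show ?thesis
  proof (intro exI[of _ C] conjI ballI C(1))
    fix p :: "real \<times> 'n path" assume p: "p \<in> Lambda T"
    obtain t x where tx: "p = (t, x)" by (cases p)
    have ph: "(t, x) \<in> Lambda_hat T" using p Lambda_subset tx by auto
    then have *: "x \<in> cadlag_paths T" "t \<in> {0..T}" by (auto simp: Lambda_hat_def)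
    show "0 \<le> rmax \<phi> \<gamma> v p" using rmax_nonneg[OF pg ph] tx by simp
    show "rmax \<phi> \<gamma> v p \<le> C * (1 + sup_norm T (snd p))"
      unfolding tx snd_conv by (rule rmax_least[OF pg *(2)]) (use C * in auto)
  qed
qed

lemma primitive_bound: "\<exists>B\<ge>0. \<forall>t\<in>{0..T}. \<bar>\<phi> t\<bar> \<le> B"
proof -
  have "bounded (\<phi> ` {0..T})"
    by (rule compact_imp_bounded[OF compact_continuous_image[OF primitiveD(3)[OF pg] compact_Icc]])
  then obtain B where B: "\<forall>t\<in>{0..T}. \<bar>\<phi> t\<bar> \<le> B" unfolding bounded_iff by auto
  then have "0 \<le> B" by (intro order_trans[OF abs_ge_zero[of "\<phi> 0"]] bspec[OF B]) (use T_pos in simp)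
  then show ?thesis using B by blast
qed

lemma quartic_power:
  fixes F :: "real \<times> 'n path \<Rightarrow> 'b::real_normed_vector"
  assumes n: "n \<le> 4" and F: "\<And>p. p \<in> Lambda T \<Longrightarrow> norm (F p) \<le> K * (rmax \<phi> \<gamma> v p) ^ n"
  shows "quartic F"
proof -
  obtain C where C: "C \<ge> 0" "\<And>p. p \<in> Lambda T \<Longrightarrow> 0 \<le> rmax \<phi> \<gamma> v p"
     "\<And>p. p \<in> Lambda T \<Longrightarrow> rmax \<phi> \<gamma> v p \<le> C * (1 + sup_norm T (snd p))" using rmax_growth by blast
  show ?thesis
  proof (rule quarticI[of _ "\<bar>K\<bar> * C ^ n"])
    fix p :: "real \<times> 'n path" assume p: "p \<in> Lambda T"
    have s: "0 \<le> sup_norm T (snd p)" by (rule Lambda_sup_norm_nonneg[OF p])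
    have "norm (F p) \<le> \<bar>K\<bar> * (rmax \<phi> \<gamma> v p) ^ n"
      by (rule order_trans[OF F[OF p] mult_right_mono]) (use C(2)[OF p] in auto)
    also have "\<dots> \<le> \<bar>K\<bar> * (C * (1 + sup_norm T (snd p))) ^ n"
      using C p by (intro mult_left_mono power_mono) auto
    also have "\<dots> = \<bar>K\<bar> * C ^ n * (1 + sup_norm T (snd p)) ^ n" by (simp add: power_mult_distrib)
    also have "\<dots> \<le> \<bar>K\<bar> * C ^ n * (1 + sup_norm T (snd p)) ^ 4"
      using C(1) s n by (intro mult_left_mono power_increasing) auto
    finally show "norm (F p) \<le> \<bar>K\<bar> * C ^ n * (1 + sup_norm T (snd p)) ^ 4" .
  qed
qed

lemma smooth_gauge: "smooth (gauge \<phi> \<gamma> v) (\<lambda>_. 0) (gauge_b \<phi> \<gamma> v) (gauge_c \<phi> \<gamma> v)"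
proof (rule smooth_flat[OF flat_C2_gauge[OF pg]])
  obtain B where B: "B \<ge> 0" "\<And>t. t \<in> {0..T} \<Longrightarrow> \<bar>\<phi> t\<bar> \<le> B" using primitive_bound by blast
  have ph: "p \<in> Lambda_hat T" "\<bar>\<phi> (fst p)\<bar> \<le> B" "0 \<le> rmax \<phi> \<gamma> v p" if "p \<in> Lambda T" for p :: "real \<times> 'n path"
    using that Lambda_subset B rmax_growth by (auto simp: Lambda_def)
  show "quartic (gauge \<phi> \<gamma> v)"
    by (rule quartic_power[of 4 _ 4]) (use gauge_estimates(2,3)[OF ph(1)] in auto)
  show "quartic (gauge_b \<phi> \<gamma> v)"
  proof (rule quartic_power[of 3 _ "18 * B"])
    fix p :: "real \<times> 'n path" assume p: "p \<in> Lambda T"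
    have "18 * \<bar>\<phi> (fst p)\<bar> * (rmax \<phi> \<gamma> v p) ^ 3 \<le> 18 * B * (rmax \<phi> \<gamma> v p) ^ 3"
      using ph[OF p] by (intro mult_right_mono) auto
    then show "norm (gauge_b \<phi> \<gamma> v p) \<le> 18 * B * (rmax \<phi> \<gamma> v p) ^ 3"
      using gauge_estimates(4)[OF ph(1)[OF p]] by linarith
  qed simp
  show "quartic (gauge_c \<phi> \<gamma> v)"
  proof (rule quartic_power[of 2 _ "real CARD('n) * (real CARD('n) * (66 * B\<^sup>2))"])
    fix p :: "real \<times> 'n path" assume p: "p \<in> Lambda T"
    have "(\<phi> (fst p))\<^sup>2 \<le> B\<^sup>2" using ph[OF p] B(1) by (simp add: abs_le_square_iff[symmetric])
    then have "66 * (\<phi> (fst p))\<^sup>2 * (rmax \<phi> \<gamma> v p)\<^sup>2 \<le> 66 * B\<^sup>2 * (rmax \<phi> \<gamma> v p)\<^sup>2"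
      by (intro mult_right_mono) auto
    then have "\<bar>gauge_c \<phi> \<gamma> v p $ i $ j\<bar> \<le> 66 * B\<^sup>2 * (rmax \<phi> \<gamma> v p)\<^sup>2" for i j
      using gauge_estimates(5)[OF ph(1)[OF p], of i j] by linarith
    from norm_matrix_le[OF this]
    show "norm (gauge_c \<phi> \<gamma> v p) \<le> real CARD('n) * (real CARD('n) * (66 * B\<^sup>2)) * (rmax \<phi> \<gamma> v p)\<^sup>2"
      by (simp add: mult.assoc)
  qed simp
qed

definition pos_c :: "real \<times> 'n path \<Rightarrow> real ^ 'n ^ 'n" where
  "pos_c p = (\<chi> i j. 2 * (\<phi> (fst p))\<^sup>2 * (if i = j then 1 else 0))"

lemma smooth_norm_pos:
  "smooth (\<lambda>p. (norm (pos \<phi> \<gamma> v p))\<^sup>2) (\<lambda>_. 0) (\<lambda>p. (2 * \<phi> (fst p)) *\<^sub>R pos \<phi> \<gamma> v p) pos_c"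
proof (rule smooth_flat)
  show "flat_C2 (\<lambda>p. (norm (pos \<phi> \<gamma> v p))\<^sup>2) (\<lambda>p. (2 * \<phi> (fst p)) *\<^sub>R pos \<phi> \<gamma> v p) pos_c"
  proof (rule flat_C2I)
    fix x :: "'n path" and t s assume *: "x \<in> cadlag_paths T" "t \<in> {0..T}" "s \<in> {t..T}"
    then show "(norm (pos \<phi> \<gamma> v (s, stopped T t x)))\<^sup>2 = (norm (pos \<phi> \<gamma> v (t, x)))\<^sup>2"
      by (simp add: pos_stopped[OF pg] min_absorb2)
  next
    fix t :: real and x :: "'n path" and i j assume tx: "(t, x) \<in> Lambda_hat T"
    define y where "y = pos \<phi> \<gamma> v (t, x)"
    have bp: "pos \<phi> \<gamma> v (t, bumped T t (h *\<^sub>R axis i 1) x) = y + (\<phi> t * h) *\<^sub>R axis i 1" for h i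
      by (simp add: pos_bump[OF pg tx] y_def)
    have n2: "(norm (y + (\<phi> t * h) *\<^sub>R axis i 1))\<^sup>2 = (norm y)\<^sup>2 + 2 * \<phi> t * y $ i * h + (\<phi> t)\<^sup>2 * h\<^sup>2" for h i
      by (simp only: power2_norm_eq_inner inner_add_left inner_add_right inner_scaleR_left inner_scaleR_right)
         (simp add: inner_axis inner_axis' power2_eq_square algebra_simps)
    show "((\<lambda>h. (norm (pos \<phi> \<gamma> v (t, bumped T t (h *\<^sub>R axis i 1) x)))\<^sup>2) has_real_derivative
       ((2 * \<phi> (fst (t, x))) *\<^sub>R pos \<phi> \<gamma> v (t, x)) $ i) (at 0)"
      unfolding bp n2 y_def[symmetric] by (auto intro!: derivative_eq_intros)
    have "((\<lambda>h. 2 * \<phi> t * (y $ i + (\<phi> t * h) * (if i = j then 1 else 0))) has_real_derivative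
      2 * \<phi> t * (\<phi> t * (if i = j then 1 else 0))) (at 0)"
      by (auto intro!: derivative_eq_intros)
    then show "((\<lambda>h. ((2 * \<phi> (fst (t, bumped T t (h *\<^sub>R axis j 1) x))) *\<^sub>R pos \<phi> \<gamma> v (t, bumped T t (h *\<^sub>R axis j 1) x)) $ i)
       has_real_derivative pos_c (t, x) $ i $ j) (at 0)"
      unfolding bp by (simp add: pos_c_def axis_def power2_eq_square mult.assoc cong: if_cong)
  next
    fix p :: "real \<times> 'n path" assume p: "p \<in> Lambda_hat T"
    have ft: "((\<lambda>p. \<phi> (fst p)) \<longlongrightarrow> \<phi> (fst p)) (nb p)" by (rule tendsto_time_fun_nb[OF primitiveD(3)[OF pg] p])
    show "((\<lambda>p. (norm (pos \<phi> \<gamma> v p))\<^sup>2) \<longlongrightarrow> (norm (pos \<phi> \<gamma> v p))\<^sup>2) (nb p)"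
      by (intro tendsto_intros tendsto_pos_nb[OF pg] p)
    show "((\<lambda>p. (2 * \<phi> (fst p)) *\<^sub>R pos \<phi> \<gamma> v p) \<longlongrightarrow> (2 * \<phi> (fst p)) *\<^sub>R pos \<phi> \<gamma> v p) (nb p)"
      by (intro tendsto_intros ft tendsto_pos_nb[OF pg] p)
    show "(pos_c \<longlongrightarrow> pos_c p) (nb p)"
      unfolding pos_c_def[abs_def] by (intro vec_tendstoI) (auto intro!: tendsto_intros ft)
  qed
  obtain B where B: "B \<ge> 0" "\<And>t. t \<in> {0..T} \<Longrightarrow> \<bar>\<phi> t\<bar> \<le> B" using primitive_bound by blast
  have ph: "p \<in> Lambda_hat T" "\<bar>\<phi> (fst p)\<bar> \<le> B" "0 \<le> rmax \<phi> \<gamma> v p" if "p \<in> Lambda T" for p :: "real \<times> 'n path"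
    using that Lambda_subset B rmax_growth by (auto simp: Lambda_def)
  show "quartic (\<lambda>p. (norm (pos \<phi> \<gamma> v p))\<^sup>2)"
    by (rule quartic_power[of 2 _ 1]) (use pos2_le_rmax2[OF pg ph(1)] in auto)
  show "quartic (\<lambda>p. (2 * \<phi> (fst p)) *\<^sub>R pos \<phi> \<gamma> v p)"
  proof (rule quartic_power[of 1 _ "2 * B"])
    fix p :: "real \<times> 'n path" assume p: "p \<in> Lambda T"
    have "(2 * \<bar>\<phi> (fst p)\<bar>) * norm (pos \<phi> \<gamma> v p) \<le> (2 * B) * rmax \<phi> \<gamma> v p"
      using ph[OF p] B(1) pos_le_rmax[OF pg ph(1)[OF p]] by (intro mult_mono) auto
    then show "norm ((2 * \<phi> (fst p)) *\<^sub>R pos \<phi> \<gamma> v p) \<le> 2 * B * rmax \<phi> \<gamma> v p ^ 1" by (simp add: abs_mult)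
  qed simp
  show "quartic pos_c"
  proof (rule quartic_power[of 0 _ "real CARD('n) * (real CARD('n) * (2 * B\<^sup>2))"])
    fix p :: "real \<times> 'n path" assume p: "p \<in> Lambda T"
    have "(\<phi> (fst p))\<^sup>2 \<le> B\<^sup>2" using ph[OF p] B(1) by (simp add: abs_le_square_iff[symmetric])
    then have "\<bar>pos_c p $ i $ j\<bar> \<le> 2 * B\<^sup>2" for i j by (simp add: pos_c_def)
    from norm_matrix_le[OF this]
    show "norm (pos_c p) \<le> real CARD('n) * (real CARD('n) * (2 * B\<^sup>2)) * (rmax \<phi> \<gamma> v p) ^ 0" by simp
  qed simp
qed

end

subsection \<open>A smooth saturation\<close>

text \<open>
  The auxiliary functions of a piecewise polynomial \<open>cut\<close> of class \<open>C\<^sup>2\<close> that increases from \<open>0\<close>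
  on \<open>s \<le> 1\<close> to \<open>1\<close> on \<open>s \<ge> 2\<close>.
\<close>

definition cutP :: "real \<Rightarrow> real" where "cutP s = max 0 (s - 1)"

definition cutQ :: "real \<Rightarrow> real" where "cutQ s = max 0 (1 - cutP s ^ 3)"

definition cut :: "real \<Rightarrow> real" where "cut s = 1 - cutQ s ^ 3"

definition cut1 :: "real \<Rightarrow> real" where "cut1 s = 9 * (cutQ s)\<^sup>2 * (cutP s)\<^sup>2"

definition cut2 :: "real \<Rightarrow> real" where "cut2 s = 18 * (cutQ s)\<^sup>2 * cutP s - 54 * cutQ s * (cutP s) ^ 4"

lemma cut:
  shows DERIV_cut: "(cut has_real_derivative cut1 s) (at s)"
    and DERIV_cut1: "(cut1 has_real_derivative cut2 s) (at s)"
    and cut2_cont: "continuous_on UNIV cut2"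
    and cut_low: "s \<le> 1 \<Longrightarrow> cut s = 0"
    and cut_high: "s \<ge> 2 \<Longrightarrow> cut s = 1" "s \<ge> 2 \<Longrightarrow> cut1 s = 0" "s \<ge> 2 \<Longrightarrow> cut2 s = 0"
    and cut_range: "0 \<le> cut s" "cut s \<le> 1"
    and cut_bounds: "\<bar>cut1 s\<bar> \<le> 100" "\<bar>cut2 s\<bar> \<le> 100"
proof -
  note P_def = cutP_def and Q_def = cutQ_def and E_def = cut_def and E1_def = cut1_def and E2_def = cut2_def
  have p3: "((\<lambda>x::real. (max 0 x) ^ 3) has_real_derivative 3 * (max 0 x)\<^sup>2) (at x)"
    and p2: "((\<lambda>x::real. (max 0 x)\<^sup>2) has_real_derivative 2 * (max 0 x)) (at x)" for x
    using DERIV_pos_part_power[of 1 x] DERIV_pos_part_power[of 0 x] by (simp_all add: eval_nat_numeral)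
  have d0: "((\<lambda>s::real. s - 1) has_real_derivative 1) (at s)" for s by (auto intro!: derivative_eq_intros)
  have dP3: "((\<lambda>s. cutP s ^ 3) has_real_derivative 3 * (cutP s)\<^sup>2) (at s)" for s
    unfolding P_def using DERIV_chain2[OF p3 d0] by simp
  have dP2: "((\<lambda>s. (cutP s)\<^sup>2) has_real_derivative 2 * cutP s) (at s)" for s
    unfolding P_def using DERIV_chain2[OF p2 d0] by simp
  have d1: "((\<lambda>s. 1 - cutP s ^ 3) has_real_derivative - (3 * (cutP s)\<^sup>2)) (at s)" for s
    using DERIV_diff[OF DERIV_const dP3, of 1 s] by simp
  have dQ3: "((\<lambda>s. cutQ s ^ 3) has_real_derivative 3 * (cutQ s)\<^sup>2 * - (3 * (cutP s)\<^sup>2)) (at s)" for s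
    unfolding Q_def by (rule DERIV_chain2[OF p3 d1])
  have dQ2: "((\<lambda>s. (cutQ s)\<^sup>2) has_real_derivative 2 * cutQ s * - (3 * (cutP s)\<^sup>2)) (at s)" for s
    unfolding Q_def by (rule DERIV_chain2[OF p2 d1])
  have f1: "\<forall>s. (cut has_real_derivative cut1 s) (at s)"
  proof
    fix s show "(cut has_real_derivative cut1 s) (at s)"
    using DERIV_diff[OF DERIV_const dQ3, of 1 s] by (simp add: E_def[abs_def] E1_def mult.assoc)
  qed
  have f2: "\<forall>s. (cut1 has_real_derivative cut2 s) (at s)"
  proof
    fix s
    have "9 * ((cutQ s)\<^sup>2 * (2 * cutP s) + (2 * cutQ s * - (3 * (cutP s)\<^sup>2)) * (cutP s)\<^sup>2) = cut2 s"
      by (simp add: E2_def power2_eq_square power4_eq_xxxx algebra_simps)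
    then show "(cut1 has_real_derivative cut2 s) (at s)"
      using DERIV_cmult[OF DERIV_mult'[OF dQ2 dP2], of 9 s] by (simp add: E1_def[abs_def] mult.assoc)
  qed
  have f3: "continuous_on UNIV cut2"
    unfolding E2_def[abs_def] Q_def P_def by (intro continuous_intros)
  have f4: "\<forall>s\<le>1. cut s = 0" by (simp add: E_def Q_def P_def)
  have Q0: "cutQ s = 0" if "s \<ge> 2" for s
  proof -
    have "1 \<le> cutP s ^ 3" using that by (intro one_le_power) (auto simp: P_def)
    then show ?thesis by (simp add: Q_def)
  qed
  then have f5: "\<forall>s\<ge>2. cut s = 1 \<and> cut1 s = 0 \<and> cut2 s = 0" by (simp add: E_def E1_def E2_def)
  have Q01: "0 \<le> cutQ s" "cutQ s \<le> 1" and P0: "0 \<le> cutP s" for s by (auto simp: Q_def P_def)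
  have f6: "\<forall>s. 0 \<le> cut s \<and> cut s \<le> 1 \<and> \<bar>cut1 s\<bar> \<le> 100 \<and> \<bar>cut2 s\<bar> \<le> 100"
  proof
    fix s
    have cut: "0 \<le> cut s" "cut s \<le> 1" using power_le_one[OF Q01(1,2), of s 3] Q01[of s] by (auto simp: E_def)
    show "0 \<le> cut s \<and> cut s \<le> 1 \<and> \<bar>cut1 s\<bar> \<le> 100 \<and> \<bar>cut2 s\<bar> \<le> 100"
    proof (cases "s \<ge> 2")
      case True then show ?thesis using Q0[OF True] cut by (simp add: E1_def E2_def)
    next
      case False
      then have P1: "cutP s \<le> 1" by (simp add: P_def)
      have "(cutQ s)\<^sup>2 * (cutP s)\<^sup>2 \<le> 1 * 1" using P1 P0[of s] Q01[of s] by (intro mult_mono power_le_one) auto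
      moreover have "0 \<le> (cutQ s)\<^sup>2 * (cutP s)\<^sup>2" by simp
      moreover have "(cutQ s)\<^sup>2 * cutP s \<le> 1 * 1" using P1 P0[of s] Q01[of s] by (intro mult_mono power_le_one) auto
      moreover have "0 \<le> (cutQ s)\<^sup>2 * cutP s" using P0 by simp
      moreover have "cutQ s * (cutP s) ^ 4 \<le> 1 * 1" using P1 P0[of s] Q01[of s] by (intro mult_mono power_le_one) auto
      moreover have "0 \<le> cutQ s * (cutP s) ^ 4" using Q01 by simp
      ultimately show ?thesis using cut unfolding E1_def E2_def mult.assoc by (auto simp: abs_le_iff)
    qed
  qed
  show "(cut has_real_derivative cut1 s) (at s)" "(cut1 has_real_derivative cut2 s) (at s)"
    "continuous_on UNIV cut2" "s \<le> 1 \<Longrightarrow> cut s = 0" "s \<ge> 2 \<Longrightarrow> cut s = 1" "s \<ge> 2 \<Longrightarrow> cut1 s = 0"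
    "s \<ge> 2 \<Longrightarrow> cut2 s = 0" "0 \<le> cut s" "cut s \<le> 1" "\<bar>cut1 s\<bar> \<le> 100" "\<bar>cut2 s\<bar> \<le> 100"
    using f1 f2 f3 f4 f5 f6 by simp_all
qed

subsection \<open>A smooth supersolution above the gauge\<close>

context
  fixes \<phi> \<gamma> :: "real \<Rightarrow> real" and v :: "real ^ 'n::finite"
  assumes pg: "primitive \<phi> \<gamma>"
begin

text \<open>
  The quadratic variation that the window integral of a Brownian path still accumulates after
  time \<open>t\<close>.
\<close>

definition qvar :: "real \<Rightarrow> real" where
  "qvar t = integral {0..T} (\<lambda>s. (\<phi> s)\<^sup>2) - integral {0..t} (\<lambda>s. (\<phi> s)\<^sup>2)"

lemma qvar_deriv:
  "t \<in> {0..T} \<Longrightarrow> (qvar has_real_derivative - (\<phi> t)\<^sup>2) (at t within {0..T})"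
proof -
  assume t: "t \<in> {0..T}"
  have "continuous_on {0..T} (\<lambda>s. (\<phi> s)\<^sup>2)" using primitiveD(3)[OF pg] by (intro continuous_intros)
  from integral_has_real_derivative[OF this t]
  show ?thesis unfolding qvar_def[abs_def] by (auto intro!: derivative_eq_intros)
qed

text \<open>
  With \<open>C = 6 d + 24\<close>, half the trace of the Hessian of the gauge is at most \<open>C \<phi>\<^sup>2 |y|\<^sup>2\<close>. The
  time derivative of \<open>C A |y|\<^sup>2\<close>, where \<open>A\<close> is the remaining quadratic variation, cancels it; the
  Hessian of \<open>C A |y|\<^sup>2\<close> contributes \<open>C d A \<phi>\<^sup>2\<close>, which the time derivative of \<open>(C d / 2) A\<^sup>2\<close>
  cancels in turn.
\<close>

definition martingale_bound :: "real \<times> 'n path \<Rightarrow> real" where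
  "martingale_bound p = gauge \<phi> \<gamma> v p + (6 * real CARD('n) + 24) * qvar (fst p) * (norm (pos \<phi> \<gamma> v p))\<^sup>2 +
     (3 * real CARD('n) + 12) * real CARD('n) * (qvar (fst p))\<^sup>2"

lemma smooth_martingale_bound:
  "\<exists>a b c. smooth martingale_bound a b c \<and> (\<forall>p\<in>Lambda T. a p + 1 / 2 * trace (c p) \<le> 0)"
proof -
  let ?C = "6 * real CARD('n) + 24" and ?d = "real CARD('n)"
  have fc: "continuous_on {0..T} \<phi>" by (rule primitiveD(3)[OF pg])
  have qc: "continuous_on {0..T} qvar" by (rule DERIV_continuous_on[OF qvar_deriv])
  have d1: "((\<lambda>t. ?C * qvar t) has_real_derivative ?C * - (\<phi> t)\<^sup>2) (at t within {0..T})" if "t \<in> {0..T}" for t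
    by (rule DERIV_cmult[OF qvar_deriv[OF that]])
  have c1: "continuous_on {0..T} (\<lambda>t. ?C * - (\<phi> t)\<^sup>2)" by (intro continuous_intros fc)
  note S1 = smooth_time_mult[OF smooth_norm_pos[OF pg, of v] d1 c1]
  have d2: "((\<lambda>t. (3 * ?d + 12) * ?d * (qvar t)\<^sup>2) has_real_derivative (3 * ?d + 12) * ?d * (2 * (qvar t * - (\<phi> t)\<^sup>2))) (at t within {0..T})"
    if "t \<in> {0..T}" for t
    by (rule DERIV_cmult) (use DERIV_power[OF qvar_deriv[OF that], of 2] in \<open>simp add: ac_simps\<close>)
  have c2: "continuous_on {0..T} (\<lambda>t. (3 * ?d + 12) * ?d * (2 * (qvar t * - (\<phi> t)\<^sup>2)))" by (intro continuous_intros fc qc)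
  note S2 = smooth_time[OF d2 c2, where ?'a = 'n]
  note S = smooth_add[OF smooth_add[OF smooth_gauge[OF pg, of v] S1] S2]
  have A: "smooth martingale_bound
    (\<lambda>p. 0 + (?C * - (\<phi> (fst p))\<^sup>2 * (norm (pos \<phi> \<gamma> v (unjump p)))\<^sup>2 + ?C * qvar (fst p) * 0) + (3 * ?d + 12) * ?d * (2 * (qvar (fst p) * - (\<phi> (fst p))\<^sup>2)))
    (\<lambda>p. gauge_b \<phi> \<gamma> v p + (?C * qvar (fst p)) *\<^sub>R (2 * \<phi> (fst p)) *\<^sub>R pos \<phi> \<gamma> v p + 0)
    (\<lambda>p. gauge_c \<phi> \<gamma> v p + (?C * qvar (fst p)) *\<^sub>R pos_c \<phi> p + 0)"
    unfolding martingale_bound_def[abs_def] by (rule S)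
  have B: "(0 + (?C * - (\<phi> (fst p))\<^sup>2 * (norm (pos \<phi> \<gamma> v (unjump p)))\<^sup>2 + ?C * qvar (fst p) * 0) + (3 * ?d + 12) * ?d * (2 * (qvar (fst p) * - (\<phi> (fst p))\<^sup>2)))
     + 1 / 2 * trace (gauge_c \<phi> \<gamma> v p + (?C * qvar (fst p)) *\<^sub>R pos_c \<phi> p + 0) \<le> 0" if p: "p \<in> Lambda T" for p :: "real \<times> 'n path"
  proof -
    have ph: "p \<in> Lambda_hat T" using p Lambda_subset by auto
    have "trace (pos_c \<phi> p) = ?d * (2 * (\<phi> (fst p))\<^sup>2)" by (simp add: trace_def pos_c_def[OF pg])
    moreover have "trace (gauge_c \<phi> \<gamma> v p + (?C * qvar (fst p)) *\<^sub>R pos_c \<phi> p + 0) =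
      trace (gauge_c \<phi> \<gamma> v p) + ?C * qvar (fst p) * trace (pos_c \<phi> p)"
      by (simp add: trace_def sum.distrib sum_distrib_left)
    ultimately have "1 / 2 * trace (gauge_c \<phi> \<gamma> v p + (?C * qvar (fst p)) *\<^sub>R pos_c \<phi> p + 0) =
      1 / 2 * trace (gauge_c \<phi> \<gamma> v p) + ?C * qvar (fst p) * ?d * (\<phi> (fst p))\<^sup>2"
      by simp
    moreover have "?C * qvar (fst p) * ?d * (\<phi> (fst p))\<^sup>2 = (3 * ?d + 12) * ?d * (2 * (qvar (fst p) * (\<phi> (fst p))\<^sup>2))"
      by (simp add: algebra_simps)
    moreover have "?C * - (\<phi> (fst p))\<^sup>2 * (norm (pos \<phi> \<gamma> v (unjump p)))\<^sup>2 = - (?C * (\<phi> (fst p))\<^sup>2 * (norm (pos \<phi> \<gamma> v p))\<^sup>2)"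
      using unjump_Lambda[OF p] by simp
    moreover have "(3 * ?d + 12) * ?d * (2 * (qvar (fst p) * - (\<phi> (fst p))\<^sup>2)) = - ((3 * ?d + 12) * ?d * (2 * (qvar (fst p) * (\<phi> (fst p))\<^sup>2)))"
      by simp
    ultimately show ?thesis using gauge_estimates(6)[OF pg ph, of v] by linarith
  qed
  show ?thesis by (rule exI, rule exI, rule exI, rule conjI, rule A, rule ballI, rule B)
qed

end

section \<open>Windows\<close>

text \<open>
  A quadratic spline from \<open>0\<close> on \<open>u \<le> 0\<close> to \<open>1\<close> on \<open>u \<ge> 1\<close>; its derivative is the hat function
  with top at \<open>1 / 2\<close>.
\<close>

definition step :: "real \<Rightarrow> real" where
  "step u = 2 * (max 0 u)\<^sup>2 - 4 * (max 0 (u - 1 / 2))\<^sup>2 + 2 * (max 0 (u - 1))\<^sup>2"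

definition step' :: "real \<Rightarrow> real" where
  "step' u = 4 * max 0 u - 8 * max 0 (u - 1 / 2) + 4 * max 0 (u - 1)"

lemma DERIV_step: "(step has_real_derivative step' u) (at u)"
proof -
  have p2: "((\<lambda>x::real. (max 0 x)\<^sup>2) has_real_derivative 2 * (max 0 x)) (at x)" for x
    using DERIV_pos_part_power[of 0 x] by (simp add: eval_nat_numeral)
  have d: "((\<lambda>u. (max 0 (u - a))\<^sup>2) has_real_derivative 2 * max 0 (u - a)) (at u)" for a :: real
  proof -
    have "((\<lambda>u. u - a) has_real_derivative 1) (at u)" by (auto intro!: derivative_eq_intros)
    from DERIV_chain2[OF p2 this] show ?thesis by simp
  qed
  have "((\<lambda>u. 2 * (max 0 u)\<^sup>2 - 4 * (max 0 (u - 1 / 2))\<^sup>2 + 2 * (max 0 (u - 1))\<^sup>2) has_real_derivative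
     2 * (2 * max 0 u) - 4 * (2 * max 0 (u - 1 / 2)) + 2 * (2 * max 0 (u - 1))) (at u)"
    by (intro DERIV_add DERIV_diff DERIV_cmult d p2)
  then show ?thesis by (simp add: step_def[abs_def] step'_def)
qed

lemma step_0: "u \<le> 0 \<Longrightarrow> step u = 0" "u \<le> 0 \<Longrightarrow> step' u = 0"
  by (auto simp: step_def step'_def max_def)

lemma step_1: "u \<ge> 1 \<Longrightarrow> step u = 1" "u \<ge> 1 \<Longrightarrow> step' u = 0"
  by (auto simp: step_def step'_def power2_eq_square algebra_simps)

lemma step'_nonneg: "0 \<le> step' u"
  by (auto simp: step'_def max_def)

lemma step'_cont: "continuous_on S step'"
  unfolding step'_def[abs_def] by (intro continuous_intros)

lemma step_mono: "u \<le> w \<Longrightarrow> step u \<le> step w"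
  by (rule DERIV_nonneg_imp_nondecreasing[of u w step]) (use DERIV_step step'_nonneg in blast)+

lemma step_range: "0 \<le> step u" "step u \<le> 1"
  using step_mono[of "min u 0" u] step_mono[of u "max u 1"] step_0(1)[of "min u 0"] step_1(1)[of "max u 1"]
  by auto

text \<open>
  Window \<open>i\<close> is supported between \<open>(i - 1) h\<close> and \<open>(i + 1) h\<close>. The differences of steps
  telescope, so that the first \<open>wnum h\<close> windows sum to \<open>1\<close> on \<open>[0, T]\<close>.
\<close>

definition wphi :: "real \<Rightarrow> nat \<Rightarrow> real \<Rightarrow> real" where
  "wphi h i t = step (t / h - real i + 1) - step (t / h - real i)"

definition wgam :: "real \<Rightarrow> nat \<Rightarrow> real \<Rightarrow> real" where
  "wgam h i t = step' (t / h - real i + 1) / h - step' (t / h - real i) / h"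

definition wnum :: "real \<Rightarrow> nat" where
  "wnum h = nat \<lceil>T / h\<rceil> + 1"

lemma primitive_step:
  "primitive (\<lambda>t. step (t / h + a)) (\<lambda>t. step' (t / h + a) / h)"
  unfolding primitive_def
proof (intro conjI ballI)
  have "continuous_on {0..T} (\<lambda>t. step' (t / h + a))"
    by (rule continuous_on_compose2[OF step'_cont[of UNIV]])
       (auto simp: divide_inverse intro!: continuous_intros)
  then have "continuous_on {0..T} (\<lambda>t. step' (t / h + a) * inverse h)" by (intro continuous_intros)
  then show "continuous_on {0..T} (\<lambda>t. step' (t / h + a) / h)" by (simp add: divide_inverse)
  fix t
  have "((\<lambda>t. t / h + a) has_real_derivative 1 / h) (at t)"
    using DERIV_add[OF DERIV_cdivide[OF DERIV_ident] DERIV_const, of h a t] by simp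
  from DERIV_chain2[OF DERIV_step this]
  show "((\<lambda>t. step (t / h + a)) has_vector_derivative step' (t / h + a) / h) (at t within {0..T})"
    by (simp add: has_real_derivative_iff_has_vector_derivative has_vector_derivative_at_within)
qed

lemma primitive_diff: "primitive f g \<Longrightarrow> primitive f' g' \<Longrightarrow> primitive (\<lambda>t. f t - f' t) (\<lambda>t. g t - g' t)"
  unfolding primitive_def by (auto intro: continuous_on_diff has_vector_derivative_diff)

lemma primitive_window: "primitive (wphi h i) (wgam h i)"
  using primitive_diff[OF primitive_step[of h "1 - real i"] primitive_step[of h "- real i"]]
  by (simp add: wphi_def[abs_def] wgam_def[abs_def] algebra_simps)

lemma wphi_range: "0 < h \<Longrightarrow> 0 \<le> wphi h i t" "wphi h i t \<le> 1"
  using step_mono[of "t / h - real i" "t / h - real i + 1"] step_range(2)[of "t / h - real i + 1"]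
    step_range(1)[of "t / h - real i"] by (auto simp: wphi_def)

lemma window_support:
  assumes h: "0 < h" and t: "t \<le> (real i - 1) * h \<or> (real i + 1) * h \<le> t"
  shows "wphi h i t = 0" "wgam h i t = 0"
proof -
  have "t / h - real i + 1 \<le> 0 \<or> t / h - real i \<ge> 1" using t h by (auto simp: field_simps)
  then show "wphi h i t = 0" "wgam h i t = 0"
    by (auto simp: wphi_def wgam_def step_0 step_1)
qed

lemma wphi_at_0: "0 < h \<Longrightarrow> wphi h i 0 = (if i = 0 then 1 else 0)"
  by (cases i) (auto simp: wphi_def step_0 step_1)

lemma wphi_sum:
  assumes h: "0 < h" and t: "t \<in> {0..T}"
  shows "(\<Sum>i<wnum h. wphi h i t) = 1"
proof -
  have "(\<Sum>i<n. wphi h i t) = step (t / h + 1) - step (t / h - real n + 1)" for n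
    by (induction n) (auto simp: wphi_def algebra_simps)
  moreover have "step (t / h + 1) = 1" using h t by (intro step_1) simp
  moreover have "t / h - real (wnum h) + 1 \<le> 0"
  proof -
    have "t / h \<le> T / h" using h t by (intro divide_right_mono) auto
    moreover have "T / h \<le> real (nat \<lceil>T / h\<rceil>)" by linarith
    ultimately show ?thesis by (simp add: wnum_def)
  qed
  ultimately show ?thesis by (simp add: step_0)
qed

text \<open>
  Only the zeroth window is nonzero at time \<open>0\<close>. Subtracting \<open>v = x 0\<close> from it makes all window
  integrals of \<open>x\<close> start at \<open>0\<close>.
\<close>

definition woff :: "'b::zero \<Rightarrow> nat \<Rightarrow> 'b" where
  "woff v i = (if i = 0 then v else 0)"

abbreviation wpos :: "real \<Rightarrow> real ^ 'n \<Rightarrow> nat \<Rightarrow> real \<times> ('n::finite) path \<Rightarrow> real ^ 'n" where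
  "wpos h v i \<equiv> pos (wphi h i) (wgam h i) (woff v i)"

abbreviation wmax :: "real \<Rightarrow> real ^ 'n \<Rightarrow> nat \<Rightarrow> real \<times> ('n::finite) path \<Rightarrow> real" where
  "wmax h v i \<equiv> rmax (wphi h i) (wgam h i) (woff v i)"

text \<open>
  The window functions sum to \<open>1\<close> and their derivatives to \<open>0\<close>, so the window integrals
  reproduce the path.
\<close>

lemma path_window_sum:
  fixes x :: "('n::finite) path"
  assumes h: "0 < h" and x: "x \<in> cadlag_paths T" and t: "t \<in> {0..T}"
  shows "x t = (\<Sum>i<wnum h. wpos h v i (t, x)) + v"
proof -
  have wi: "(\<lambda>s. wgam h i s *\<^sub>R x s) integrable_on {0..t}" for i
    by (rule cadlag_scale_integrable[OF x primitiveD(1)[OF primitive_window] t])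
  have g0: "(\<Sum>i<wnum h. wgam h i s) = 0" if s: "s \<in> {0<..<T}" for s
  proof -
    have "((\<lambda>s. \<Sum>i<wnum h. wphi h i s) has_vector_derivative (\<Sum>i<wnum h. wgam h i s)) (at s within {0..T})"
      by (rule has_vector_derivative_sum) (use primitiveD(2)[OF primitive_window] s in auto)
    then have 1: "((\<lambda>s. \<Sum>i<wnum h. wphi h i s) has_vector_derivative (\<Sum>i<wnum h. wgam h i s)) (at s)"
      using s at_within_Icc_at[of 0 s T] by simp
    have "((\<lambda>s. 1) has_vector_derivative 0) (at s)" by simp
    then have "((\<lambda>s. \<Sum>i<wnum h. wphi h i s) has_vector_derivative 0) (at s)"
      by (rule has_vector_derivative_transform_within_open[of _ _ _ "{0<..<T}"]) (use s wphi_sum[OF h] in auto)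
    then show ?thesis using 1 vector_derivative_unique_at by blast
  qed
  have "(\<Sum>i<wnum h. wpos h v i (t, x)) = (\<Sum>i<wnum h. wphi h i t *\<^sub>R x t - integral {0..t} (\<lambda>s. wgam h i s *\<^sub>R x s) - woff v i)"
    by (simp add: pos_def win_stopped[OF primitive_window x t])
  also have "\<dots> = (\<Sum>i<wnum h. wphi h i t) *\<^sub>R x t - integral {0..t} (\<lambda>s. \<Sum>i<wnum h. wgam h i s *\<^sub>R x s) - (\<Sum>i<wnum h. woff v i)"
    by (subst Henstock_Kurzweil_Integration.integral_sum) (auto simp: wi sum_subtractf scaleR_left.sum)
  also have "integral {0..t} (\<lambda>s. \<Sum>i<wnum h. wgam h i s *\<^sub>R x s) = integral {0..t} (\<lambda>s. 0)"
    by (rule integral_spike[of "{0, T}"])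
       (use t g0 in \<open>auto simp: scaleR_left.sum[symmetric] simp del: scaleR_left.sum\<close>)
  also have "(\<Sum>i<wnum h. woff v i) = v" by (simp add: woff_def wnum_def sum.delta)
  finally show ?thesis by (simp add: wphi_sum[OF h t])
qed

lemma wpos_eq:
  assumes h: "0 < h" and x: "x \<in> cadlag_paths T" and t: "0 \<le> s" "s \<le> t" "t \<le> T"
    and c: "t \<le> (real i - 1) * h \<or> (real i + 1) * h \<le> s"
  shows "wpos h v i (t, x) = wpos h v i (s, x)"
proof -
  have z: "wphi h i r = 0" "wgam h i r = 0" if "r \<in> {s..t}" for r
    using window_support[OF h, of r i] c that by auto
  have wi: "(\<lambda>s. wgam h i s *\<^sub>R x s) integrable_on {0..t}"
    by (rule cadlag_scale_integrable[OF x primitiveD(1)[OF primitive_window]]) (use t in auto)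
  have "integral {0..t} (\<lambda>s. wgam h i s *\<^sub>R x s) =
      integral {0..s} (\<lambda>s. wgam h i s *\<^sub>R x s) + integral {s..t} (\<lambda>s. wgam h i s *\<^sub>R x s)"
    using t wi by (simp add: Henstock_Kurzweil_Integration.integral_combine)
  also have "integral {s..t} (\<lambda>s. wgam h i s *\<^sub>R x s) = integral {s..t} (\<lambda>s. 0)"
    by (rule Henstock_Kurzweil_Integration.integral_cong) (simp add: z)
  finally show ?thesis using t z by (simp add: pos_def win_stopped[OF primitive_window x])
qed

text \<open>
  In a time interval of length at most \<open>h\<close> no more than three window integrals move, each by at
  most \<open>2 \<rho>\<close>.
\<close>

lemma window_modulus:
  fixes x :: "('n::finite) path"
  assumes h: "0 < h" and x: "x \<in> cadlag_paths T" and t: "t \<in> {0..T}"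
    and small: "\<And>i. i < wnum h \<Longrightarrow> wmax h v i (t, x) \<le> \<rho>" and \<rho>: "0 \<le> \<rho>"
    and rs: "0 \<le> s" "s \<le> r" "r \<le> t" "r - s \<le> h"
  shows "norm (x r - x s) \<le> 6 * \<rho>"
proof -
  define k where "k = nat \<lfloor>s / h\<rfloor>"
  have "real k = of_int \<lfloor>s / h\<rfloor>" using rs h by (simp add: k_def)
  then have k: "real k \<le> s / h" "s / h < real k + 1" by linarith+
  have le: "norm (wpos h v i (r, x) - wpos h v i (s, x)) \<le> (if i \<in> {k..k+2} then 2 * \<rho> else 0)"
    if i: "i < wnum h" for i
  proof (cases "i \<in> {k..k+2}")
    case True
    have "norm (wpos h v i (u, x)) \<le> \<rho>" if "u \<in> {0..t}" for u
      using rmax_upper[OF primitive_window x t that] small[OF i] order_trans by blast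
    then have "norm (wpos h v i (r, x)) \<le> \<rho>" "norm (wpos h v i (s, x)) \<le> \<rho>" using rs by auto
    then show ?thesis using True norm_triangle_ineq4[of "wpos h v i (r, x)" "wpos h v i (s, x)"] by simp
  next
    case False
    have "r / h \<le> s / h + 1" using rs h by (simp add: field_simps)
    have "r \<le> (real i - 1) * h \<or> (real i + 1) * h \<le> s"
    proof (cases "i < k")
      case True
      then have "real i + 1 \<le> s / h" using k by linarith
      then show ?thesis using h by (simp add: field_simps)
    next
      case False
      then have "k + 3 \<le> i" using \<open>i \<notin> {k..k+2}\<close> by auto
      then have "r / h \<le> real i - 1" using k \<open>r / h \<le> s / h + 1\<close> by linarith
      then show ?thesis using h by (simp add: field_simps)
    qed
    then have "wpos h v i (r, x) = wpos h v i (s, x)"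
      using wpos_eq[OF h x rs(1,2), of i v] rs t by auto
    then show ?thesis using False \<rho> by simp
  qed
  have "x r - x s = (\<Sum>i<wnum h. wpos h v i (r, x) - wpos h v i (s, x))"
    using path_window_sum[OF h x, of r v] path_window_sum[OF h x, of s v] rs t by (simp add: sum_subtractf)
  then have "norm (x r - x s) \<le> (\<Sum>i<wnum h. norm (wpos h v i (r, x) - wpos h v i (s, x)))"
    by (simp add: norm_sum)
  also have "\<dots> \<le> (\<Sum>i<wnum h. if i \<in> {k..k+2} then 2 * \<rho> else 0)" by (intro sum_mono le) simp
  also have "\<dots> = real (card ({..<wnum h} \<inter> {k..k+2})) * (2 * \<rho>)"
    by (simp add: sum.If_cases Int_def)
  also have "\<dots> \<le> real 3 * (2 * \<rho>)"
  proof (intro mult_right_mono)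
    have "card ({..<wnum h} \<inter> {k..k+2}) \<le> card {k..k+2}" by (intro card_mono) auto
    then show "real (card ({..<wnum h} \<inter> {k..k+2})) \<le> real 3" by simp
  qed (use \<rho> in auto)
  finally show ?thesis by simp
qed

lemma window_bound:
  fixes x :: "('n::finite) path"
  assumes h: "0 < h" and x: "x \<in> cadlag_paths T" and t: "t \<in> {0..T}"
    and small: "\<And>i. i < wnum h \<Longrightarrow> wmax h v i (t, x) \<le> \<rho>" and r: "r \<in> {0..t}"
  shows "norm (x r) \<le> real (wnum h) * \<rho> + norm v"
proof -
  have "norm (wpos h v i (r, x)) \<le> \<rho>" if "i < wnum h" for i
    using rmax_upper[OF primitive_window x t r] small[OF that] order_trans by blast
  then have "(\<Sum>i<wnum h. norm (wpos h v i (r, x))) \<le> (\<Sum>i<wnum h. \<rho>)" by (intro sum_mono) simp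
  then have "norm (\<Sum>i<wnum h. wpos h v i (r, x)) \<le> real (wnum h) * \<rho>"
    using norm_sum[of "\<lambda>i. wpos h v i (r, x)" "{..<wnum h}"] by simp
  then show ?thesis
    using path_window_sum[OF h x, of r v] r t norm_triangle_ineq[of "\<Sum>i<wnum h. wpos h v i (r, x)" v] by auto
qed

text \<open>
  The converse of \<open>window_modulus\<close>. On the support of a window the path differs by at most \<open>\<omega>\<close>
  from its value \<open>c\<close> at the centre, and for a constant path everything cancels; the boundary
  term contributes one \<open>\<omega>\<close> and the total variation of the window function at most two.
\<close>

lemma window_small:
  fixes x :: "('n::finite) path"
  assumes h: "0 < h" and x: "x \<in> cadlag_paths T"
    and osc: "\<And>r s. r \<in> {0..T} \<Longrightarrow> s \<in> {0..T} \<Longrightarrow> \<bar>r - s\<bar> \<le> h \<Longrightarrow> norm (x r - x s) \<le> \<omega>"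
    and t: "t \<in> {0..T}"
  shows "norm (wpos h (x 0) i (t, x)) \<le> 3 * \<omega>"
proof -
  define m where "m = min (real i * h) T"
  define c where "c = x m"
  have m: "m \<in> {0..T}" using h T_pos by (simp add: m_def)
  have \<omega>: "0 \<le> \<omega>" using osc[OF m m] h by simp
  have near: "norm (x r - c) \<le> \<omega>" if "r \<in> {0..T}" "(real i - 1) * h < r" "r < (real i + 1) * h" for r
    unfolding c_def using that h by (intro osc m) (auto simp: m_def min_def algebra_simps)
  have fn: "norm (wphi h i t *\<^sub>R (x t - c)) \<le> \<omega>"
  proof (cases "wphi h i t = 0")
    case False
    then have "norm (x t - c) \<le> \<omega>" using window_support(1)[OF h, of t i] near t by force
    moreover have "\<bar>wphi h i t\<bar> \<le> 1" using wphi_range[of h i t] h by simp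
    ultimately have "\<bar>wphi h i t\<bar> * norm (x t - c) \<le> 1 * \<omega>" by (intro mult_mono) auto
    then show ?thesis by simp
  qed (use \<omega> in simp)
  have pm: "primitive (\<lambda>t. step (t / h + (1 - real i))) (\<lambda>t. step' (t / h + (1 - real i)) / h)"
    and pn: "primitive (\<lambda>t. step (t / h + (- real i))) (\<lambda>t. step' (t / h + (- real i)) / h)"
    by (rule primitive_step)+
  define G where "G s = (step' (s / h + (1 - real i)) / h + step' (s / h + (- real i)) / h) * \<omega>" for s
  have Gi: "(G has_integral (step (t / h + (1 - real i)) - step (0 / h + (1 - real i)) + (step (t / h + (- real i)) - step (0 / h + (- real i)))) * \<omega>) {0..t}"
    unfolding G_def[abs_def]
    by (intro has_integral_mult_left has_integral_add primitive_integral[OF pm] primitive_integral[OF pn]) (use t in auto)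
  have wi: "(\<lambda>s. wgam h i s *\<^sub>R x s) integrable_on {0..t}"
    by (rule cadlag_scale_integrable[OF x primitiveD(1)[OF primitive_window] t])
  have ci: "((\<lambda>s. wgam h i s *\<^sub>R c) has_integral (wphi h i t - wphi h i 0) *\<^sub>R c) {0..t}"
    using has_integral_scaleR_left[OF primitive_integral[OF primitive_window, of 0 t h i]] t by auto
  have di: "((\<lambda>s. wgam h i s *\<^sub>R x s - wgam h i s *\<^sub>R c) has_integral
      (integral {0..t} (\<lambda>s. wgam h i s *\<^sub>R x s) - (wphi h i t - wphi h i 0) *\<^sub>R c)) {0..t}"
    by (rule has_integral_diff[OF integrable_integral[OF wi] ci])
  have "norm (integral {0..t} (\<lambda>s. wgam h i s *\<^sub>R x s - wgam h i s *\<^sub>R c)) \<le> integral {0..t} G"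
  proof (rule Henstock_Kurzweil_Integration.integral_norm_bound_integral)
    fix s assume s: "s \<in> {0..t}"
    have "norm (wgam h i s *\<^sub>R (x s - c)) \<le> G s"
    proof (cases "wgam h i s = 0")
      case True
      then show ?thesis using h \<omega> step'_nonneg by (simp add: G_def)
    next
      case False
      then have "norm (x s - c) \<le> \<omega>" using window_support(2)[OF h, of s i] near[of s] s t by force
      moreover have "\<bar>wgam h i s\<bar> \<le> step' (s / h + (1 - real i)) / h + step' (s / h + (- real i)) / h"
        using step'_nonneg[of "s / h + (1 - real i)"] step'_nonneg[of "s / h + (- real i)"] h
        unfolding wgam_def by (simp add: abs_le_iff algebra_simps)
      ultimately show ?thesis unfolding G_def norm_scaleR by (intro mult_mono) auto
    qed
    then show "norm (wgam h i s *\<^sub>R x s - wgam h i s *\<^sub>R c) \<le> G s" by (simp add: scaleR_diff_right)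
  qed (use di Gi in auto)
  also have "integral {0..t} G \<le> 2 * \<omega>"
  proof -
    have "step (t / h + (1 - real i)) - step (0 / h + (1 - real i)) + (step (t / h + (- real i)) - step (0 / h + (- real i))) \<le> 2"
      using step_range(2)[of "t / h + (1 - real i)"] step_range(2)[of "t / h + (- real i)"]
        step_range(1)[of "0 / h + (1 - real i)"] step_range(1)[of "0 / h + (- real i)"] by linarith
    then show ?thesis using integral_unique[OF Gi] \<omega> by (simp add: mult_right_mono)
  qed
  finally have I: "norm (integral {0..t} (\<lambda>s. wgam h i s *\<^sub>R x s) - (wphi h i t - wphi h i 0) *\<^sub>R c) \<le> 2 * \<omega>"
    using integral_unique[OF di] by simp
  have off: "woff (x 0) i = wphi h i 0 *\<^sub>R c"
    using h T_pos by (simp add: woff_def wphi_at_0 c_def m_def min_def)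
  have "wpos h (x 0) i (t, x) = wphi h i t *\<^sub>R (x t - c) -
     (integral {0..t} (\<lambda>s. wgam h i s *\<^sub>R x s) - (wphi h i t - wphi h i 0) *\<^sub>R c)"
    by (simp add: pos_def win_stopped[OF primitive_window x t] off algebra_simps)
  then show ?thesis
    using norm_triangle_ineq4[of "wphi h i t *\<^sub>R (x t - c)"
       "integral {0..t} (\<lambda>s. wgam h i s *\<^sub>R x s) - (wphi h i t - wphi h i 0) *\<^sub>R c"] fn I by simp
qed

section \<open>The oscillation penalty\<close>

abbreviation wgauge :: "real \<Rightarrow> real ^ 'n \<Rightarrow> nat \<Rightarrow> real \<times> ('n::finite) path \<Rightarrow> real" where
  "wgauge h v i \<equiv> gauge (wphi h i) (wgam h i) (woff v i)"

definition wcut :: "real \<Rightarrow> real \<Rightarrow> real ^ 'n \<Rightarrow> nat \<Rightarrow> real \<times> ('n::finite) path \<Rightarrow> real" where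
  "wcut h \<rho> v i p = cut (wgauge h v i p / \<rho>)"

definition wcut_b :: "real \<Rightarrow> real \<Rightarrow> real ^ 'n \<Rightarrow> nat \<Rightarrow> real \<times> ('n::finite) path \<Rightarrow> real ^ 'n" where
  "wcut_b h \<rho> v i p = (cut1 (wgauge h v i p / \<rho>) / \<rho>) *\<^sub>R gauge_b (wphi h i) (wgam h i) (woff v i) p"

definition wcut_c :: "real \<Rightarrow> real \<Rightarrow> real ^ 'n \<Rightarrow> nat \<Rightarrow> real \<times> ('n::finite) path \<Rightarrow> real ^ 'n ^ 'n" where
  "wcut_c h \<rho> v i p = (\<chi> k l. cut2 (wgauge h v i p / \<rho>) / \<rho>\<^sup>2 *
      gauge_b (wphi h i) (wgam h i) (woff v i) p $ k * gauge_b (wphi h i) (wgam h i) (woff v i) p $ l +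
      cut1 (wgauge h v i p / \<rho>) / \<rho> * gauge_c (wphi h i) (wgam h i) (woff v i) p $ k $ l)"

lemma flat_C2_wcut: "flat_C2 (wcut h \<rho> v i) (wcut_b h \<rho> v i) (wcut_c h \<rho> v i)"
proof -
  have d: "((\<lambda>s. s / \<rho>) has_real_derivative 1 / \<rho>) (at s)" for s
    by (rule DERIV_cdivide[OF DERIV_ident])
  have 1: "((\<lambda>s. cut (s / \<rho>)) has_real_derivative cut1 (s / \<rho>) / \<rho>) (at s)" for s
    using DERIV_chain2[OF DERIV_cut d] by simp
  have 2: "((\<lambda>s. cut1 (s / \<rho>) / \<rho>) has_real_derivative cut2 (s / \<rho>) / \<rho>\<^sup>2) (at s)" for s
    using DERIV_cdivide[OF DERIV_chain2[OF DERIV_cut1 d]] by (simp add: power2_eq_square)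
  have "continuous_on UNIV (\<lambda>s. cut2 (s * inverse \<rho>) * inverse (\<rho>\<^sup>2))"
    by (intro continuous_intros continuous_on_compose2[OF cut2_cont]) auto
  then have 3: "continuous_on UNIV (\<lambda>s. cut2 (s / \<rho>) / \<rho>\<^sup>2)" by (simp add: divide_inverse)
  from flat_C2_compose[OF flat_C2_gauge[OF primitive_window] 1 2 3]
  show ?thesis unfolding wcut_def[abs_def] wcut_b_def[abs_def] wcut_c_def[abs_def] .
qed

text \<open>
  The derivatives vanish unless the gauge is below \<open>2 \<rho>\<close>, and then the running maximum is at
  most \<open>2\<close>. The factor \<open>wphi\<close> on the right-hand side matters: it makes the sum over all windows
  bounded independently of their number.
\<close>

lemma wcut_estimates:
  assumes h: "0 < h" and \<rho>: "0 < \<rho>" "\<rho> \<le> 1" and p: "p \<in> Lambda_hat T"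
  shows "norm (wcut_b h \<rho> v i p) \<le> 3000000 / \<rho>\<^sup>2 * wphi h i (fst p)"
    "\<bar>wcut_c h \<rho> v i p $ k $ l\<bar> \<le> 3000000 / \<rho>\<^sup>2 * wphi h i (fst p)"
proof -
  define g where "g = wgauge h v i p"
  define f where "f = wphi h i (fst p)"
  define R where "R = wmax h v i p"
  define B where "B = gauge_b (wphi h i) (wgam h i) (woff v i) p"
  define C where "C = gauge_c (wphi h i) (wgam h i) (woff v i) p $ k $ l"
  have f: "0 \<le> f" "f \<le> 1" using wphi_range h by (auto simp: f_def)
  have \<rho>2: "\<rho>\<^sup>2 \<le> \<rho>" using \<rho> by (simp add: power2_eq_square mult_left_le)
  have "norm (wcut_b h \<rho> v i p) \<le> 3000000 / \<rho>\<^sup>2 * f \<and> \<bar>wcut_c h \<rho> v i p $ k $ l\<bar> \<le> 3000000 / \<rho>\<^sup>2 * f"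
  proof (cases "g / \<rho> \<ge> 2")
    case True
    then show ?thesis using f cut_high(2,3)[of "g / \<rho>"]
      by (simp add: wcut_b_def wcut_c_def g_def)
  next
    case False
    then have "g < 2 * \<rho>" using \<rho> by (simp add: field_simps)
    then have "R ^ 4 < 2 ^ 4"
      using gauge_estimates(1)[OF primitive_window p, of h i "woff v i"] \<rho>
      by (simp add: g_def R_def)
    then have R: "R \<le> 2" using power_less_imp_less_base[of R 4 2] by simp
    have R0: "0 \<le> R" using rmax_nonneg[OF primitive_window, of "fst p" "snd p"] p by (simp add: R_def)
    have "norm B \<le> 18 * \<bar>f\<bar> * R ^ 3"
      unfolding B_def f_def R_def by (rule gauge_estimates(4)[OF primitive_window p])
    also have "\<dots> \<le> 18 * \<bar>f\<bar> * 2 ^ 3" using R R0 by (intro mult_left_mono power_mono) auto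
    finally have B: "norm B \<le> 144 * f" using f by simp
    have "\<bar>C\<bar> \<le> 66 * f\<^sup>2 * R\<^sup>2"
      unfolding C_def f_def R_def by (rule gauge_estimates(5)[OF primitive_window p])
    also have "\<dots> \<le> 66 * f\<^sup>2 * 2\<^sup>2" using R R0 by (intro mult_left_mono power_mono) auto
    also have "\<dots> \<le> 264 * f" using f by (simp add: power2_eq_square mult_left_le)
    finally have C: "\<bar>C\<bar> \<le> 264 * f" .
    have c1: "\<bar>cut1 (g / \<rho>) / \<rho>\<bar> \<le> 100 / \<rho>\<^sup>2"
    proof -
      have "\<bar>cut1 (g / \<rho>)\<bar> / \<rho> \<le> 100 / \<rho>\<^sup>2" using cut_bounds(1)[of "g / \<rho>"] \<rho>2 \<rho> by (intro frac_le) auto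
      then show ?thesis using \<rho> by (simp add: abs_divide)
    qed
    have c2: "\<bar>cut2 (g / \<rho>) / \<rho>\<^sup>2\<bar> \<le> 100 / \<rho>\<^sup>2"
      using cut_bounds(2)[of "g / \<rho>"] by (simp add: divide_right_mono)
    have "norm (wcut_b h \<rho> v i p) = \<bar>cut1 (g / \<rho>) / \<rho>\<bar> * norm B" by (simp add: wcut_b_def g_def B_def)
    also have "\<dots> \<le> 100 / \<rho>\<^sup>2 * (144 * f)" using c1 B by (intro mult_mono) auto
    also have "\<dots> = 14400 * (f / \<rho>\<^sup>2)" by simp
    also have "\<dots> \<le> 3000000 * (f / \<rho>\<^sup>2)" using f by (intro mult_right_mono) auto
    also have "\<dots> = 3000000 / \<rho>\<^sup>2 * f" by simp
    finally have 1: "norm (wcut_b h \<rho> v i p) \<le> 3000000 / \<rho>\<^sup>2 * f" .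
    have Bk: "\<bar>B $ k\<bar> \<le> 144 * f" for k using component_le_norm_cart[of B k] B by linarith
    have "\<bar>wcut_c h \<rho> v i p $ k $ l\<bar> = \<bar>cut2 (g / \<rho>) / \<rho>\<^sup>2 * B $ k * B $ l + cut1 (g / \<rho>) / \<rho> * C\<bar>"
      by (simp add: wcut_c_def g_def B_def C_def)
    also have "\<dots> \<le> \<bar>cut2 (g / \<rho>) / \<rho>\<^sup>2 * B $ k * B $ l\<bar> + \<bar>cut1 (g / \<rho>) / \<rho> * C\<bar>" by (rule abs_triangle_ineq)
    also have "\<dots> = \<bar>cut2 (g / \<rho>) / \<rho>\<^sup>2\<bar> * (\<bar>B $ k\<bar> * \<bar>B $ l\<bar>) + \<bar>cut1 (g / \<rho>) / \<rho>\<bar> * \<bar>C\<bar>"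
      by (simp only: abs_mult mult.assoc)
    also have "\<dots> \<le> 100 / \<rho>\<^sup>2 * ((144 * f) * (144 * f)) + 100 / \<rho>\<^sup>2 * (264 * f)"
      using c1 c2 Bk C f by (intro add_mono mult_mono mult_nonneg_nonneg) auto
    also have "\<dots> = 100 / \<rho>\<^sup>2 * (20736 * (f * f) + 264 * f)" by (simp add: algebra_simps)
    also have "\<dots> \<le> 100 / \<rho>\<^sup>2 * (20736 * f + 264 * f)"
    proof -
      have "f * f \<le> f" using f by (simp add: mult_left_le)
      then show ?thesis by (intro mult_left_mono) auto
    qed
    also have "\<dots> = 2100000 * (f / \<rho>\<^sup>2)" by (simp add: field_simps)
    also have "\<dots> \<le> 3000000 * (f / \<rho>\<^sup>2)" using f by (intro mult_right_mono) auto
    also have "\<dots> = 3000000 / \<rho>\<^sup>2 * f" by simp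
    finally show ?thesis using 1 by blast
  qed
  then show "norm (wcut_b h \<rho> v i p) \<le> 3000000 / \<rho>\<^sup>2 * wphi h i (fst p)"
    "\<bar>wcut_c h \<rho> v i p $ k $ l\<bar> \<le> 3000000 / \<rho>\<^sup>2 * wphi h i (fst p)"
    by (simp_all add: f_def)
qed

text \<open>
  The outer function keeps the penalty below \<open>1\<close> however many windows are violated.
\<close>

definition pen :: "real \<Rightarrow> real \<Rightarrow> real ^ 'n \<Rightarrow> real \<times> ('n::finite) path \<Rightarrow> real" where
  "pen h \<rho> v p = 1 - exp (- (\<Sum>i<wnum h. wcut h \<rho> v i p))"

lemma wcut_sum_nonneg: "0 \<le> (\<Sum>i<wnum h. wcut h \<rho> v i p)"
  by (intro sum_nonneg) (simp add: wcut_def cut_range)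

lemma pen_range: "0 \<le> pen h \<rho> v p" "pen h \<rho> v p \<le> 1"
  using wcut_sum_nonneg[of h \<rho> v p] by (auto simp: pen_def)

text \<open>
  The bound on the derivatives depends neither on the scale \<open>h\<close> nor on \<open>v\<close>, since the window
  functions sum to \<open>1\<close>. The variational principle chooses the scales one after the other and
  needs this uniformity.
\<close>

lemma flat_C2_pen:
  fixes v :: "real ^ 'n::finite"
  shows "\<exists>B>0. \<forall>h \<rho> (v :: real ^ 'n). 0 < h \<longrightarrow> 0 < \<rho> \<longrightarrow> \<rho> \<le> 1 \<longrightarrow>
    (\<exists>b c. flat_C2 (pen h \<rho> v) b c \<and> (\<forall>p\<in>Lambda_hat T. norm (b p) \<le> B / \<rho> ^ 4 \<and> norm (c p) \<le> B / \<rho> ^ 4))"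
proof -
  define K :: real where "K = 3000000"
  define d where "d = real CARD('n)"
  have d: "d \<ge> 1" using zero_less_card_finite[where 'a = 'n] by (simp add: d_def Suc_leI)
  define B where "B = d * (d * (K\<^sup>2 + K))"
  have B: "B > 0" "B \<ge> K"
  proof -
    show "B > 0" using d by (simp add: B_def K_def)
    have "1 * (1 * K) \<le> d * (d * (K\<^sup>2 + K))" using d by (intro mult_mono) (auto simp: K_def)
    then show "B \<ge> K" by (simp add: B_def)
  qed
  have "\<exists>b c. flat_C2 (pen h \<rho> v) b c \<and> (\<forall>p\<in>Lambda_hat T. norm (b p) \<le> B / \<rho> ^ 4 \<and> norm (c p) \<le> B / \<rho> ^ 4)"
    if h: "0 < h" and \<rho>: "0 < \<rho>" "\<rho> \<le> 1" for h \<rho> and v :: "real ^ 'n"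
  proof -
    let ?s = "\<lambda>p. \<Sum>i<wnum h. wcut h \<rho> v i p" and ?b = "\<lambda>p. \<Sum>i<wnum h. wcut_b h \<rho> v i p"
      and ?c = "\<lambda>p. \<Sum>i<wnum h. wcut_c h \<rho> v i p"
    have S: "flat_C2 ?s ?b ?c" by (rule flat_C2_sum) (auto intro: flat_C2_wcut)
    have 1: "((\<lambda>s. 1 - exp (- s)) has_real_derivative exp (- s)) (at s)"
      and 2: "((\<lambda>s. exp (- s)) has_real_derivative - exp (- s)) (at s)" for s :: real
      by (auto intro!: derivative_eq_intros)
    have 3: "continuous_on UNIV (\<lambda>s::real. - exp (- s))" by (intro continuous_intros)
    note F = flat_C2_compose[OF S 1 2 3]
    have \<rho>24: "\<rho> ^ 4 \<le> \<rho>\<^sup>2" using \<rho> by (intro power_decreasing) auto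
    have "norm (exp (- ?s p) *\<^sub>R ?b p) \<le> B / \<rho> ^ 4 \<and>
      norm (\<chi> i j. - exp (- ?s p) * ?b p $ i * ?b p $ j + exp (- ?s p) * ?c p $ i $ j) \<le> B / \<rho> ^ 4"
      if p: "p \<in> Lambda_hat T" for p :: "real \<times> 'n path"
    proof -
      have tp: "fst p \<in> {0..T}" using p by (auto simp: Lambda_hat_def)
      have e: "0 \<le> exp (- ?s p)" "exp (- ?s p) \<le> 1" using wcut_sum_nonneg[of h \<rho> v p] by auto
      have W: "(\<Sum>i<wnum h. K / \<rho>\<^sup>2 * wphi h i (fst p)) = K / \<rho>\<^sup>2"
        unfolding sum_distrib_left[symmetric] using wphi_sum[OF h tp] by simp
      have "norm (?b p) \<le> (\<Sum>i<wnum h. norm (wcut_b h \<rho> v i p))" by (rule norm_sum)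
      also have "\<dots> \<le> (\<Sum>i<wnum h. K / \<rho>\<^sup>2 * wphi h i (fst p))"
        unfolding K_def by (intro sum_mono wcut_estimates(1) h \<rho> p)
      finally have b: "norm (?b p) \<le> K / \<rho>\<^sup>2" unfolding W .
      have c: "\<bar>?c p $ i $ j\<bar> \<le> K / \<rho>\<^sup>2" for i j
      proof -
        have "\<bar>?c p $ i $ j\<bar> \<le> (\<Sum>k<wnum h. \<bar>wcut_c h \<rho> v k p $ i $ j\<bar>)" by (simp add: sum_abs)
        also have "\<dots> \<le> (\<Sum>i<wnum h. K / \<rho>\<^sup>2 * wphi h i (fst p))"
          unfolding K_def by (intro sum_mono wcut_estimates(2) h \<rho> p)
        finally show ?thesis unfolding W .
      qed
      have K4: "K / \<rho>\<^sup>2 \<le> K / \<rho> ^ 4" using \<rho> \<rho>24 by (intro divide_left_mono) (auto simp: K_def)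
      have "norm (exp (- ?s p) *\<^sub>R ?b p) \<le> 1 * (K / \<rho>\<^sup>2)"
        unfolding norm_scaleR using e b by (intro mult_mono) auto
      also have "\<dots> \<le> B / \<rho> ^ 4" using K4 B(2) \<rho> divide_right_mono[of K B "\<rho> ^ 4"] by simp
      finally have A: "norm (exp (- ?s p) *\<^sub>R ?b p) \<le> B / \<rho> ^ 4" .
      have bi: "\<bar>?b p $ i\<bar> \<le> K / \<rho>\<^sup>2" for i using component_le_norm_cart[of "?b p" i] b by linarith
      have "\<bar>- exp (- ?s p) * ?b p $ i * ?b p $ j + exp (- ?s p) * ?c p $ i $ j\<bar> \<le> (K\<^sup>2 + K) / \<rho> ^ 4" for i j
      proof -
        have "\<bar>- exp (- ?s p) * ?b p $ i * ?b p $ j + exp (- ?s p) * ?c p $ i $ j\<bar> \<le>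
          \<bar>- exp (- ?s p) * ?b p $ i * ?b p $ j\<bar> + \<bar>exp (- ?s p) * ?c p $ i $ j\<bar>" by (rule abs_triangle_ineq)
        also have "\<dots> = exp (- ?s p) * (\<bar>?b p $ i\<bar> * \<bar>?b p $ j\<bar>) + exp (- ?s p) * \<bar>?c p $ i $ j\<bar>"
          by (simp add: abs_mult mult.assoc)
        also have "\<dots> \<le> 1 * ((K / \<rho>\<^sup>2) * (K / \<rho>\<^sup>2)) + 1 * (K / \<rho>\<^sup>2)"
          using e c bi by (intro add_mono mult_mono) (auto simp: K_def)
        also have "\<dots> \<le> K\<^sup>2 / \<rho> ^ 4 + K / \<rho> ^ 4" using K4 by (simp add: power2_eq_square eval_nat_numeral)
        finally show ?thesis by (simp add: add_divide_distrib)
      qed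
      then have "\<bar>(\<chi> i j. - exp (- ?s p) * ?b p $ i * ?b p $ j + exp (- ?s p) * ?c p $ i $ j) $ i $ j\<bar> \<le> (K\<^sup>2 + K) / \<rho> ^ 4" for i j
        by simp
      from norm_matrix_le[OF this]
      have "norm (\<chi> i j. - exp (- ?s p) * ?b p $ i * ?b p $ j + exp (- ?s p) * ?c p $ i $ j) \<le> B / \<rho> ^ 4"
        unfolding B_def d_def by simp
      with A show ?thesis by blast
    qed
    then show ?thesis unfolding pen_def[abs_def]
      by (intro exI[of _ "\<lambda>p. exp (- ?s p) *\<^sub>R ?b p"]
          exI[of _ "\<lambda>p. \<chi> i j. - exp (- ?s p) * ?b p $ i * ?b p $ j + exp (- ?s p) * ?c p $ i $ j"] conjI F) auto
  qed
  then show ?thesis by (intro exI[of _ B] conjI B(1) allI impI)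
qed

lemma pen_zero:
  assumes p: "p \<in> Lambda_hat T" and \<rho>: "0 < \<rho>" and i: "\<And>i. i < wnum h \<Longrightarrow> 4 * (wmax h v i p) ^ 4 \<le> \<rho>"
  shows "pen h \<rho> v p = 0"
proof -
  have "wcut h \<rho> v i p = 0" if "i < wnum h" for i
    unfolding wcut_def using gauge_estimates(2)[OF primitive_window p, of h i "woff v i"] i[OF that] \<rho>
    by (intro cut_low) simp
  then show ?thesis by (simp add: pen_def)
qed

lemma cut_less_1: assumes "cut (g / \<rho>) < 1" "0 < \<rho>" shows "g < 2 * \<rho>"
  using assms cut_high(1)[of "g / \<rho>"] by (force simp: field_simps)

lemma wgauge_less:
  assumes p: "p \<in> Lambda_hat T" and r: "0 < r" and g: "wgauge h v i p < r ^ 4 / 2"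
  shows "wmax h v i p \<le> r"
proof -
  have "(wmax h v i p) ^ 4 < r ^ 4"
    using gauge_estimates(1)[OF primitive_window p, of h i "woff v i"] g by linarith
  then show ?thesis using power_less_imp_less_base[of "wmax h v i p" 4 r] r by simp
qed

text \<open>
  The level \<open>r\<^sup>4 / 4\<close> is chosen so that an unsaturated cut-off means that the gauge is below
  \<open>r\<^sup>4 / 2\<close>, hence that the running maximum is at most \<open>r\<close>. If the penalty is at most \<open>1 / 4\<close>, no
  cut-off is saturated, because \<open>1 - exp (- 1) > 1 / 4\<close>.
\<close>

lemma pen_small:
  assumes p: "p \<in> Lambda_hat T" and r: "0 < r" and small: "pen h (r ^ 4 / 4) v p \<le> 1 / 4" and i: "i < wnum h"
  shows "wmax h v i p \<le> r"
proof -
  let ?s = "\<Sum>i<wnum h. wcut h (r ^ 4 / 4) v i p"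
  have "?s < 1"
  proof (rule ccontr)
    assume "\<not> ?s < 1"
    then have "exp (- ?s) \<le> exp (- 1)" by simp
    moreover have "exp (- 1 :: real) \<le> 1 / 2"
      using exp_ge_add_one_self[of "1::real"] by (simp add: exp_minus field_simps)
    moreover have "3 / 4 \<le> exp (- ?s)" using small by (simp add: pen_def)
    ultimately show False by linarith
  qed
  moreover have "wcut h (r ^ 4 / 4) v i p \<le> ?s"
    using i by (intro member_le_sum) (auto simp: wcut_def cut_range)
  ultimately have "wgauge h v i p < 2 * (r ^ 4 / 4)"
    unfolding wcut_def by (intro cut_less_1) (use r in auto)
  then show ?thesis by (intro wgauge_less[OF p r]) simp
qed

lemma window_small_cont:
  fixes x :: "('n::finite) path"
  assumes x: "x \<in> cont_paths T" and r: "0 < r"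
  shows "\<exists>h0>0. \<forall>h. 0 < h \<and> h \<le> h0 \<longrightarrow> (\<forall>t\<in>{0..T}. \<forall>i. wmax h (x 0) i (t, x) \<le> r)"
proof -
  have xc: "x \<in> cadlag_paths T" using x cont_cadlag by auto
  have "uniformly_continuous_on {0..T} x"
    using x by (intro compact_uniformly_continuous) (auto simp: cont_paths_def)
  then obtain d where d: "d > 0" "\<And>s s'. s \<in> {0..T} \<Longrightarrow> s' \<in> {0..T} \<Longrightarrow> dist s' s < d \<Longrightarrow> dist (x s') (x s) < r / 3"
    using r by (elim uniformly_continuous_onE[of _ _ "r / 3"]) auto
  show ?thesis
  proof (intro exI[of _ "d / 2"] conjI allI impI ballI)
    show "d / 2 > 0" using d by simp
    fix h t i assume h: "0 < h \<and> h \<le> d / 2" and t: "t \<in> {0..T}"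
    have osc: "norm (x a - x b) \<le> r / 3" if "a \<in> {0..T}" "b \<in> {0..T}" "\<bar>a - b\<bar> \<le> h" for a b
      using d(2)[OF that(2,1)] that h d(1) by (simp add: dist_norm less_imp_le)
    show "wmax h (x 0) i (t, x) \<le> r"
    proof (rule rmax_least[OF primitive_window t])
      fix s assume "s \<in> {0..t}"
      then show "norm (wpos h (x 0) i (s, x)) \<le> r"
        using window_small[OF conjunct1[OF h] xc osc, of s i] t by simp
    qed
  qed
qed

section \<open>Compactness from small windows\<close>

text \<open>
  Constraint \<open>k\<close> bounds the oscillation at scale \<open>h k\<close> of all paths from the index \<open>k + 1\<close> on,
  frozen at their times; the finitely many others are uniformly continuous by themselves. So the
  frozen paths are equicontinuous and bounded, and Arzela-Ascoli applies.
\<close>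

lemma windows_compact:
  fixes x :: "nat \<Rightarrow> ('n::finite) path"
  assumes p: "\<And>j. (t j, x j) \<in> Lambda T" and h: "\<And>k. 0 < h k"
    and small: "\<And>k j i. k < j \<Longrightarrow> i < wnum (h k) \<Longrightarrow> wmax (h k) (v k) i (t j, x j) \<le> (1 / 2) ^ k"
  obtains q and s :: "nat \<Rightarrow> nat" where "q \<in> Lambda T" "strict_mono s"
    "\<And>e. e > 0 \<Longrightarrow> \<exists>N. \<forall>j\<ge>N. d_inf T q (t (s j), x (s j)) < e"
proof -
  have tj: "t j \<in> {0..T}" and xj: "x j \<in> cont_paths T" and xc: "x j \<in> cadlag_paths T" for j
    using p[of j] cont_cadlag by (auto simp: Lambda_def)
  (* The shift by one makes constraint k hold for all n with k at most n, and constraint 0 for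
     all n. *)
  define F where "F n r = x (Suc n) (min r (t (Suc n)))" for n r
  have M: "norm (F n r) \<le> real (wnum (h 0)) * 1 + norm (v 0)" if "r \<in> {0..T}" for n r
    unfolding F_def
    by (rule window_bound[where h = "h 0" and v = "v 0" and t = "t (Suc n)" and x = "x (Suc n)", OF h xc tj]) (use small[of 0 "Suc n"] that tj[of "Suc n"] in auto)
  have mod: "norm (F n r - F n r') \<le> 6 * (1 / 2) ^ k"
    if "r \<in> {0..T}" "r' \<in> {0..T}" "\<bar>r - r'\<bar> \<le> h k" "k \<le> n" for n r r' k
  proof -
    have A: "norm (F n r - F n r') \<le> 6 * (1 / 2) ^ k" if "r \<in> {0..T}" "r' \<in> {0..T}" "\<bar>r - r'\<bar> \<le> h k" "r' \<le> r" for r r'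
      unfolding F_def
      by (rule window_modulus[where h = "h k" and v = "v k" and t = "t (Suc n)" and x = "x (Suc n)", OF h xc tj])
         (use small[of k "Suc n"] that tj[of "Suc n"] \<open>k \<le> n\<close> in \<open>auto simp: min_def\<close>)
    show ?thesis using A[of r r'] A[of r' r] that by (cases "r' \<le> r") (auto simp: norm_minus_commute)
  qed
  have Fc: "continuous_on {0..T} (F n)" for n
    unfolding F_def
    by (rule continuous_on_compose2[of "{0..T}" "x (Suc n)"])
       (use xj[of "Suc n"] tj[of "Suc n"] in \<open>auto simp: cont_paths_def intro!: continuous_intros continuous_on_min\<close>)
  have "\<exists>d>0. \<forall>n y. y \<in> {0..T} \<and> norm (r - y) < d \<longrightarrow> norm (F n r - F n y) < e"
    if r: "r \<in> {0..T}" and e: "e > 0" for r e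
  proof -
    obtain k where k: "6 * (1 / 2 :: real) ^ k < e"
      using real_arch_pow_inv[of "e / 6" "1 / 2"] e by (auto simp: field_simps)
    have "\<forall>n. \<exists>d>0. \<forall>y\<in>{0..T}. dist y r < d \<longrightarrow> dist (F n y) (F n r) < e"
      using Fc r e unfolding continuous_on_iff by blast
    then obtain d where d: "\<And>n. d n > 0" "\<And>n y. y \<in> {0..T} \<Longrightarrow> dist y r < d n \<Longrightarrow> dist (F n y) (F n r) < e" by metis
    define D where "D = Min (insert (h k) (d ` {..<k}))"
    have D: "D > 0" "D \<le> h k" "\<And>n. n < k \<Longrightarrow> D \<le> d n" using h d(1) by (auto simp: D_def)
    show ?thesis
    proof (intro exI[of _ D] conjI allI impI D(1))
      fix n y assume y: "y \<in> {0..T} \<and> norm (r - y) < D"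
      show "norm (F n r - F n y) < e"
      proof (cases "n < k")
        case True
        have "dist y r = norm (r - y)" by (simp add: dist_real_def abs_minus_commute)
        then have "dist y r < d n" using D(3)[OF True] y by linarith
        then show ?thesis using d(2)[of y n] y by (simp add: dist_norm norm_minus_commute)
      next
        case False
        then show ?thesis using mod[of r y k n] r y D(2) k by auto
      qed
    qed
  qed
  from Arzela_Ascoli[OF compact_Icc M this]
  obtain g and s1 :: "nat \<Rightarrow> nat" where g: "continuous_on {0..T} g" and s1: "strict_mono s1"
    and lim: "\<And>e. 0 < e \<Longrightarrow> \<exists>N. \<forall>n y. N \<le> n \<and> y \<in> {0..T} \<longrightarrow> norm (F (s1 n) y - g y) < e"
    by blast
  have "seq_compact {0..T}" by (simp add: compact_imp_seq_compact)
  then obtain T0 s2 where T0: "T0 \<in> {0..T}" and s2: "strict_mono (s2 :: nat \<Rightarrow> nat)"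
    and tl: "(\<lambda>n. t (Suc (s1 (s2 n)))) \<longlonglongrightarrow> T0"
    using seq_compactE[of "{0..T}" "\<lambda>n. t (Suc (s1 n))"] tj by (auto simp: o_def)
  define q where "q = (T0, restrict g {0..T})"
  have "continuous_on {0..T} (restrict g {0..T})" by (rule continuous_on_eq[OF g]) simp
  then have q: "q \<in> Lambda T" using T0 by (auto simp: q_def Lambda_def cont_paths_def)
  define s where "s n = Suc (s1 (s2 n))" for n
  have s: "strict_mono s" using s1 s2 by (simp add: s_def strict_mono_def)
  have "\<exists>N. \<forall>j\<ge>N. d_inf T q (t (s j), x (s j)) < e" if e: "e > 0" for e
  proof -
    obtain N1 where N1: "\<And>n y. N1 \<le> n \<Longrightarrow> y \<in> {0..T} \<Longrightarrow> norm (F (s1 n) y - g y) < e / 4"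
      using lim[of "e / 4"] e by auto
    have "uniformly_continuous_on {0..T} g" using g by (intro compact_uniformly_continuous) auto
    then obtain d where d: "d > 0" "\<And>a b. a \<in> {0..T} \<Longrightarrow> b \<in> {0..T} \<Longrightarrow> dist b a < d \<Longrightarrow> dist (g b) (g a) < e / 4"
      using e by (elim uniformly_continuous_onE[of _ _ "e / 4"]) auto
    have "eventually (\<lambda>n. dist (t (s n)) T0 < min d (e / 4)) sequentially"
      using tl d e unfolding s_def by (intro tendstoD) auto
    then obtain N2 where N2: "\<And>n. N2 \<le> n \<Longrightarrow> dist (t (s n)) T0 < min d (e / 4)"
      by (auto simp: eventually_sequentially)
    show ?thesis
    proof (intro exI[of _ "max N1 N2"] allI impI)
      fix j assume j: "max N1 N2 \<le> j"
      have "N1 \<le> s2 j" using j seq_suble[OF s2, of j] by simp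
      note n1 = N1[OF this]
      have tt: "\<bar>T0 - t (s j)\<bar> \<le> e / 4" "dist (t (s j)) T0 < d" using N2[of j] j abs_minus_commute[of T0 "t (s j)"] by (simp_all add: dist_real_def)
      have "norm (restrict g {0..T} (min r T0) - x (s j) (min r (t (s j)))) \<le> e / 2" if r: "r \<in> {0..T}" for r
      proof -
        define a where "a = min r (t (s j))"
        have a: "a \<in> {0..T}" "min r T0 \<in> {0..T}" using r T0 tj[of "s j"] by (auto simp: a_def)
        have "dist a (min r T0) \<le> dist (t (s j)) T0" by (auto simp: a_def dist_real_def min_def)
        then have "dist (g a) (g (min r T0)) < e / 4" using d(2)[OF a(2,1)] tt by linarith
        moreover have "x (s j) a = F (s1 (s2 j)) a" by (simp add: F_def a_def s_def)
        then have "norm (x (s j) a - g a) < e / 4" using n1[OF a(1)] by simp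
        ultimately have "dist (x (s j) a) (g (min r T0)) < e / 4 + e / 4"
          using dist_triangle[of "x (s j) a" "g (min r T0)" "g a"] by (simp add: dist_norm)
        then show ?thesis using a by (simp add: a_def dist_norm norm_minus_commute)
      qed
      then have "d_inf T q (t (s j), x (s j)) \<le> e / 4 + e / 2"
        unfolding q_def by (intro d_inf_least tt(1))
      then show "d_inf T q (t (s j), x (s j)) < e" using e by simp
    qed
  qed
  with q s show ?thesis by (rule that)
qed

section \<open>A smooth variational principle\<close>

lemma usc_diff_cont:
  assumes f: "usc_wrt (d_inf T) (Lambda T) f" and g: "cont_wrt (d_inf T) (Lambda_hat T) g"
  shows "usc_wrt (d_inf T) (Lambda T) (\<lambda>p. f p - g p)"
  unfolding usc_wrt_def
proof (intro ballI allI impI)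
  fix p :: "real \<times> 'a path" and e :: real assume p: "p \<in> Lambda T" and e: "e > 0"
  have ph: "p \<in> Lambda_hat T" using p Lambda_subset by auto
  have e2: "e / 2 > 0" using e by simp
  obtain d1 where d1: "d1 > 0" "\<And>q. q \<in> Lambda T \<Longrightarrow> d_inf T p q < d1 \<Longrightarrow> f q < f p + e / 2"
    using f p e2 unfolding usc_wrt_def by meson
  obtain d2 where d2: "d2 > 0" "\<And>q. q \<in> Lambda_hat T \<Longrightarrow> d_inf T p q < d2 \<Longrightarrow> dist (g q) (g p) < e / 2"
    using g ph e2 unfolding cont_wrt_def by meson
  show "\<exists>\<delta>>0. \<forall>q\<in>Lambda T. d_inf T p q < \<delta> \<longrightarrow> f q - g q < f p - g p + e"
  proof (intro exI[of _ "min d1 d2"] conjI ballI impI)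
    show "min d1 d2 > 0" using d1 d2 by simp
    fix q assume q: "q \<in> Lambda T" "d_inf T p q < min d1 d2"
    have "q \<in> Lambda_hat T" using q Lambda_subset by auto
    then have "\<bar>g q - g p\<bar> < e / 2" using d2(2)[of q] q by (simp add: dist_real_def)
    moreover have "f q < f p + e / 2" using d1(2)[of q] q by simp
    ultimately show "f q - g q < f p - g p + e" by linarith
  qed
qed

lemma Lambda_nonempty: "(0, \<lambda>s\<in>{0..T}. 0) \<in> (Lambda T :: (real \<times> ('n::finite) path) set)"
proof -
  have "continuous_on {0..T} (\<lambda>s\<in>{0..T}. 0 :: real ^ 'n)"
    by (rule continuous_on_eq[of _ "\<lambda>_. 0"]) auto
  then show ?thesis using T_pos by (simp add: Lambda_def cont_paths_def)
qed

lemma near_maximizer: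
  fixes g :: "real \<times> ('n::finite) path \<Rightarrow> real"
  assumes "\<And>q. q \<in> Lambda T \<Longrightarrow> g q \<le> M" "0 < e"
  shows "\<exists>p\<in>Lambda T. \<forall>q\<in>Lambda T. g q \<le> g p + e"
proof -
  let ?S = "g ` Lambda T"
  have bdd: "bdd_above ?S" by (rule bdd_aboveI2[OF assms(1)])
  have ne: "?S \<noteq> {}" using Lambda_nonempty by blast
  have "Sup ?S - e < Sup ?S" using assms(2) by simp
  then obtain p where p: "p \<in> Lambda T" "Sup ?S - e < g p" using less_cSup_iff[OF ne bdd] by auto
  show ?thesis
  proof (intro bexI[OF _ p(1)] ballI)
    fix q :: "real \<times> 'n path" assume "q \<in> Lambda T"
    then have "g q \<le> Sup ?S" using bdd by (intro cSup_upper) auto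
    then show "g q \<le> g p + e" using p(2) by linarith
  qed
qed

text \<open>
  A continuous path oscillates little at small scales, so a fine enough penalty centred at it
  ignores it.
\<close>

lemma window_scale:
  fixes x :: "('n::finite) path"
  assumes p: "(t, x) \<in> Lambda T" and r: "0 < r"
  shows "\<exists>h>0. pen h (r ^ 4 / 4) (x 0) (t, x) = 0"
proof -
  have xt: "x \<in> cont_paths T" "t \<in> {0..T}" using p by (auto simp: Lambda_def)
  obtain h0 where h0: "h0 > 0" "\<And>h t i. 0 < h \<Longrightarrow> h \<le> h0 \<Longrightarrow> t \<in> {0..T} \<Longrightarrow> wmax h (x 0) i (t, x) \<le> r / 2"
    using window_small_cont[OF xt(1), of "r / 2"] r by auto
  have ph: "(t, x) \<in> Lambda_hat T" using p Lambda_subset by auto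
  have "pen h0 (r ^ 4 / 4) (x 0) (t, x) = 0"
  proof (rule pen_zero[OF ph])
    fix i
    have "0 \<le> wmax h0 (x 0) i (t, x)" by (rule rmax_nonneg[OF primitive_window ph])
    then have "(wmax h0 (x 0) i (t, x)) ^ 4 \<le> (r / 2) ^ 4"
      using h0 xt by (intro power_mono) auto
    also have "\<dots> = r ^ 4 / 16" by (simp add: power_divide)
    finally show "4 * (wmax h0 (x 0) i (t, x)) ^ 4 \<le> r ^ 4 / 4" by simp
  qed (use r in simp)
  then show ?thesis using h0(1) by blast
qed

text \<open>
  Let \<open>p k\<close> maximize the current function \<open>F k\<close> up to \<open>\<epsilon> k\<close>, and subtract from \<open>F k\<close> a penalty
  \<open>\<nu> k\<close> times \<open>\<psi> k\<close> that vanishes at \<open>p k\<close>. Later near-maximizers \<open>p j\<close> do not fall below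
  \<open>F k (p k) - \<epsilon> k\<close>, so that \<open>\<nu> k * \<psi> k (p j) \<le> 2 * \<epsilon> k\<close>. With \<open>\<epsilon> k = \<nu> k / 8\<close> this gives
  \<open>\<psi> k (p j) \<le> 1 / 4\<close>, which by \<open>pen_small\<close> limits the oscillation of \<open>p j\<close> at scale \<open>h k\<close>. A
  limit point of the sequence, which exists by \<open>windows_compact\<close>, is a maximum point of \<open>f\<close>
  minus the sum of all penalties, by upper semicontinuity.
\<close>

lemma perturbed_maximum:
  fixes f :: "real \<times> ('n::finite) path \<Rightarrow> real"
  assumes usc: "usc_wrt (d_inf T) (Lambda T) f" and bdd: "\<And>q. q \<in> Lambda T \<Longrightarrow> f q \<le> M" and lam: "0 < lam"
  obtains \<psi> b c p where "smooth \<psi> (\<lambda>_. 0) b c" "p \<in> Lambda T"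
    "\<And>q. q \<in> Lambda T \<Longrightarrow> f q - \<psi> q \<le> f p - \<psi> p"
    "\<And>q. q \<in> Lambda T \<Longrightarrow> 0 \<le> \<psi> q \<and> \<psi> q \<le> lam \<and> 1 / 2 * trace (c q) \<le> lam"
proof -
  obtain B where B: "B > 0" and P: "\<And>h \<rho> (v :: real ^ 'n). 0 < h \<Longrightarrow> 0 < \<rho> \<Longrightarrow> \<rho> \<le> 1 \<Longrightarrow>
    (\<exists>b c. flat_C2 (pen h \<rho> v) b c \<and> (\<forall>p\<in>Lambda_hat T. norm (b p) \<le> B / \<rho> ^ 4 \<and> norm (c p) \<le> B / \<rho> ^ 4))"
    using flat_C2_pen[where ?'n = 'n] by meson
  define d where "d = real CARD('n)"
  have d: "d \<ge> 1" using zero_less_card_finite[where 'a = 'n] by (simp add: d_def Suc_leI)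
  define r :: "nat \<Rightarrow> real" where "r k = (1 / 2) ^ k" for k
  define \<rho> where "\<rho> k = r k ^ 4 / 4" for k
  (* The derivatives of penalty k are of size rho^(-4), that is 256 * 2^(16 k). The power 17 k
     absorbs this and leaves the summable factor 2^(-k). *)
  define \<nu> where "\<nu> k = lam / (512 * (1 + B) * d) * (1 / 2) ^ (17 * k)" for k
  define \<epsilon> where "\<epsilon> k = \<nu> k / 8" for k
  have r: "0 < r k" "r k \<le> 1" for k by (auto simp: r_def power_le_one)
  have \<rho>: "0 < \<rho> k" "\<rho> k \<le> 1" for k
    using r[of k] power_le_one[of "r k" 4] by (auto simp: \<rho>_def)
  have \<nu>: "0 < \<nu> k" for k using lam B d by (simp add: \<nu>_def)
  have \<epsilon>: "0 < \<epsilon> k" for k using \<nu> by (simp add: \<epsilon>_def)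
  have \<epsilon>S: "2 * \<epsilon> (Suc k) \<le> \<epsilon> k" for k
  proof -
    have "(1 / 2 :: real) ^ (17 * Suc k) = (1 / 2) ^ 17 * (1 / 2) ^ (17 * k)" by (simp add: power_add)
    then have "\<epsilon> (Suc k) = (1 / 2) ^ 17 * \<epsilon> k" by (simp add: \<epsilon>_def \<nu>_def)
    moreover have "(1 / 2 :: real) ^ 17 * \<epsilon> k \<le> 1 / 2 * \<epsilon> k"
      using \<epsilon>[of k] power_decreasing[of 1 17 "1 / 2 :: real"] by (intro mult_right_mono) auto
    ultimately show ?thesis by linarith
  qed
  define W where "W = lam / (2 * d)"
  have W: "0 < W" using lam d by (simp add: W_def)
  have \<nu>B: "\<nu> k * (B / \<rho> k ^ 4) \<le> W * (1 / 2) ^ k" for k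
  proof -
    define X :: real where "X = (1 / 2) ^ (16 * k)"
    define A where "A = lam / (512 * (1 + B) * d)"
    have X: "X \<noteq> 0" by (simp add: X_def)
    have r4: "\<rho> k ^ 4 = X / 256"
      by (simp add: \<rho>_def r_def X_def power_divide flip: power_mult)
    have "(1 / 2 :: real) ^ (17 * k) = X * (1 / 2) ^ k" by (simp add: X_def flip: power_add)
    then have nk: "\<nu> k = A * (X * (1 / 2) ^ k)" by (simp add: \<nu>_def A_def)
    have "\<nu> k * (B / \<rho> k ^ 4) = A * 256 * B * (1 / 2) ^ k" unfolding r4 nk using X by simp
    also have "\<dots> = W * (1 / 2) ^ k * (B / (1 + B))"
    proof -
      define C where "C = 1 + B"
      have "C \<noteq> 0" "d \<noteq> 0" using B d by (auto simp: C_def)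
      then have "A * 256 * B = W * (B / C)" unfolding A_def W_def C_def[symmetric] by (simp add: field_simps)
      then have "A * 256 * B = W * (B / (1 + B))" by (simp add: C_def)
      then show ?thesis by simp
    qed
    also have "\<dots> \<le> W * (1 / 2) ^ k * 1" using B W by (intro mult_left_mono) (auto simp: field_simps)
    finally show ?thesis by simp
  qed
  have \<nu>l: "\<nu> k \<le> lam / 2 * (1 / 2) ^ k" for k
  proof -
    have "1 * 1 \<le> (1 + B) * d" using B d by (intro mult_mono) auto
    then have "2 \<le> 512 * ((1 + B) * d)" by linarith
    then have "lam / (512 * ((1 + B) * d)) \<le> lam / 2" using lam B d by (intro divide_left_mono mult_pos_pos) auto
    then have "lam / (512 * (1 + B) * d) \<le> lam / 2" by (simp only: mult.assoc)
    moreover have "(1 / 2 :: real) ^ (17 * k) \<le> (1 / 2) ^ k" by (intro power_decreasing) auto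
    ultimately show ?thesis unfolding \<nu>_def using lam by (intro mult_mono) auto
  qed
  define pick where "pick k g = (SOME p. p \<in> Lambda T \<and> (\<forall>q\<in>Lambda T. g q \<le> g p + \<epsilon> k))"
    for k and g :: "real \<times> 'n path \<Rightarrow> real"
  define scale where "scale k p = (SOME h. 0 < h \<and> pen h (\<rho> k) (snd p 0) p = 0)" for k and p :: "real \<times> 'n path"
  define upd where "upd k g = (\<lambda>q. g q - \<nu> k * pen (scale k (pick k g)) (\<rho> k) (snd (pick k g) 0) q)" for k g
  define F where "F = rec_nat f upd"
  have F0: "F 0 = f" and FS: "F (Suc k) = upd k (F k)" for k by (simp_all add: F_def)
  define p where "p k = pick k (F k)" for k
  define h where "h k = scale k (p k)" for k
  define v where "v k = snd (p k) 0" for k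
  define \<psi> where "\<psi> k = pen (h k) (\<rho> k) (v k)" for k
  have FS': "F (Suc k) q = F k q - \<nu> k * \<psi> k q" for k q
    by (simp add: FS upd_def \<psi>_def h_def v_def p_def)
  have \<psi>01: "0 \<le> \<psi> k q" "\<psi> k q \<le> 1" for k q by (simp_all add: \<psi>_def pen_range)
  have FM: "F k q \<le> M" if "q \<in> Lambda T" for k and q :: "real \<times> 'n path"
  proof (induction k)
    case (Suc k)
    have "0 \<le> \<nu> k * \<psi> k q" using \<nu>[of k] \<psi>01 by simp
    then show ?case using Suc by (simp add: FS')
  qed (simp add: F0 bdd that)
  have "p k \<in> Lambda T \<and> (\<forall>q\<in>Lambda T. F k q \<le> F k (p k) + \<epsilon> k)" for k
    unfolding p_def pick_def by (rule someI_ex) (use near_maximizer[where g = "F k" and e = "\<epsilon> k", OF FM \<epsilon>] in blast)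
  then have p: "p k \<in> Lambda T" and pmax: "q \<in> Lambda T \<Longrightarrow> F k q \<le> F k (p k) + \<epsilon> k" for k q by auto
  have "0 < h k \<and> pen (h k) (\<rho> k) (v k) (p k) = 0" for k
    unfolding h_def scale_def v_def
  proof (rule someI_ex)
    show "\<exists>h>0. pen h (\<rho> k) (snd (p k) 0) (p k) = 0"
      using window_scale[of "fst (p k)" "snd (p k)" "r k", OF _ r(1)] p[of k] by (simp add: \<rho>_def)
  qed
  then have h: "0 < h k" and \<psi>0: "\<psi> k (p k) = 0" for k by (auto simp: \<psi>_def)
  have Fdec: "F j q \<le> F k q" if "k \<le> j" for j k q
    using that
  proof (induction j rule: dec_induct)
    case (step j)
    have "0 \<le> \<nu> j * \<psi> j q" using \<nu>[of j] \<psi>01 by simp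
    then show ?case using step by (simp add: FS')
  qed simp
  have a: "F k (p k) - \<epsilon> k + \<epsilon> j \<le> F j (p j)" if "k \<le> j" for j k
    using that
  proof (induction j rule: dec_induct)
    case (step j)
    have "F j (p j) = F (Suc j) (p j)" by (simp add: FS' \<psi>0)
    also have "\<dots> \<le> F (Suc j) (p (Suc j)) + \<epsilon> (Suc j)" by (rule pmax[OF p])
    finally show ?case using step.IH \<epsilon>S[of j] by linarith
  qed simp
  have small: "\<psi> k (p j) \<le> 1 / 4" if kj: "k < j" for k j
  proof -
    have "F k (p j) \<le> F k (p k) + \<epsilon> k" by (rule pmax[OF p])
    moreover have "F k (p k) - \<epsilon> k + \<epsilon> j \<le> F j (p j)" using kj by (intro a) simp
    moreover have "F j (p j) \<le> F k (p j) - \<nu> k * \<psi> k (p j)" using Fdec[of "Suc k" j "p j"] kj by (simp add: FS')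
    ultimately have "\<nu> k * \<psi> k (p j) \<le> 2 * \<epsilon> k" using \<epsilon>[of j] by linarith
    then show ?thesis using \<nu>[of k] by (simp add: \<epsilon>_def)
  qed
  have pp: "(fst (p j), snd (p j)) \<in> Lambda T" for j using p by simp
  have wm: "wmax (h k) (v k) i (fst (p j), snd (p j)) \<le> (1 / 2) ^ k" if "k < j" "i < wnum (h k)" for k j i
    unfolding prod.collapse r_def[symmetric]
    by (rule pen_small[OF _ r(1) _ that(2)])
       (use p[of j] Lambda_subset small[OF that(1)] in \<open>auto simp: \<psi>_def \<rho>_def\<close>)
  obtain q and s :: "nat \<Rightarrow> nat" where q: "q \<in> Lambda T" and s: "strict_mono s"
    and conv: "\<And>e. e > 0 \<Longrightarrow> \<exists>N. \<forall>j\<ge>N. d_inf T q (fst (p (s j)), snd (p (s j))) < e"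
    by (rule windows_compact[where t = "\<lambda>j. fst (p j)" and x = "\<lambda>j. snd (p j)" and h = h and v = v,
          OF pp h wm]) blast+
  have "\<forall>k. \<exists>bc. flat_C2 (\<psi> k) (fst bc) (snd bc) \<and>
     (\<forall>p\<in>Lambda_hat T. norm (fst bc p) \<le> B / \<rho> k ^ 4 \<and> norm (snd bc p) \<le> B / \<rho> k ^ 4)"
  proof
    fix k
    obtain b c where "flat_C2 (\<psi> k) b c" "\<forall>p\<in>Lambda_hat T. norm (b p) \<le> B / \<rho> k ^ 4 \<and> norm (c p) \<le> B / \<rho> k ^ 4"
      using P[of "h k" "\<rho> k" "v k", OF h \<rho>] unfolding \<psi>_def by blast
    then show "\<exists>bc. flat_C2 (\<psi> k) (fst bc) (snd bc) \<and>
     (\<forall>p\<in>Lambda_hat T. norm (fst bc p) \<le> B / \<rho> k ^ 4 \<and> norm (snd bc p) \<le> B / \<rho> k ^ 4)"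
      by (intro exI[of _ "(b, c)"]) simp
  qed
  then obtain bc where bc: "\<forall>k. flat_C2 (\<psi> k) (fst (bc k)) (snd (bc k)) \<and>
     (\<forall>p\<in>Lambda_hat T. norm (fst (bc k) p) \<le> B / \<rho> k ^ 4 \<and> norm (snd (bc k) p) \<le> B / \<rho> k ^ 4)"
    by (rule choice[THEN exE])
  define b where "b k = fst (bc k)" for k
  define c where "c k = snd (bc k)" for k
  have fl: "flat_C2 (\<psi> k) (b k) (c k)" and bB: "p \<in> Lambda_hat T \<Longrightarrow> norm (b k p) \<le> B / \<rho> k ^ 4"
    and cB: "p \<in> Lambda_hat T \<Longrightarrow> norm (c k p) \<le> B / \<rho> k ^ 4" for k p
    using bc by (auto simp: b_def c_def)
  have fl': "flat_C2 (\<lambda>p. \<nu> k * \<psi> k p) (\<lambda>p. \<nu> k *\<^sub>R b k p) (\<lambda>p. \<nu> k *\<^sub>R c k p)" for k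
    by (rule flat_C2_scale[OF fl])
  have g2: "summable (\<lambda>k. (1 / 2 :: real) ^ k)" "(\<Sum>k. (1 / 2 :: real) ^ k) = 2"
    using summable_geometric[of "1 / 2 :: real"] suminf_geometric[of "1 / 2 :: real"] by auto
  have bb: "norm (\<nu> k *\<^sub>R b k p) \<le> W * (1 / 2) ^ k" "norm (\<nu> k *\<^sub>R c k p) \<le> W * (1 / 2) ^ k"
    if "p \<in> Lambda_hat T" for k and p :: "real \<times> 'n path"
  proof -
    have "norm (\<nu> k *\<^sub>R b k p) \<le> \<nu> k * (B / \<rho> k ^ 4)" "norm (\<nu> k *\<^sub>R c k p) \<le> \<nu> k * (B / \<rho> k ^ 4)"
      using mult_left_mono[OF bB[OF that]] mult_left_mono[OF cB[OF that]] \<nu>[of k] by (simp_all add: less_imp_le)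
    then show "norm (\<nu> k *\<^sub>R b k p) \<le> W * (1 / 2) ^ k" "norm (\<nu> k *\<^sub>R c k p) \<le> W * (1 / 2) ^ k"
      using \<nu>B[of k] by linarith+
  qed
  have ub: "\<bar>\<nu> k * \<psi> k p\<bar> \<le> lam / 2 * (1 / 2) ^ k" for k p
  proof -
    have "\<nu> k * \<psi> k p \<le> (lam / 2 * (1 / 2) ^ k) * 1" using \<nu>l[of k] \<psi>01 lam by (intro mult_mono) auto
    moreover have "0 \<le> \<nu> k * \<psi> k p" using \<nu>[of k] \<psi>01 by simp
    ultimately show ?thesis by simp
  qed
  define \<Psi> where "\<Psi> p = (\<Sum>k. \<nu> k * \<psi> k p)" for p
  define bb' where "bb' p = (\<Sum>k. \<nu> k *\<^sub>R b k p)" for p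
  define cc' where "cc' p = (\<Sum>k. \<nu> k *\<^sub>R c k p)" for p
  have sl: "summable (\<lambda>k. lam / 2 * (1 / 2) ^ k)" and sW: "summable (\<lambda>k. W * (1 / 2) ^ k)"
    by (intro summable_mult g2)+
  have flat: "flat_C2 \<Psi> bb' cc'"
    unfolding \<Psi>_def[abs_def] bb'_def[abs_def] cc'_def[abs_def]
  proof (rule flat_C2_suminf[OF fl', where M = "\<lambda>k. lam / 2 * (1 / 2) ^ k + W * (1 / 2) ^ k"])
    fix k and p :: "real \<times> 'n path" assume "p \<in> Lambda_hat T"
    have 0: "0 \<le> lam / 2 * (1 / 2) ^ k" "0 \<le> W * (1 / 2) ^ k" using lam W by auto
    show "\<bar>\<nu> k * \<psi> k p\<bar> \<le> lam / 2 * (1 / 2) ^ k + W * (1 / 2) ^ k" using ub[of k p] 0 by linarith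
    show "norm (\<nu> k *\<^sub>R b k p) \<le> lam / 2 * (1 / 2) ^ k + W * (1 / 2) ^ k"
      "norm (\<nu> k *\<^sub>R c k p) \<le> lam / 2 * (1 / 2) ^ k + W * (1 / 2) ^ k"
      using bb[OF \<open>p \<in> Lambda_hat T\<close>, of k] 0 by linarith+
  qed (rule summable_add[OF sl sW])
  have s\<psi>: "summable (\<lambda>k. \<nu> k * \<psi> k p)" for p
    by (rule summable_comparison_test'[OF sl, of 0]) (use ub in simp)
  have \<Psi>0: "0 \<le> \<Psi> p" for p
    unfolding \<Psi>_def using s\<psi> \<nu> \<psi>01 by (intro suminf_nonneg) (auto simp: less_imp_le)
  have \<Psi>lam: "\<Psi> p \<le> lam" for p
  proof -
    have "\<Psi> p \<le> (\<Sum>k. lam / 2 * (1 / 2) ^ k)"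
      unfolding \<Psi>_def by (intro suminf_le abs_le_D1[OF ub] s\<psi> sl)
    also have "\<dots> = lam" using suminf_mult[OF g2(1), of "lam / 2"] g2(2) by simp
    finally show ?thesis .
  qed
  have nW: "norm (\<Sum>k. w k) \<le> lam / d" if "\<And>k. norm (w k) \<le> W * (1 / 2) ^ k" for w :: "nat \<Rightarrow> 'z::banach"
  proof -
    have "norm (\<Sum>k. w k) \<le> (\<Sum>k. W * (1 / 2) ^ k)"
      by (rule norm_suminf_le[OF that sW])
    also have "\<dots> = lam / d" using suminf_mult[OF g2(1), of W] g2(2) by (simp add: W_def)
    finally show ?thesis .
  qed
  have bn: "norm (bb' p) \<le> lam / d" "norm (cc' p) \<le> lam / d" if "p \<in> Lambda_hat T" for p :: "real \<times> 'n path"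
    unfolding bb'_def cc'_def using bb[OF that] by (auto intro!: nW)
  have tr: "1 / 2 * trace (cc' p) \<le> lam" if "p \<in> Lambda_hat T" for p :: "real \<times> 'n path"
  proof -
    have "trace (cc' p) \<le> (\<Sum>i\<in>(UNIV :: 'n set). lam / d)"
      unfolding trace_def
    proof (rule sum_mono)
      fix i
      have "\<bar>cc' p $ i $ i\<bar> \<le> norm (cc' p)"
        using component_le_norm_cart[of "cc' p $ i" i] Finite_Cartesian_Product.norm_nth_le[of "cc' p" i] by linarith
      then show "cc' p $ i $ i \<le> lam / d" using bn(2)[OF that] by linarith
    qed
    also have "\<dots> = lam" using d by (simp add: d_def)
    finally show ?thesis using lam by linarith
  qed
  have sm: "smooth \<Psi> (\<lambda>_. 0) bb' cc'"
  proof (rule smooth_flat[OF flat])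
    show "quartic \<Psi>" by (rule quartic_bounded[of _ lam]) (use \<Psi>0 \<Psi>lam in simp)
    show "quartic bb'" "quartic cc'"
      using bn Lambda_subset by (auto intro!: quartic_bounded[of _ "lam / d"])
  qed
  have Fk: "F k q = f q - (\<Sum>j<k. \<nu> j * \<psi> j q)" for k q
    by (induction k) (simp_all add: F0 FS')
  have Fusc: "usc_wrt (d_inf T) (Lambda T) (F k)" for k
  proof -
    have "flat_C2 (\<lambda>q. \<Sum>j<k. \<nu> j * \<psi> j q) (\<lambda>q. \<Sum>j<k. \<nu> j *\<^sub>R b j q) (\<lambda>q. \<Sum>j<k. \<nu> j *\<^sub>R c j q)"
      by (rule flat_C2_sum[OF _ fl']) simp
    then have "cont_wrt (d_inf T) (Lambda_hat T) (\<lambda>q. \<Sum>j<k. \<nu> j * \<psi> j q)" by (simp add: flat_C2_def)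
    from usc_diff_cont[OF usc this] show ?thesis by (simp add: Fk[abs_def])
  qed
  have \<epsilon>lim: "\<epsilon> \<longlonglongrightarrow> 0"
  proof (rule Lim_null_comparison)
    show "\<forall>\<^sub>F k in sequentially. norm (\<epsilon> k) \<le> lam / 2 * (1 / 2) ^ k"
      using \<nu>l \<nu> by (intro always_eventually allI) (simp add: \<epsilon>_def, smt (verit))
    show "(\<lambda>k. lam / 2 * (1 / 2) ^ k) \<longlonglongrightarrow> 0" by (rule summable_LIMSEQ_zero[OF sl])
  qed
  (* F j lies above the final function, F j is nearly maximal at p j, and F k lies above F j; so
     upper semicontinuity of F k at the limit point q of the p j gives the claim. *)
  have main: "f z - \<Psi> z \<le> F k q" if z: "z \<in> Lambda T" for k and z :: "real \<times> 'n path"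
  proof (rule field_le_epsilon)
    fix e :: real assume e: "0 < e"
    then have e2: "e / 2 > 0" by simp
    obtain dl where dl: "dl > 0" "\<And>y. y \<in> Lambda T \<Longrightarrow> d_inf T q y < dl \<Longrightarrow> F k y < F k q + e / 2"
      using Fusc[of k] q e2 unfolding usc_wrt_def by meson
    obtain N where N: "\<And>j. j \<ge> N \<Longrightarrow> d_inf T q (fst (p (s j)), snd (p (s j))) < dl" using conv[OF dl(1)] by blast
    have "eventually (\<lambda>k. \<epsilon> k < e / 2) sequentially" using \<epsilon>lim e2 by (rule order_tendstoD(2))
    then obtain N' where N': "\<And>k. k \<ge> N' \<Longrightarrow> \<epsilon> k < e / 2" unfolding eventually_sequentially by blast
    define j where "j = s (max (max N N') k)"
    have j: "k \<le> j" "N' \<le> j" using seq_suble[OF s, of "max (max N N') k"] by (auto simp: j_def)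
    have "(\<Sum>i<j. \<nu> i * \<psi> i z) \<le> \<Psi> z"
      unfolding \<Psi>_def using \<nu> \<psi>01 by (intro sum_le_suminf s\<psi>) (auto simp: less_imp_le)
    then have "f z - \<Psi> z \<le> F j z" by (simp add: Fk)
    also have "\<dots> \<le> F j (p j) + \<epsilon> j" by (rule pmax[OF z])
    also have "\<dots> \<le> F k (p j) + \<epsilon> j" using Fdec[OF j(1)] by simp
    also have "F k (p j) < F k q + e / 2" using dl(2)[OF p] N[of "max (max N N') k"] by (simp add: j_def)
    finally show "f z - \<Psi> z \<le> F k q + e" using N'[OF j(2)] by linarith
  qed
  have lim: "(\<lambda>k. F k q) \<longlonglongrightarrow> f q - \<Psi> q"
    unfolding Fk \<Psi>_def by (intro tendsto_diff tendsto_const summable_LIMSEQ s\<psi>)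
  show ?thesis
  proof (rule that[OF sm q])
    fix z :: "real \<times> 'n path" assume z: "z \<in> Lambda T"
    show "f z - \<Psi> z \<le> f q - \<Psi> q"
      by (rule tendsto_lowerbound[OF lim]) (use main[OF z] in auto)
    show "0 \<le> \<Psi> z \<and> \<Psi> z \<le> lam \<and> 1 / 2 * trace (cc' z) \<le> lam"
      using \<Psi>0 \<Psi>lam tr[OF subsetD[OF Lambda_subset z]] by blast
  qed
qed

section \<open>Comparison with smooth supersolutions\<close>

text \<open>
  The term \<open>\<mu> (T - t)\<close> turns \<open>\<phi>\<close> into a strict supersolution, and the perturbation is so small,
  by the choice of \<open>lam\<close>, that strictness and the positivity of the maximum survive. The maximum
  point lies where \<open>\<phi> < u\<close>, so the supersolution inequality is demanded there only.
\<close>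

lemma comparison_smooth:
  fixes u :: "real \<times> ('n::finite) path \<Rightarrow> real"
  assumes sub: "viscosity_subsolution T \<xi> u" and uM: "\<And>p. p \<in> Lambda T \<Longrightarrow> u p \<le> M"
    and sm: "smooth \<phi> a b c" and low: "\<And>p. p \<in> Lambda T \<Longrightarrow> m \<le> \<phi> p"
    and terminal: "\<And>x. x \<in> cont_paths T \<Longrightarrow> \<xi> x \<le> \<phi> (T, x)"
    and super: "\<And>p. p \<in> Lambda T \<Longrightarrow> fst p < T \<Longrightarrow> \<phi> p < u p \<Longrightarrow> a p + 1 / 2 * trace (c p) \<le> 0"
    and p0: "p0 \<in> Lambda T"
  shows "u p0 \<le> \<phi> p0"
proof (rule ccontr)
  assume "\<not> u p0 \<le> \<phi> p0"
  then have gap: "0 < u p0 - \<phi> p0" by simp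
  define \<mu> where "\<mu> = (u p0 - \<phi> p0) / (2 * (T + 1))"
  have \<mu>: "0 < \<mu>" using gap T_pos by (simp add: \<mu>_def)
  have "\<mu> * (T - fst p0) < (u p0 - \<phi> p0) / 2"
  proof -
    have "\<mu> * (T - fst p0) < \<mu> * (T + 1)"
      using p0 \<mu> by (intro mult_strict_left_mono) (auto simp: Lambda_def)
    also have "\<dots> = (u p0 - \<phi> p0) / 2" using T_pos by (simp add: \<mu>_def field_simps)
    finally show ?thesis .
  qed
  then have f0: "(u p0 - \<phi> p0) / 2 < u p0 - (\<phi> p0 + \<mu> * (T - fst p0))"
    by (simp only: diff_add_eq_diff_diff_swap) argo
  define lam where "lam = min (\<mu> / 2) ((u p0 - \<phi> p0) / 4)"
  have lam: "0 < lam" using \<mu> gap by (simp add: lam_def)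
  have "smooth (\<lambda>p. \<mu> * (T - fst p)) (\<lambda>p. - \<mu>) (\<lambda>_. 0 :: real ^ 'n) (\<lambda>_. 0 :: real ^ 'n ^ 'n)"
    by (rule smooth_time[of "\<lambda>t. \<mu> * (T - t)" "\<lambda>_. - \<mu>"]) (auto intro!: derivative_eq_intros)
  note sm1 = smooth_add[OF sm this]
  have uusc: "usc_wrt (d_inf T) (Lambda T) u" using sub by (simp add: viscosity_subsolution_def)
  have "cont_wrt (d_inf T) (Lambda_hat T) (\<lambda>p. \<phi> p + \<mu> * (T - fst p))"
    using sm1 by (simp add: smooth_def C12_hat_def)
  note fusc = usc_diff_cont[OF uusc this]
  have fM: "u q - (\<phi> q + \<mu> * (T - fst q)) \<le> M - m" if "q \<in> Lambda T" for q :: "real \<times> 'n path"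
  proof -
    have "0 \<le> \<mu> * (T - fst q)" using \<mu> that by (auto simp: Lambda_def)
    then show ?thesis using uM[OF that] low[OF that] by linarith
  qed
  obtain \<psi> b' c' p where \<psi>: "smooth \<psi> (\<lambda>_. 0) b' c'" and p: "p \<in> Lambda T"
    and pmax: "\<And>q. q \<in> Lambda T \<Longrightarrow> u q - (\<phi> q + \<mu> * (T - fst q)) - \<psi> q \<le> u p - (\<phi> p + \<mu> * (T - fst p)) - \<psi> p"
    and \<psi>b: "\<And>q. q \<in> Lambda T \<Longrightarrow> 0 \<le> \<psi> q \<and> \<psi> q \<le> lam \<and> 1 / 2 * trace (c' q) \<le> lam"
    using perturbed_maximum[OF fusc fM lam] by metis
  have pos: "0 < u p - (\<phi> p + \<mu> * (T - fst p)) - \<psi> p"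
    using pmax[OF p0] f0 \<psi>b[OF p0] gap by (simp add: lam_def)
  have tp: "fst p \<le> T" "0 \<le> fst p" and xp: "snd p \<in> cont_paths T" using p by (auto simp: Lambda_def)
  have "0 \<le> \<mu> * (T - fst p)" using \<mu> tp by simp
  then have up: "\<phi> p < u p" using pos \<psi>b[OF p] by linarith
  have tT: "fst p < T"
  proof (rule ccontr)
    assume "\<not> fst p < T"
    then have pT: "p = (T, snd p)" using tp by (simp add: prod_eq_iff)
    have "u (T, snd p) \<le> \<xi> (snd p)" using sub xp by (simp add: viscosity_subsolution_def)
    then have "u p \<le> \<phi> p" using terminal[OF xp] pT by simp
    then show False using up by simp
  qed
  note sm2 = smooth_add[OF sm1 \<psi>]
  have "ereal (u (fst p, snd p) - (\<phi> (fst p, snd p) + \<mu> * (T - fst (fst p, snd p)) + \<psi> (fst p, snd p))) =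
     (SUP q\<in>Lambda T. ereal (u q - (\<phi> q + \<mu> * (T - fst q) + \<psi> q)))"
  proof (rule SUP_eqI[symmetric])
    fix q :: "real \<times> 'n path" assume "q \<in> Lambda T"
    then show "ereal (u q - (\<phi> q + \<mu> * (T - fst q) + \<psi> q)) \<le>
       ereal (u (fst p, snd p) - (\<phi> (fst p, snd p) + \<mu> * (T - fst (fst p, snd p)) + \<psi> (fst p, snd p)))"
      using pmax[of q] by simp
  next
    fix y assume "\<And>q :: real \<times> 'n path. q \<in> Lambda T \<Longrightarrow> ereal (u q - (\<phi> q + \<mu> * (T - fst q) + \<psi> q)) \<le> y"
    from this[OF p] show "ereal (u (fst p, snd p) - (\<phi> (fst p, snd p) + \<mu> * (T - fst (fst p, snd p)) + \<psi> (fst p, snd p))) \<le> y"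
      by simp
  qed
  with smooth_C12_pol[OF sm2] sub tT tp xp
  have "- (a (fst p, snd p) + - \<mu> + 0) - 1 / 2 * trace (c (fst p, snd p) + 0 + c' (fst p, snd p)) \<le> 0"
    unfolding viscosity_subsolution_def by fastforce
  then have "- a p + \<mu> - 1 / 2 * trace (c p) - 1 / 2 * trace (c' p) \<le> 0"
    by (simp add: trace_def sum.distrib algebra_simps)
  moreover have "a p + 1 / 2 * trace (c p) \<le> 0" by (rule super[OF p tT up])
  moreover have "1 / 2 * trace (c' p) \<le> \<mu> / 2" using \<psi>b[OF p] by (simp add: lam_def)
  ultimately show False using \<mu> by linarith
qed

section \<open>Barriers\<close>

text \<open>A window has length \<open>2 h\<close> and height at most \<open>1\<close>.\<close>

lemma qvar_window:
  assumes h: "0 < h" and t: "t \<in> {0..T}"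
  shows "0 \<le> qvar (wphi h i) t" "qvar (wphi h i) t \<le> 2 * h"
proof -
  let ?f = "\<lambda>s. (wphi h i s)\<^sup>2"
  define a where "a = (real i - 1) * h"
  define b where "b = (real i + 1) * h"
  have ab: "b - a = 2 * h" by (simp add: a_def b_def algebra_simps)
  have fi: "?f integrable_on {0..T}"
    by (intro integrable_continuous_interval continuous_intros primitiveD(3)[OF primitive_window])
  have qd: "qvar (wphi h i) t = integral {t..T} ?f"
    using Henstock_Kurzweil_Integration.integral_combine[OF _ _ fi, of t] t
    unfolding qvar_def[OF primitive_window[of h i]] by simp
  show "0 \<le> qvar (wphi h i) t"
    unfolding qd by (intro integral_nonneg integrable_on_subinterval[OF fi]) (use t in auto)
  have "0 \<le> integral {0..t} ?f"
    by (intro integral_nonneg integrable_on_subinterval[OF fi]) (use t in auto)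
  then have "qvar (wphi h i) t \<le> integral {0..T} ?f" by (simp add: qvar_def[OF primitive_window[of h i]])
  also have "\<dots> = integral UNIV (\<lambda>s. if s \<in> {0..T} then ?f s else 0)" by (simp only: integral_restrict_UNIV)
  also have "\<dots> \<le> integral UNIV (\<lambda>s. if s \<in> {a..b} then 1 else 0)"
  proof (rule Henstock_Kurzweil_Integration.integral_le)
    show "(\<lambda>s. if s \<in> {0..T} then ?f s else 0) integrable_on UNIV"
      using fi by (simp only: integrable_restrict_UNIV)
    show "(\<lambda>s. if s \<in> {a..b} then 1 else 0 :: real) integrable_on UNIV"
      using integrable_const_ivl[of 1 a b] by (simp only: integrable_restrict_UNIV)
    fix s
    show "(if s \<in> {0..T} then ?f s else 0) \<le> (if s \<in> {a..b} then 1 else 0)"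
    proof (cases "s \<in> {a..b}")
      case True
      have "?f s \<le> 1" using wphi_range[of h i s] h by (intro power_le_one) auto
      then show ?thesis using True by simp
    next
      case False
      then have "wphi h i s = 0" by (intro window_support[OF h]) (auto simp: a_def b_def)
      then show ?thesis using False by simp
    qed
  qed
  also have "\<dots> = integral {a..b} (\<lambda>s. 1)" by (simp only: integral_restrict_UNIV)
  also have "\<dots> = 2 * h" using ab h by simp
  finally show "qvar (wphi h i) t \<le> 2 * h" .
qed

lemma smooth_wcut:
  fixes v :: "real ^ 'n::finite"
  assumes h: "0 < h" and \<rho>: "0 < \<rho>" "\<rho> \<le> 1"
  shows "smooth (wcut h \<rho> v i) (\<lambda>_. 0) (wcut_b h \<rho> v i) (wcut_c h \<rho> v i)"
proof (rule smooth_flat[OF flat_C2_wcut])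
  let ?K = "3000000 / \<rho>\<^sup>2"
  have le: "?K * wphi h i t \<le> ?K" for t
    using wphi_range[of h i t] h by (intro mult_left_le) auto
  have ph: "p \<in> Lambda_hat T" if "p \<in> Lambda T" for p :: "real \<times> 'n path" using that Lambda_subset by auto
  show "quartic (wcut h \<rho> v i)" by (rule quartic_bounded[of _ 1]) (simp add: wcut_def cut_range)
  show "quartic (wcut_b h \<rho> v i)"
    by (rule quartic_bounded[of _ ?K]) (rule order_trans[OF wcut_estimates(1)[OF h \<rho> ph] le])
  show "quartic (wcut_c h \<rho> v i)"
  proof (rule quartic_bounded[of _ "real CARD('n) * (real CARD('n) * ?K)"])
    fix p :: "real \<times> 'n path" assume "p \<in> Lambda T"
    from norm_matrix_le[OF order_trans[OF wcut_estimates(2)[OF h \<rho> ph[OF this]] le]]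
    show "norm (wcut_c h \<rho> v i p) \<le> real CARD('n) * (real CARD('n) * ?K)" .
  qed
qed

text \<open>
  After time \<open>t0 - h\<close> a window that ended before has become inert: the gauge needs no correction
  there, and the cut-off removes the contribution at the reference path altogether. All other
  windows are measured by the supersolution above their gauge, scaled so that it reaches \<open>1\<close>
  before the gauge exceeds \<open>r\<^sup>4 / 2\<close>.
\<close>

definition bterm :: "real \<Rightarrow> real \<Rightarrow> real \<Rightarrow> real ^ 'n \<Rightarrow> nat \<Rightarrow> real \<times> ('n::finite) path \<Rightarrow> real" where
  "bterm h r t0 v i p = (if (real i + 1) * h \<le> t0 - h then wcut h (r ^ 4 / 4) v i p
     else 2 / r ^ 4 * martingale_bound (wphi h i) (wgam h i) (woff v i) p)"

lemma barrier_term: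
  fixes v :: "real ^ 'n::finite"
  assumes h: "0 < h" and r: "0 < r" "r \<le> 1"
  shows "\<exists>a b c. smooth (bterm h r t0 v i) a b c \<and> (\<forall>p\<in>Lambda T. t0 - h \<le> fst p \<longrightarrow> a p + 1 / 2 * trace (c p) \<le> 0)"
    and "p \<in> Lambda T \<Longrightarrow> 0 \<le> bterm h r t0 v i p"
    and "p \<in> Lambda T \<Longrightarrow> bterm h r t0 v i p < 1 \<Longrightarrow> wmax h v i p \<le> r"
proof -
  note mbd = martingale_bound_def[OF primitive_window[of h i], of "woff v i"]
  show "\<exists>a b c. smooth (bterm h r t0 v i) a b c \<and> (\<forall>p\<in>Lambda T. t0 - h \<le> fst p \<longrightarrow> a p + 1 / 2 * trace (c p) \<le> 0)"
  proof (cases "(real i + 1) * h \<le> t0 - h")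
    case True
    have r4: "0 < r ^ 4 / 4" "r ^ 4 / 4 \<le> 1" using r power_le_one[of r 4] by auto
    have z: "bterm h r t0 v i = wcut h (r ^ 4 / 4) v i" using True by (simp add: bterm_def[abs_def])
    have "trace (wcut_c h (r ^ 4 / 4) v i p) = 0" if p: "p \<in> Lambda T" and t: "t0 - h \<le> fst p" for p
    proof -
      have "wphi h i (fst p) = 0" using True t by (intro window_support[OF h]) auto
      then have "\<bar>wcut_c h (r ^ 4 / 4) v i p $ k $ l\<bar> \<le> 0" for k l
        using wcut_estimates(2)[OF h r4, of p v i k l] p Lambda_subset by fastforce
      then show ?thesis by (simp add: trace_def)
    qed
    then have "\<forall>p\<in>Lambda T. t0 - h \<le> fst p \<longrightarrow> 0 + 1 / 2 * trace (wcut_c h (r ^ 4 / 4) v i p) \<le> 0" by simp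
    then show ?thesis
      unfolding z by (intro exI[of _ "\<lambda>_. 0"] exI[of _ "wcut_b h (r ^ 4 / 4) v i"] exI[of _ "wcut_c h (r ^ 4 / 4) v i"]
          conjI smooth_wcut[OF h r4])
  next
    case False
    obtain a b c where S: "smooth (martingale_bound (wphi h i) (wgam h i) (woff v i)) a b c"
      and L: "\<And>p. p \<in> Lambda T \<Longrightarrow> a p + 1 / 2 * trace (c p) \<le> 0"
      using smooth_martingale_bound[OF primitive_window[of h i], of "woff v i"] by blast
    have z: "bterm h r t0 v i = (\<lambda>p. 2 / r ^ 4 * martingale_bound (wphi h i) (wgam h i) (woff v i) p)" using False by (simp add: bterm_def[abs_def])
    have "2 / r ^ 4 * a p + 1 / 2 * trace ((2 / r ^ 4) *\<^sub>R c p) \<le> 0" if "p \<in> Lambda T" for p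
    proof -
      have "2 / r ^ 4 * a p + 1 / 2 * trace ((2 / r ^ 4) *\<^sub>R c p) = 2 / r ^ 4 * (a p + 1 / 2 * trace (c p))"
        by (simp add: trace_def distrib_left flip: sum_distrib_left sum_divide_distrib)
      also have "\<dots> \<le> 0" using L[OF that] r by (intro mult_nonneg_nonpos) auto
      finally show ?thesis .
    qed
    then show ?thesis unfolding z
      by (intro exI[of _ "\<lambda>p. 2 / r ^ 4 * a p"] exI[of _ "\<lambda>p. (2 / r ^ 4) *\<^sub>R b p"] exI[of _ "\<lambda>p. (2 / r ^ 4) *\<^sub>R c p"]
          conjI smooth_scale[OF S]) simp
  qed
  assume p: "p \<in> Lambda T"
  then have ph: "p \<in> Lambda_hat T" and tp: "fst p \<in> {0..T}" using Lambda_subset by (auto simp: Lambda_def)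
  have mb: "wgauge h v i p \<le> martingale_bound (wphi h i) (wgam h i) (woff v i) p"
    using qvar_window(1)[OF h tp, of i] unfolding mbd by simp
  moreover have g0: "0 \<le> wgauge h v i p" by (rule gauge_estimates(3)[OF primitive_window ph])
  ultimately show "0 \<le> bterm h r t0 v i p" by (simp add: bterm_def wcut_def cut_range)
  assume z1: "bterm h r t0 v i p < 1"
  show "wmax h v i p \<le> r"
  proof (rule wgauge_less[OF ph r(1)])
    show "wgauge h v i p < r ^ 4 / 2"
    proof (cases "(real i + 1) * h \<le> t0 - h")
      case True
      then have "wgauge h v i p < 2 * (r ^ 4 / 4)"
        using z1 r unfolding bterm_def wcut_def by (intro cut_less_1) auto
      then show ?thesis by simp
    next
      case False
      then have "2 / r ^ 4 * martingale_bound (wphi h i) (wgam h i) (woff v i) p < 1" using z1 by (simp add: bterm_def)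
      then have "martingale_bound (wphi h i) (wgam h i) (woff v i) p < r ^ 4 / 2" using r by (simp add: field_simps)
      then show ?thesis using mb by linarith
    qed
  qed
qed

text \<open>A window that has not begun has not collected any increment.\<close>

lemma wmax_future:
  fixes x :: "('n::finite) path"
  assumes h: "0 < h" and x: "x \<in> cadlag_paths T" and t: "t \<in> {0..T}" "t \<le> (real i - 1) * h"
  shows "wmax h (x 0) i (t, x) \<le> 0"
proof (rule rmax_least[OF primitive_window t(1)])
  fix s assume s: "s \<in> {0..t}"
  have "wpos h (x 0) i (s, x) = wpos h (x 0) i (0, x)"
    by (rule wpos_eq[OF h x]) (use s t in auto)
  also have "\<dots> = 0"
    using win_stopped[OF primitive_window x, of 0 h i] T_pos h by (simp add: pos_def wphi_at_0 woff_def)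
  finally show "norm (wpos h (x 0) i (s, x)) \<le> 0" by simp
qed

text \<open>
  At the reference point the past windows contribute \<open>0\<close>. The at most three windows near \<open>t0\<close>
  contribute at most \<open>A\<close> each, where the small number \<open>w\<close> bounds the window integrals of the
  reference path once \<open>h\<close> is small enough. The future windows, of which there are about \<open>T / h\<close>,
  only contribute the square of their expected quadratic variation, of order \<open>h\<^sup>2\<close> each.
\<close>

lemma barrier_scale:
  fixes x0 :: "('n::finite) path"
  assumes p0: "(t0, x0) \<in> Lambda T" and r: "0 < r" "r \<le> 1" and \<delta>: "0 < \<delta>"
  shows "\<exists>h>0. \<exists>Z a b c. smooth Z a b c \<and>
    (\<forall>p\<in>Lambda T. 0 \<le> Z p \<and> (t0 - h \<le> fst p \<longrightarrow> a p + 1 / 2 * trace (c p) \<le> 0) \<and>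
       (Z p < 1 \<longrightarrow> (\<forall>i<wnum h. wmax h (x0 0) i p \<le> r))) \<and>
    Z (t0, x0) \<le> \<delta>"
proof -
  have x0: "x0 \<in> cont_paths T" and t0: "t0 \<in> {0..T}" using p0 by (auto simp: Lambda_def)
  have x0c: "x0 \<in> cadlag_paths T" using x0 cont_cadlag by auto
  have p0h: "(t0, x0) \<in> Lambda_hat T" using p0 Lambda_subset by auto
  define C where "C = 6 * real CARD('n) + 24"
  define K where "K = (3 * real CARD('n) + 12) * real CARD('n)"
  define D where "D = 2 / r ^ 4"
  have C: "0 \<le> C" and K: "0 \<le> K" and D: "0 < D" using r by (auto simp: C_def K_def D_def)
  define w where "w = min (r / 2) (min 1 (\<delta> / (24 * D)))"
  have w: "0 < w" "w \<le> 1" "w \<le> r / 2" "w \<le> \<delta> / (24 * D)" using r \<delta> D by (auto simp: w_def)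
  have w4: "w ^ 4 \<le> w" "w\<^sup>2 \<le> 1" using w power_decreasing[of 1 4 w] by (auto intro: power_le_one)
  obtain h0 where h0: "h0 > 0" and h0w: "\<And>h t i. 0 < h \<Longrightarrow> h \<le> h0 \<Longrightarrow> t \<in> {0..T} \<Longrightarrow> wmax h (x0 0) i (t, x0) \<le> w"
    using window_small_cont[OF x0 w(1)] by blast
  define E where "E = D * (6 * C + 12 * K + 4 * K * (T + 2))"
  have E: "0 \<le> E" using C K D T_pos by (simp add: E_def)
  define h where "h = min (min h0 1) (\<delta> / (2 * (E + 1)))"
  have h: "0 < h" "h \<le> h0" "h \<le> 1" using h0 \<delta> E by (auto simp: h_def)
  have hE: "h * E \<le> \<delta> / 2"
  proof -
    have "h * E \<le> \<delta> / (2 * (E + 1)) * (E + 1)" using h E by (intro mult_mono) (auto simp: h_def)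
    also have "\<dots> = \<delta> / 2" using E by (simp add: field_simps)
    finally show ?thesis .
  qed
  define z where "z i = bterm h r t0 (x0 0) i" for i
  note bt = barrier_term[OF h(1) r, where ?t0.0 = t0 and v = "x0 0", folded z_def]
  have "\<forall>i. \<exists>abc. smooth (z i) (fst abc) (fst (snd abc)) (snd (snd abc)) \<and>
    (\<forall>p\<in>Lambda T. t0 - h \<le> fst p \<longrightarrow> fst abc p + 1 / 2 * trace (snd (snd abc) p) \<le> 0)"
  proof
    fix i
    obtain a b c where "smooth (z i) a b c" "\<forall>p\<in>Lambda T. t0 - h \<le> fst p \<longrightarrow> a p + 1 / 2 * trace (c p) \<le> 0"
      using bt(1)[of i] by blast
    then show "\<exists>abc. smooth (z i) (fst abc) (fst (snd abc)) (snd (snd abc)) \<and>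
      (\<forall>p\<in>Lambda T. t0 - h \<le> fst p \<longrightarrow> fst abc p + 1 / 2 * trace (snd (snd abc) p) \<le> 0)"
      by (intro exI[of _ "(a, b, c)"]) simp
  qed
  then obtain abc where abc: "\<forall>i. smooth (z i) (fst (abc i)) (fst (snd (abc i))) (snd (snd (abc i))) \<and>
    (\<forall>p\<in>Lambda T. t0 - h \<le> fst p \<longrightarrow> fst (abc i) p + 1 / 2 * trace (snd (snd (abc i)) p) \<le> 0)"
    by (rule choice[THEN exE])
  define Z where "Z p = (\<Sum>i<wnum h. z i p)" for p
  have S: "smooth Z (\<lambda>p. \<Sum>i<wnum h. fst (abc i) p) (\<lambda>p. \<Sum>i<wnum h. fst (snd (abc i)) p) (\<lambda>p. \<Sum>i<wnum h. snd (snd (abc i)) p)"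
    unfolding Z_def[abs_def] by (rule smooth_sum) (use abc in auto)
  have L: "(\<Sum>i<wnum h. fst (abc i) p) + 1 / 2 * trace (\<Sum>i<wnum h. snd (snd (abc i)) p) \<le> 0"
    if "p \<in> Lambda T" "t0 - h \<le> fst p" for p
  proof -
    have "trace (\<Sum>i<wnum h. snd (snd (abc i)) p) = (\<Sum>i<wnum h. trace (snd (snd (abc i)) p))"
      unfolding trace_def by (subst sum.swap) simp
    then have "(\<Sum>i<wnum h. fst (abc i) p) + 1 / 2 * trace (\<Sum>i<wnum h. snd (snd (abc i)) p) =
      (\<Sum>i<wnum h. fst (abc i) p + 1 / 2 * trace (snd (snd (abc i)) p))"
      by (simp add: sum.distrib sum_divide_distrib)
    also have "\<dots> \<le> 0" using abc that by (intro sum_nonpos) blast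
    finally show ?thesis .
  qed
  have Zm: "z i p \<le> Z p" if "p \<in> Lambda T" "i < wnum h" for i p
    unfolding Z_def using that bt(2) by (intro member_le_sum) auto
  have Z0: "0 \<le> Z p" if "p \<in> Lambda T" for p
    unfolding Z_def using that bt(2) by (intro sum_nonneg) auto
  have Zs: "wmax h (x0 0) i p \<le> r" if "p \<in> Lambda T" "Z p < 1" "i < wnum h" for i p
    using bt(3)[OF that(1), of i] Zm[OF that(1,3)] that(2) by linarith
  define A where "A = D * (4 * w ^ 4 + C * (2 * h) * w\<^sup>2)"
  define F where "F = D * (K * (2 * h)\<^sup>2)"
  have A0: "0 \<le> A" and F0: "0 \<le> F" using C K D h w by (auto simp: A_def F_def)
  define k where "k = nat \<lfloor>t0 / h\<rfloor>"
  have "real k = of_int \<lfloor>t0 / h\<rfloor>" using t0 h by (simp add: k_def)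
  then have k: "real k \<le> t0 / h" "t0 / h < real k + 1" by linarith+
  have zi: "z i (t0, x0) \<le> (if i \<in> {k - 1..k + 1} then A else 0) + F" for i
  proof (cases "(real i + 1) * h \<le> t0 - h")
    case True
    have "0 \<le> wmax h (x0 0) i (t0, x0)" by (rule rmax_nonneg[OF primitive_window p0h])
    then have "(wmax h (x0 0) i (t0, x0)) ^ 4 \<le> (r / 2) ^ 4"
      using h0w[OF h(1,2) t0, of i] w(3) by (intro power_mono) auto
    then have "wgauge h (x0 0) i (t0, x0) \<le> r ^ 4 / 4"
      using gauge_estimates(2)[OF primitive_window p0h, of h i "woff (x0 0) i"] by (simp add: power_divide)
    then have "wcut h (r ^ 4 / 4) (x0 0) i (t0, x0) = 0"
      unfolding wcut_def using r by (intro cut_low) (simp add: field_simps)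
    then show ?thesis using True A0 F0 by (simp add: z_def bterm_def)
  next
    case False
    define m where "m = wmax h (x0 0) i (t0, x0)"
    define Q where "Q = qvar (wphi h i) t0"
    have m0: "0 \<le> m" unfolding m_def by (rule rmax_nonneg[OF primitive_window p0h])
    have Q: "0 \<le> Q" "Q \<le> 2 * h" using qvar_window[OF h(1) t0] by (auto simp: Q_def)
    have "wgauge h (x0 0) i (t0, x0) \<le> 4 * m ^ 4" unfolding m_def by (rule gauge_estimates(2)[OF primitive_window p0h])
    moreover have "(norm (wpos h (x0 0) i (t0, x0)))\<^sup>2 \<le> m\<^sup>2" unfolding m_def by (rule pos2_le_rmax2[OF primitive_window p0h])
    then have "C * Q * (norm (wpos h (x0 0) i (t0, x0)))\<^sup>2 \<le> C * (2 * h) * m\<^sup>2"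
      using C Q h by (intro mult_mono) auto
    moreover have "K * Q\<^sup>2 \<le> K * (2 * h)\<^sup>2" using K Q by (intro mult_left_mono power_mono)
    ultimately have "martingale_bound (wphi h i) (wgam h i) (woff (x0 0) i) (t0, x0) \<le> 4 * m ^ 4 + C * (2 * h) * m\<^sup>2 + K * (2 * h)\<^sup>2"
      unfolding martingale_bound_def[OF primitive_window] C_def K_def Q_def fst_conv by linarith
    then have "D * martingale_bound (wphi h i) (wgam h i) (woff (x0 0) i) (t0, x0) \<le> D * (4 * m ^ 4 + C * (2 * h) * m\<^sup>2 + K * (2 * h)\<^sup>2)"
      using D by (intro mult_left_mono) auto
    then have zle: "z i (t0, x0) \<le> D * (4 * m ^ 4 + C * (2 * h) * m\<^sup>2) + F"
      using False by (simp add: z_def bterm_def D_def F_def distrib_left)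
    show ?thesis
    proof (cases "i \<in> {k - 1..k + 1}")
      case True
      have "m \<le> w" unfolding m_def by (rule h0w[OF h(1,2) t0])
      then have "4 * m ^ 4 + C * (2 * h) * m\<^sup>2 \<le> 4 * w ^ 4 + C * (2 * h) * w\<^sup>2"
        using m0 C h by (intro add_mono mult_left_mono power_mono) auto
      then have "D * (4 * m ^ 4 + C * (2 * h) * m\<^sup>2) \<le> A" unfolding A_def using D by (intro mult_left_mono) auto
      then show ?thesis using True zle by simp
    next
      case i: False
      have "t0 / h < real i + 2" using False h by (simp add: field_simps)
      then have "k \<le> i + 1" using k by linarith
      then have "k + 2 \<le> i" using i by auto
      then have "t0 / h \<le> real i - 1" using k by linarith
      then have "t0 \<le> (real i - 1) * h" using h by (simp add: field_simps)
      from wmax_future[OF h(1) x0c t0 this] have "m = 0" using m0 by (simp add: m_def)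
      then have "z i (t0, x0) \<le> F" using zle by simp
      then show ?thesis using A0 by simp
    qed
  qed
  have "Z (t0, x0) \<le> (\<Sum>i<wnum h. (if i \<in> {k - 1..k + 1} then A else 0) + F)"
    unfolding Z_def by (intro sum_mono zi)
  also have "\<dots> = real (card ({..<wnum h} \<inter> {k - 1..k + 1})) * A + real (wnum h) * F"
    by (simp add: sum.distrib sum.If_cases Int_def)
  also have "\<dots> \<le> 3 * A + real (wnum h) * F"
  proof -
    have "card ({..<wnum h} \<inter> {k - 1..k + 1}) \<le> card {k - 1..k + 1}" by (intro card_mono) auto
    also have "\<dots> \<le> 3" by simp
    finally have "real (card ({..<wnum h} \<inter> {k - 1..k + 1})) \<le> 3" by simp
    then show ?thesis using A0 by (simp add: mult_right_mono)
  qed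
  also have "\<dots> \<le> \<delta>"
  proof -
    have "real (wnum h) \<le> T / h + 2"
    proof -
      have "0 \<le> T / h" using T_pos h by simp
      then have "real (nat \<lceil>T / h\<rceil>) < T / h + 1" by linarith
      then show ?thesis by (simp add: wnum_def)
    qed
    then have "real (wnum h) * F \<le> (T / h + 2) * F" using F0 by (intro mult_right_mono)
    also have "\<dots> = D * K * 4 * h * (T + 2 * h)" using h by (simp add: F_def power2_eq_square field_simps)
    also have "\<dots> \<le> D * K * 4 * h * (T + 2)" using D K h by (intro mult_left_mono) auto
    also have "\<dots> = h * (D * (4 * K * (T + 2)))" by (simp add: algebra_simps)
    finally have 1: "real (wnum h) * F \<le> h * (D * (4 * K * (T + 2)))" .
    have "3 * A = 12 * D * w ^ 4 + h * (D * (6 * C * w\<^sup>2))" by (simp add: A_def algebra_simps)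
    also have "\<dots> \<le> 12 * D * w + h * (D * (6 * C * 1))"
      using w4 D h C by (intro add_mono mult_left_mono) auto
    also have "12 * D * w \<le> 12 * D * (\<delta> / (24 * D))" using w(4) D by (intro mult_left_mono) auto
    also have "12 * D * (\<delta> / (24 * D)) = \<delta> / 2" using D by simp
    finally have 2: "3 * A \<le> \<delta> / 2 + h * (D * (6 * C))" by simp
    have "h * (D * (6 * C)) + h * (D * (4 * K * (T + 2))) \<le> h * E"
      using h D K by (simp add: E_def algebra_simps)
    then show ?thesis using 1 2 hE by linarith
  qed
  finally have Zd: "Z (t0, x0) \<le> \<delta>" .
  have all: "\<forall>p\<in>Lambda T. 0 \<le> Z p \<and>
     (t0 - h \<le> fst p \<longrightarrow> (\<Sum>i<wnum h. fst (abc i) p) + 1 / 2 * trace (\<Sum>i<wnum h. snd (snd (abc i)) p) \<le> 0) \<and>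
     (Z p < 1 \<longrightarrow> (\<forall>i<wnum h. wmax h (x0 0) i p \<le> r))"
    using Z0 L Zs by blast
  show ?thesis
    by (rule exI[of _ h], rule conjI[OF h(1)], rule exI, rule exI, rule exI, rule exI, rule conjI[OF S conjI[OF all Zd]])
qed

section \<open>Trigonometric functionals\<close>

text \<open>
  Real trigonometric polynomials on path space, with the linear functionals \<open>\<integral> \<eta> \<bullet> x\<close> as
  frequencies; the phase \<open>\<beta>\<close> accounts for sines. The values off the continuous paths are left
  arbitrary.
\<close>

inductive trig :: "(('n::finite) path \<Rightarrow> real) \<Rightarrow> bool" where
  cosine: "continuous_on {0..T} \<eta> \<Longrightarrow>
    (\<And>x. x \<in> cont_paths T \<Longrightarrow> p x = k * cos (integral {0..T} (\<lambda>s. \<eta> s \<bullet> x s) + \<beta>)) \<Longrightarrow> trig p"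
| add: "trig p \<Longrightarrow> trig q \<Longrightarrow> (\<And>x. x \<in> cont_paths T \<Longrightarrow> r x = p x + q x) \<Longrightarrow> trig r"

lemma path_integrable:
  fixes x :: "('n::finite) path"
  assumes "continuous_on {0..T} \<eta>" "x \<in> cont_paths T"
  shows "(\<lambda>s. \<eta> s \<bullet> x s) integrable_on {0..T}"
  using cadlag_inner_integrable[of x \<eta> T] assms cont_cadlag T_pos by auto

lemma trig_const: "trig (\<lambda>_. k)"
  by (rule cosine[of "\<lambda>_. 0" _ k 0]) auto

text \<open>By the product-to-sum formula for cosines.\<close>

lemma trig_mult:
  assumes "trig p" "trig q" shows "trig (\<lambda>x. p x * q x)"
  using assms
proof (induction p rule: trig.induct)
  case (cosine \<eta> p k \<beta>)
  note c1 = cosine(1,2)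
  from cosine(3) show ?case
  proof (induction q rule: trig.induct)
    case (cosine \<theta> q l \<alpha>)
    define r1 where "r1 x = k * l / 2 * cos (integral {0..T} (\<lambda>s. (\<eta> s + \<theta> s) \<bullet> x s) + (\<beta> + \<alpha>))" for x :: "'a path"
    define r2 where "r2 x = k * l / 2 * cos (integral {0..T} (\<lambda>s. (\<eta> s - \<theta> s) \<bullet> x s) + (\<beta> - \<alpha>))" for x :: "'a path"
    have "trig r1" by (rule trig.cosine[of "\<lambda>s. \<eta> s + \<theta> s" r1 "k * l / 2" "\<beta> + \<alpha>"]) (use c1 cosine in \<open>auto simp: r1_def intro: continuous_on_add\<close>)
    moreover have "trig r2" by (rule trig.cosine[of "\<lambda>s. \<eta> s - \<theta> s" r2 "k * l / 2" "\<beta> - \<alpha>"]) (use c1 cosine in \<open>auto simp: r2_def intro: continuous_on_diff\<close>)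
    ultimately show ?case
    proof (rule trig.add)
      fix x :: "'a path" assume x: "x \<in> cont_paths T"
      let ?a = "integral {0..T} (\<lambda>s. \<eta> s \<bullet> x s)" and ?b = "integral {0..T} (\<lambda>s. \<theta> s \<bullet> x s)"
      have "integral {0..T} (\<lambda>s. (\<eta> s + \<theta> s) \<bullet> x s) = ?a + ?b" "integral {0..T} (\<lambda>s. (\<eta> s - \<theta> s) \<bullet> x s) = ?a - ?b"
        using path_integrable[OF c1(1) x] path_integrable[OF cosine(1) x]
        by (simp_all add: inner_add_left inner_diff_left Henstock_Kurzweil_Integration.integral_add
            Henstock_Kurzweil_Integration.integral_diff)
      moreover have "?a + ?b + (\<beta> + \<alpha>) = (?a + \<beta>) + (?b + \<alpha>)" "?a - ?b + (\<beta> - \<alpha>) = (?a + \<beta>) - (?b + \<alpha>)" by simp_all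
      ultimately show "p x * q x = r1 x + r2 x"
        using c1(2)[OF x] cosine(2)[OF x] by (simp only: r1_def r2_def cos_add cos_diff) (simp add: algebra_simps)
    qed
  next
    case (add q q' r)
    show ?case by (rule trig.add[OF add.IH]) (simp add: add.hyps(3) distrib_left)
  qed
next
  case (add p p' r)
  show ?case by (rule trig.add[OF add.IH(1)[OF add.prems] add.IH(2)[OF add.prems]]) (simp add: add.hyps(3) distrib_right)
qed

lemma trig_polynomial:
  fixes g :: "real \<Rightarrow> real"
  assumes "real_polynomial_function g" "trig p"
  shows "trig (\<lambda>x. g (p x))"
  using assms
proof (induction g rule: real_polynomial_function.induct)
  case (linear g)
  have "g y = y * g 1" for y :: real using linear_simps(5)[OF linear(1), of y 1] by simp
  then have "(\<lambda>x. g (p x)) = (\<lambda>x. p x * g 1)" by (intro ext)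
  then show ?case using trig_mult[OF linear(2) trig_const[of "g 1"]] by simp
next
  case (add f g) show ?case by (rule trig.add[OF add.IH(1)[OF add.prems] add.IH(2)[OF add.prems]]) simp
next
  case (mult f g) show ?case by (rule trig_mult[OF mult.IH(1)[OF mult.prems] mult.IH(2)[OF mult.prems]])
qed (rule trig_const)

text \<open>
  Frozen at time \<open>t\<close>, the functional \<open>\<integral> \<eta> \<bullet> x\<close> has the vertical gradient \<open>f t\<close>, the integral of
  \<open>\<eta>\<close> over \<open>[t, T]\<close>. The Hessian of its cosine has the trace \<open>- |f t|\<^sup>2\<close> times the cosine, and
  the growing factor \<open>\<alpha>\<close> compensates for one half of that.
\<close>

lemma cosine_heat_solution:
  fixes \<eta> :: "real \<Rightarrow> real ^ 'n::finite"
  assumes \<eta>: "continuous_on {0..T} \<eta>"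
  shows "\<exists>v a b c. smooth v a b c \<and> (\<forall>p\<in>Lambda T. a p + 1 / 2 * trace (c p) = 0 \<and> \<bar>v p\<bar> \<le> \<bar>k\<bar>) \<and>
    (\<forall>x\<in>cont_paths T. v (T, x) = k * cos (integral {0..T} (\<lambda>s. \<eta> s \<bullet> x s) + \<beta>))"
proof -
  define f where "f t = integral {0..T} \<eta> - integral {0..t} \<eta>" for t
  define g where "g t = - \<eta> t" for t
  have fg: "primitive f g"
    unfolding primitive_def f_def g_def
  proof (intro conjI ballI continuous_on_minus \<eta>)
    fix t assume "t \<in> {0..T}"
    from has_vector_derivative_diff[OF has_vector_derivative_const integral_has_vector_derivative[OF \<eta> this]]
    show "((\<lambda>t. integral {0..T} \<eta> - integral {0..t} \<eta>) has_vector_derivative - \<eta> t) (at t within {0..T})" by simp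
  qed
  have fT: "f T = 0" by (simp add: f_def)
  have fc: "continuous_on {0..T} f" by (rule primitiveD(3)[OF fg])
  define u where "u p = ell f g (stopped T (fst p) (snd p))" for p :: "real \<times> 'n path"
  define F where "F s = k * cos (s + \<beta>)" for s
  define F1 where "F1 s = - k * sin (s + \<beta>)" for s
  define F2 where "F2 s = - k * cos (s + \<beta>)" for s
  have d1: "(F has_real_derivative F1 s) (at s)" and d2: "(F1 has_real_derivative F2 s) (at s)" for s
    unfolding F_def F1_def F2_def by (auto intro!: derivative_eq_intros)
  have F2c: "continuous_on UNIV F2" unfolding F2_def by (intro continuous_intros)
  have fl: "flat_C2 u (\<lambda>p. f (fst p)) (\<lambda>_. 0)" unfolding u_def by (rule flat_C2_ell[OF fg])
  note fl2 = flat_C2_compose[OF fl d1 d2 F2c]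
  define b where "b p = F1 (u p) *\<^sub>R f (fst p)" for p
  define c where "c p = (\<chi> i j. F2 (u p) * f (fst p) $ i * f (fst p) $ j + F1 (u p) * (0 :: real ^ 'n ^ 'n) $ i $ j)" for p
  have "bounded (f ` {0..T})" by (rule compact_imp_bounded[OF compact_continuous_image[OF fc compact_Icc]])
  then obtain B where B: "\<And>t. t \<in> {0..T} \<Longrightarrow> norm (f t) \<le> B" unfolding bounded_iff by blast
  have B0: "0 \<le> B" by (rule order_trans[OF norm_ge_zero B[of 0]]) (use T_pos in simp)
  have Fb: "\<bar>F s\<bar> \<le> \<bar>k\<bar>" "\<bar>F1 s\<bar> \<le> \<bar>k\<bar>" "\<bar>F2 s\<bar> \<le> \<bar>k\<bar>" for s
    by (simp_all add: F_def F1_def F2_def abs_mult mult_left_le)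
  have sm: "smooth (\<lambda>p. F (u p)) (\<lambda>_. 0) b c"
  proof (rule smooth_flat)
    show "flat_C2 (\<lambda>p. F (u p)) b c" unfolding b_def c_def by (rule fl2)
    show "quartic (\<lambda>p. F (u p))" by (rule quartic_bounded[of _ "\<bar>k\<bar>"]) (simp add: Fb)
    show "quartic b"
    proof (rule quartic_bounded[of _ "\<bar>k\<bar> * B"])
      fix p :: "real \<times> 'n path" assume "p \<in> Lambda T"
      then have "fst p \<in> {0..T}" by (auto simp: Lambda_def)
      then show "norm (b p) \<le> \<bar>k\<bar> * B" unfolding b_def norm_scaleR using Fb B by (intro mult_mono) auto
    qed
    show "quartic c"
    proof (rule quartic_bounded[of _ "real CARD('n) * (real CARD('n) * (\<bar>k\<bar> * B * B))"], rule norm_matrix_le)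
      fix p :: "real \<times> 'n path" and i j assume "p \<in> Lambda T"
      then have "fst p \<in> {0..T}" by (auto simp: Lambda_def)
      then have fi: "\<bar>f (fst p) $ i\<bar> \<le> B" for i using B[of "fst p"] component_le_norm_cart[of "f (fst p)" i] by linarith
      have "\<bar>F2 (u p)\<bar> * \<bar>f (fst p) $ i\<bar> * \<bar>f (fst p) $ j\<bar> \<le> \<bar>k\<bar> * B * B"
        using fi Fb B0 by (intro mult_mono) auto
      then show "\<bar>c p $ i $ j\<bar> \<le> \<bar>k\<bar> * B * B" by (simp add: c_def abs_mult)
    qed
  qed
  define V where "V t = integral {0..t} (\<lambda>s. (norm (f s))\<^sup>2)" for t
  define \<alpha> where "\<alpha> t = exp ((V t - V T) / 2)" for t
  have nc: "continuous_on {0..T} (\<lambda>s. (norm (f s))\<^sup>2)" by (intro continuous_intros fc)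
  have Vd: "(V has_real_derivative (norm (f t))\<^sup>2) (at t within {0..T})" if "t \<in> {0..T}" for t
    unfolding V_def using integral_has_real_derivative[OF nc that] .
  have ad: "(\<alpha> has_real_derivative (norm (f t))\<^sup>2 / 2 * \<alpha> t) (at t within {0..T})" if "t \<in> {0..T}" for t
    unfolding \<alpha>_def by (auto intro!: derivative_eq_intros Vd[OF that])
  have ac: "continuous_on {0..T} \<alpha>" by (rule DERIV_continuous_on[OF ad])
  have a1: "\<alpha> t \<le> 1" if t: "t \<in> {0..T}" for t
  proof -
    have "V t \<le> V T" unfolding V_def
      by (rule integral_subset_le) (use t in \<open>auto intro!: integrable_continuous_interval continuous_on_subset[OF nc]\<close>)
    then show ?thesis by (simp add: \<alpha>_def)
  qed
  have acc: "continuous_on {0..T} (\<lambda>t. (norm (f t))\<^sup>2 / 2 * \<alpha> t)" by (intro continuous_intros nc ac) auto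
  note S = smooth_time_mult[OF sm ad acc]
  have L: "((norm (f (fst p)))\<^sup>2 / 2 * \<alpha> (fst p) * F (u (unjump p)) + \<alpha> (fst p) * 0) + 1 / 2 * trace (\<alpha> (fst p) *\<^sub>R c p) = 0
     \<and> \<bar>\<alpha> (fst p) * F (u p)\<bar> \<le> \<bar>k\<bar>"
    if p: "p \<in> Lambda T" for p
  proof
    have n2: "(norm (f (fst p)))\<^sup>2 = (\<Sum>i\<in>UNIV. f (fst p) $ i * f (fst p) $ i)" by (simp add: power2_norm_eq_inner inner_vec_def)
    have "trace (\<alpha> (fst p) *\<^sub>R c p) = (\<Sum>i\<in>UNIV. (\<alpha> (fst p) * F2 (u p)) * (f (fst p) $ i * f (fst p) $ i))"
      by (simp add: trace_def c_def mult.assoc)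
    also have "\<dots> = \<alpha> (fst p) * F2 (u p) * (norm (f (fst p)))\<^sup>2" by (simp only: n2 sum_distrib_left)
    also have "F2 (u p) = - F (u p)" by (simp add: F_def F2_def)
    finally show "((norm (f (fst p)))\<^sup>2 / 2 * \<alpha> (fst p) * F (u (unjump p)) + \<alpha> (fst p) * 0) + 1 / 2 * trace (\<alpha> (fst p) *\<^sub>R c p) = 0"
      using unjump_Lambda[OF p] by simp
    have "0 \<le> \<alpha> (fst p)" "\<alpha> (fst p) \<le> 1" using a1 p by (auto simp: \<alpha>_def Lambda_def)
    then have "\<bar>\<alpha> (fst p)\<bar> * \<bar>F (u p)\<bar> \<le> 1 * \<bar>k\<bar>" using Fb by (intro mult_mono) auto
    then show "\<bar>\<alpha> (fst p) * F (u p)\<bar> \<le> \<bar>k\<bar>" by (simp add: abs_mult)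
  qed
  have E: "\<alpha> (fst (T, x)) * F (u (T, x)) = k * cos (integral {0..T} (\<lambda>s. \<eta> s \<bullet> x s) + \<beta>)" if "x \<in> cont_paths T" for x
  proof -
    have "stopped T T x = x" using that by (intro stopped_T) (simp add: cont_paths_def)
    then have "u (T, x) = integral {0..T} (\<lambda>s. \<eta> s \<bullet> x s)" by (simp add: u_def ell_def fT g_def)
    then show ?thesis by (simp add: \<alpha>_def F_def)
  qed
  define v where "v p = \<alpha> (fst p) * F (u p)" for p
  define a where "a p = (norm (f (fst p)))\<^sup>2 / 2 * \<alpha> (fst p) * F (u (unjump p)) + \<alpha> (fst p) * 0" for p
  have S': "smooth v a (\<lambda>p. \<alpha> (fst p) *\<^sub>R b p) (\<lambda>p. \<alpha> (fst p) *\<^sub>R c p)" unfolding v_def a_def by (rule S)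
  have L': "\<forall>p\<in>Lambda T. a p + 1 / 2 * trace (\<alpha> (fst p) *\<^sub>R c p) = 0 \<and> \<bar>v p\<bar> \<le> \<bar>k\<bar>" unfolding v_def a_def using L by blast
  have E': "\<forall>x\<in>cont_paths T. v (T, x) = k * cos (integral {0..T} (\<lambda>s. \<eta> s \<bullet> x s) + \<beta>)" unfolding v_def using E by blast
  show ?thesis
    by (rule exI[of _ v], rule exI[of _ a], rule exI, rule exI, rule conjI[OF S' conjI[OF L' E']])
qed

lemma trig_heat_solution:
  assumes "trig p"
  shows "\<exists>v a b c B. smooth v a b c \<and> (\<forall>q\<in>Lambda T. a q + 1 / 2 * trace (c q) = 0 \<and> \<bar>v q\<bar> \<le> B) \<and>
    (\<forall>x\<in>cont_paths T. v (T, x) = p x)"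
  using assms
proof (induction p rule: trig.induct)
  case (cosine \<eta> p k \<beta>)
  obtain v a b c where "smooth v a b c" "\<forall>q\<in>Lambda T. a q + 1 / 2 * trace (c q) = 0 \<and> \<bar>v q\<bar> \<le> \<bar>k\<bar>"
    "\<forall>x\<in>cont_paths T. v (T, x) = k * cos (integral {0..T} (\<lambda>s. \<eta> s \<bullet> x s) + \<beta>)"
    using cosine_heat_solution[OF cosine(1), of k \<beta>] by blast
  then show ?case using cosine(2)
    by (intro exI[of _ v] exI[of _ a] exI[of _ b] exI[of _ c] exI[of _ "\<bar>k\<bar>"]) simp
next
  case (add p q r)
  obtain v a b c B where 1: "smooth v a b c" "\<forall>q\<in>Lambda T. a q + 1 / 2 * trace (c q) = 0 \<and> \<bar>v q\<bar> \<le> B"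
    "\<forall>x\<in>cont_paths T. v (T, x) = p x" using add.IH(1) by blast
  obtain v' a' b' c' B' where 2: "smooth v' a' b' c'" "\<forall>q\<in>Lambda T. a' q + 1 / 2 * trace (c' q) = 0 \<and> \<bar>v' q\<bar> \<le> B'"
    "\<forall>x\<in>cont_paths T. v' (T, x) = q x" using add.IH(2) by blast
  have L: "a y + a' y + 1 / 2 * trace (c y + c' y) = 0 \<and> \<bar>v y + v' y\<bar> \<le> B + B'" if y: "y \<in> Lambda T" for y
  proof
    have "trace (c y + c' y) = trace (c y) + trace (c' y)" by (simp add: trace_def sum.distrib)
    then show "a y + a' y + 1 / 2 * trace (c y + c' y) = 0" using 1(2) 2(2) y by (simp add: distrib_left) fastforce
    have "\<bar>v y\<bar> \<le> B" "\<bar>v' y\<bar> \<le> B'" using 1(2) 2(2) y by auto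
    then show "\<bar>v y + v' y\<bar> \<le> B + B'" by linarith
  qed
  have E: "v (T, x) + v' (T, x) = r x" if "x \<in> cont_paths T" for x using 1(3) 2(3) add.hyps(3)[OF that] that by simp
  show ?case
    by (rule exI, rule exI, rule exI, rule exI, rule exI, rule conjI[OF smooth_add[OF 1(1) 2(1)]], rule conjI, rule ballI, rule L, assumption,
        rule ballI, rule E, assumption)
qed

lemma d_inf_terminal:
  assumes "x \<in> cont_paths T" "y \<in> cont_paths T"
  shows "d_inf T (T, x) (T, y) = sup_dist T x y"
  using assms stopped_T[of x] stopped_T[of y] by (simp add: d_inf_def cont_paths_def)

lemma trig_cont:
  assumes "trig p" shows "cont_wrt (sup_dist T) (cont_paths T) p"
proof -
  obtain v a b c B where v: "smooth v a b c" "\<forall>x\<in>cont_paths T. v (T, x) = p x"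
    using trig_heat_solution[OF assms] by blast
  have vc: "cont_wrt (d_inf T) (Lambda_hat T) v" using v(1) by (simp add: smooth_def C12_hat_def)
  show ?thesis unfolding cont_wrt_def
  proof (intro ballI allI impI)
    fix x :: "'a path" and e assume x: "x \<in> cont_paths T" and e: "(e::real) > 0"
    have L: "(T, y) \<in> Lambda_hat T" if "y \<in> cont_paths T" for y :: "'a path"
      using that cont_cadlag T_pos by (auto simp: Lambda_hat_def)
    obtain d where d: "d > 0" "\<And>q :: real \<times> 'a path. q \<in> Lambda_hat T \<Longrightarrow> d_inf T (T, x) q < d \<Longrightarrow> dist (v q) (v (T, x)) < e"
      using vc L[OF x] e unfolding cont_wrt_def by meson
    show "\<exists>\<delta>>0. \<forall>q\<in>cont_paths T. sup_dist T x q < \<delta> \<longrightarrow> dist (p q) (p x) < e"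
    proof (intro exI[of _ d] conjI ballI impI d(1))
      fix y assume y: "y \<in> cont_paths T" "sup_dist T x y < d"
      then show "dist (p y) (p x) < e" using d(2)[OF L[OF y(1)]] d_inf_terminal[OF x y(1)] v(2) x by simp
    qed
  qed
qed

subsection \<open>Separation of paths\<close>

text \<open>
  For \<open>z = x - y\<close>, the frequency \<open>\<eta> = \<pi> z / \<integral> |z|\<^sup>2\<close> shifts the phase between \<open>x\<close> and \<open>y\<close> by
  exactly \<open>\<pi>\<close>.
\<close>

lemma trig_separates:
  fixes x y :: "('n::finite) path"
  assumes x: "x \<in> cont_paths T" and y: "y \<in> cont_paths T" and ne: "x \<noteq> y"
  shows "\<exists>p. trig p \<and> p x \<noteq> p y"
proof -
  define z where "z s = x s - y s" for s
  have xy: "continuous_on {0..T} x" "continuous_on {0..T} y" using x y by (auto simp: cont_paths_def)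
  have zc: "continuous_on {0..T} z" unfolding z_def by (intro continuous_intros xy)
  have zzc: "continuous_on {0..T} (\<lambda>s. z s \<bullet> z s)" by (intro continuous_intros zc)
  define I where "I = integral {0..T} (\<lambda>s. z s \<bullet> z s)"
  have "I \<noteq> 0"
  proof
    assume I: "I = 0"
    have "x = y"
    proof (rule path_eqI)
      fix s assume s: "s \<in> {0..T}"
      have hi: "((\<lambda>s. z s \<bullet> z s) has_integral 0) (cbox 0 T)"
        using integrable_integral[OF integrable_continuous_interval[OF zzc]] I by (simp add: I_def cbox_interval)
      have "z s \<bullet> z s = 0"
      proof (rule has_integral_0_cbox_imp_0[OF _ _ hi])
        show "continuous_on (cbox 0 T) (\<lambda>s. z s \<bullet> z s)" using zzc by (simp add: cbox_interval)
        show "box 0 T \<noteq> {}" using T_pos by simp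
      qed (use s in auto)
      then show "x s = y s" by (simp add: z_def)
    qed (use x y in \<open>auto simp: cont_paths_def\<close>)
    then show False using ne by simp
  qed
  define p where "p w = cos (integral {0..T} (\<lambda>s. ((pi / I) *\<^sub>R z s) \<bullet> w s) + - integral {0..T} (\<lambda>s. ((pi / I) *\<^sub>R z s) \<bullet> y s))" for w :: "'n path"
  have ec: "continuous_on {0..T} (\<lambda>s. (pi / I) *\<^sub>R z s)" by (intro continuous_intros zc)
  have "trig p" by (rule cosine[OF ec, of p 1 "- integral {0..T} (\<lambda>s. ((pi / I) *\<^sub>R z s) \<bullet> y s)"]) (simp only: p_def mult_1)
  moreover have "p y = 1" by (simp add: p_def)
  moreover have "p x = -1"
  proof -
    have "integral {0..T} (\<lambda>s. ((pi / I) *\<^sub>R z s) \<bullet> x s) - integral {0..T} (\<lambda>s. ((pi / I) *\<^sub>R z s) \<bullet> y s)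
       = integral {0..T} (\<lambda>s. ((pi / I) *\<^sub>R z s) \<bullet> x s - ((pi / I) *\<^sub>R z s) \<bullet> y s)"
      by (rule Henstock_Kurzweil_Integration.integral_diff[symmetric]) (intro path_integrable ec x y)+
    also have "\<dots> = integral {0..T} (\<lambda>s. (pi / I) * (z s \<bullet> z s))"
      by (rule Henstock_Kurzweil_Integration.integral_cong) (simp add: z_def inner_diff_right algebra_simps)
    also have "\<dots> = pi / I * I" by (simp only: I_def integral_mult_right)
    finally show ?thesis using \<open>I \<noteq> 0\<close> by (simp add: p_def)
  qed
  ultimately show ?thesis by (intro exI[of _ p]) simp
qed

lemma sup_dist_commute: "sup_dist T x y = sup_dist T y x"
  by (simp add: sup_dist_def sup_norm_def norm_minus_commute)

subsection \<open>Uniform approximation on compact sets of paths\<close>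

text \<open>
  Continuous paths on \<open>[0, T]\<close>, extended by their values at the end points, become points of the
  Banach space of bounded continuous functions on the line, with the same distances.
\<close>

definition path_of :: "(real \<Rightarrow>\<^sub>C (real ^ 'n)) \<Rightarrow> ('n::finite) path" where
  "path_of f = restrict (apply_bcontfun f) {0..T}"

definition path_ext :: "('n::finite) path \<Rightarrow> (real \<Rightarrow>\<^sub>C (real ^ 'n))" where
  "path_ext x = Bcontfun (\<lambda>r. x (max 0 (min r T)))"

lemma path_of_cont: "path_of f \<in> cont_paths T"
proof -
  have "continuous_on {0..T} (apply_bcontfun f)" by (rule continuous_on_apply_bcontfun)
  then have "continuous_on {0..T} (path_of f)" unfolding path_of_def by (rule continuous_on_eq) simp
  then show ?thesis by (simp add: cont_paths_def path_of_def)
qed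

lemma path_ext_apply:
  assumes x: "x \<in> cont_paths T"
  shows "apply_bcontfun (path_ext x) r = x (max 0 (min r T))"
proof -
  have xc: "continuous_on {0..T} x" using x by (simp add: cont_paths_def)
  have "continuous_on UNIV (\<lambda>r. x (max 0 (min r T)))"
    by (rule continuous_on_compose2[OF xc]) (use T_pos in \<open>auto intro!: continuous_intros\<close>)
  moreover have "bounded (range (\<lambda>r. x (max 0 (min r T))))"
    by (rule bounded_subset[OF compact_imp_bounded[OF compact_continuous_image[OF xc compact_Icc]]]) (use T_pos in auto)
  ultimately have "(\<lambda>r. x (max 0 (min r T))) \<in> bcontfun" by (simp add: bcontfun_def)
  then show ?thesis by (simp add: path_ext_def Bcontfun_inverse)
qed

lemma path_of_ext: "x \<in> cont_paths T \<Longrightarrow> path_of (path_ext x) = x"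
  by (rule path_eqI) (auto simp: path_of_def path_ext_apply cont_paths_def min_def max_def)

lemma sup_dist_path_of: "sup_dist T (path_of f) (path_of g) \<le> dist f g"
proof (rule sup_dist_least)
  fix s assume "s \<in> {0..T}"
  then show "norm (path_of f s - path_of g s) \<le> dist f g"
    using dist_bounded[of f s g] by (simp add: path_of_def dist_norm)
qed

lemma cont_path_of:
  assumes "cont_wrt (sup_dist T) (cont_paths T) \<xi>"
  shows "continuous_on S (\<lambda>f. \<xi> (path_of f))"
  unfolding continuous_on_iff
proof (intro ballI allI impI)
  fix f and e :: real assume e: "e > 0"
  obtain d where d: "d > 0" "\<And>y. y \<in> cont_paths T \<Longrightarrow> sup_dist T (path_of f) y < d \<Longrightarrow> dist (\<xi> y) (\<xi> (path_of f)) < e"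
    using assms e path_of_cont[of f] unfolding cont_wrt_def by meson
  show "\<exists>d>0. \<forall>g\<in>S. dist g f < d \<longrightarrow> dist (\<xi> (path_of g)) (\<xi> (path_of f)) < e"
  proof (intro exI[of _ d] conjI ballI impI d(1))
    fix g assume "dist g f < d"
    then show "dist (\<xi> (path_of g)) (\<xi> (path_of f)) < e"
      using sup_dist_path_of[of f g] by (intro d(2) path_of_cont) (simp add: dist_commute)
  qed
qed

text \<open>
  The Stone-Weierstrass theorem controls the approximation on \<open>K\<close> only. Off \<open>K\<close> it is kept
  bounded by composing it with a real polynomial close to the truncation at \<open>\<plusminus>(M + 1)\<close>;
  trigonometric polynomials are bounded and stable under such compositions. The bound \<open>M + 2\<close>
  does not depend on \<open>\<epsilon>\<close>.
\<close>

lemma trig_dense: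
  fixes \<xi> :: "('n::finite) path \<Rightarrow> real"
  assumes \<xi>: "cont_wrt (sup_dist T) (cont_paths T) \<xi>" and M: "\<And>x. x \<in> cont_paths T \<Longrightarrow> \<bar>\<xi> x\<bar> \<le> M"
    and K: "K \<subseteq> cont_paths T" and \<epsilon>: "0 < \<epsilon>"
    and comp: "\<And>x. (\<And>n. x n \<in> K) \<Longrightarrow> \<exists>y\<in>K. \<exists>s. strict_mono (s :: nat \<Rightarrow> nat) \<and> (\<forall>e>0. \<exists>N. \<forall>j\<ge>N. sup_dist T (x (s j)) y < e)"
  shows "\<exists>p. trig p \<and> (\<forall>x\<in>K. \<bar>\<xi> x - p x\<bar> < \<epsilon>) \<and> (\<forall>x\<in>cont_paths T. \<bar>p x\<bar> \<le> M + 2)"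
proof -
  define \<delta> where "\<delta> = min 1 (\<epsilon> / 2)"
  have \<delta>: "0 < \<delta>" "\<delta> \<le> 1" "2 * \<delta> \<le> \<epsilon>" using \<epsilon> by (auto simp: \<delta>_def)
  define K' where "K' = path_ext ` K"
  define P where "P u \<longleftrightarrow> (\<exists>p. trig p \<and> u = (\<lambda>f. p (path_of f)))" for u :: "(real \<Rightarrow>\<^sub>C (real ^ 'n)) \<Rightarrow> real"
  have dist_ext: "dist (path_ext x) (path_ext y) \<le> sup_dist T x y" if "x \<in> cont_paths T" "y \<in> cont_paths T" for x y :: "'n path"
  proof (rule dist_bound)
    fix r
    show "dist (apply_bcontfun (path_ext x) r) (apply_bcontfun (path_ext y) r) \<le> sup_dist T x y"
      unfolding path_ext_apply[OF that(1)] path_ext_apply[OF that(2)] dist_norm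
      by (rule sup_dist_upper) (use that cont_cadlag T_pos in auto)
  qed
  have cpt: "compact K'"
    unfolding compact_eq_seq_compact_metric seq_compact_def
  proof (intro allI impI)
    fix f assume "\<forall>n::nat. f n \<in> K'"
    then have "\<forall>n. \<exists>x. x \<in> K \<and> f n = path_ext x" by (auto simp: K'_def)
    then obtain x where x: "\<And>n. x n \<in> K" "\<And>n. f n = path_ext (x n)" by metis
    obtain y s where y: "y \<in> K" and s: "strict_mono (s :: nat \<Rightarrow> nat)"
      and c: "\<forall>e>0. \<exists>N. \<forall>j\<ge>N. sup_dist T (x (s j)) y < e" using comp[of x, OF x(1)] by blast
    have "(f \<circ> s) \<longlonglongrightarrow> path_ext y"
      unfolding lim_sequentially
    proof (intro allI impI)
      fix e :: real assume "e > 0"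
      then obtain N where N: "\<And>j. j \<ge> N \<Longrightarrow> sup_dist T (x (s j)) y < e" using c by blast
      show "\<exists>N. \<forall>n\<ge>N. dist ((f \<circ> s) n) (path_ext y) < e"
      proof (intro exI[of _ N] allI impI)
        fix n assume "N \<le> n"
        then show "dist ((f \<circ> s) n) (path_ext y) < e"
          using N[of n] dist_ext[OF subsetD[OF K x(1)[of "s n"]] subsetD[OF K y]] by (simp add: x(2))
      qed
    qed
    then show "\<exists>l\<in>K'. \<exists>r. strict_mono r \<and> (f \<circ> r) \<longlonglongrightarrow> l"
      using y s by (intro bexI[of _ "path_ext y"] exI[of _ s]) (auto simp: K'_def)
  qed
  have const: "P (\<lambda>_. c)" for c unfolding P_def by (intro exI[of _ "\<lambda>_. c"]) (simp add: trig_const)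
  have cont: "continuous_on K' u" if Pu: "P u" for u
  proof -
    obtain p where "trig p" "u = (\<lambda>f. p (path_of f))" using Pu unfolding P_def by blast
    then show ?thesis using cont_path_of[OF trig_cont[of p]] by simp
  qed
  have add: "P (\<lambda>f. u f + w f)" if uw: "P u \<and> P w" for u w
  proof -
    obtain p q where "trig p" "u = (\<lambda>f. p (path_of f))" "trig q" "w = (\<lambda>f. q (path_of f))" using uw unfolding P_def by blast
    then show ?thesis unfolding P_def by (intro exI[of _ "\<lambda>x. p x + q x"]) (simp add: trig.add[of p q])
  qed
  have mult: "P (\<lambda>f. u f * w f)" if uw: "P u \<and> P w" for u w
  proof -
    obtain p q where "trig p" "u = (\<lambda>f. p (path_of f))" "trig q" "w = (\<lambda>f. q (path_of f))" using uw unfolding P_def by blast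
    then show ?thesis unfolding P_def by (intro exI[of _ "\<lambda>x. p x * q x"]) (simp add: trig_mult)
  qed
  have sep: "\<exists>u. P u \<and> u f \<noteq> u g" if fg: "f \<in> K' \<and> g \<in> K' \<and> f \<noteq> g" for f g
  proof -
    obtain x y where xy: "x \<in> K" "f = path_ext x" "y \<in> K" "g = path_ext y" using fg by (auto simp: K'_def)
    then have "x \<noteq> y" using fg by auto
    then obtain p where "trig p" "p x \<noteq> p y" using trig_separates[of x y] xy K by auto
    then have "trig p" "p (path_of f) \<noteq> p (path_of g)"
      using path_of_ext[OF subsetD[OF K xy(1)]] path_of_ext[OF subsetD[OF K xy(3)]] by (simp_all add: xy(2,4))
    then show ?thesis unfolding P_def by (intro exI[of _ "\<lambda>f. p (path_of f)"] conjI exI[of _ p]) simp_all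
  qed
  have target: "continuous_on K' (\<lambda>f. \<xi> (path_of f))" by (rule cont_path_of[OF \<xi>])
  have "\<exists>u. P u \<and> (\<forall>f\<in>K'. \<bar>\<xi> (path_of f) - u f\<bar> < \<delta>)"
    by (rule Stone_Weierstrass_HOL[where P = P, OF cpt const cont add mult sep target \<delta>(1)])
  then obtain p0 where p0: "trig p0" "\<And>f. f \<in> K' \<Longrightarrow> \<bar>\<xi> (path_of f) - p0 (path_of f)\<bar> < \<delta>" unfolding P_def by blast
  have p0K: "\<bar>\<xi> x - p0 x\<bar> < \<delta>" if "x \<in> K" for x
    using p0(2)[of "path_ext x"] that K path_of_ext[of x] by (auto simp: K'_def)
  obtain v a b c B where v: "smooth v a b c" "\<forall>q\<in>Lambda T. a q + 1 / 2 * trace (c q) = 0 \<and> \<bar>v q\<bar> \<le> B" "\<forall>x\<in>cont_paths T. v (T, x) = p0 x"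
    using trig_heat_solution[OF p0(1)] by blast
  have B: "\<bar>p0 x\<bar> \<le> B" if "x \<in> cont_paths T" for x
  proof -
    have "(T, x) \<in> Lambda T" using that T_pos by (simp add: Lambda_def)
    then show ?thesis using v(2,3) that by fastforce
  qed
  define L where "L = M + 1"
  define clip where "clip s = max (- L) (min s L)" for s :: real
  have "continuous_on {- B..B} clip" unfolding clip_def by (intro continuous_intros)
  then obtain g where g: "real_polynomial_function g" "\<And>s. s \<in> {- B..B} \<Longrightarrow> \<bar>clip s - g s\<bar> < \<delta>"
    using Stone_Weierstrass_real_polynomial_function[of "{- B..B}" clip \<delta>] \<delta>(1) by auto
  have M0: "0 \<le> M"
  proof -
    have "path_of 0 \<in> (cont_paths T :: 'n path set)" by (rule path_of_cont)
    from M[OF this] show ?thesis by linarith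
  qed
  have "trig (\<lambda>x. g (p0 x))" by (rule trig_polynomial[OF g(1) p0(1)])
  moreover have "\<bar>\<xi> x - g (p0 x)\<bar> < \<epsilon>" if x: "x \<in> K" for x
  proof -
    have xc: "x \<in> cont_paths T" using x K by auto
    have "\<bar>p0 x\<bar> \<le> L" using p0K[OF x] M[OF xc] \<delta>(2) by (simp add: L_def)
    then have "clip (p0 x) = p0 x" by (auto simp: clip_def abs_le_iff)
    moreover have "p0 x \<in> {- B..B}" using B[OF xc] by (auto simp: abs_le_iff)
    ultimately have "\<bar>p0 x - g (p0 x)\<bar> < \<delta>" using g(2) by metis
    then show ?thesis using p0K[OF x] \<delta>(3) by linarith
  qed
  moreover have "\<bar>g (p0 x)\<bar> \<le> M + 2" if x: "x \<in> cont_paths T" for x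
  proof -
    have "p0 x \<in> {- B..B}" using B[OF x] by (auto simp: abs_le_iff)
    then have "\<bar>clip (p0 x) - g (p0 x)\<bar> < \<delta>" by (rule g(2))
    moreover have "\<bar>clip (p0 x)\<bar> \<le> L" using M0 by (auto simp: clip_def L_def abs_le_iff)
    ultimately show ?thesis using \<delta>(2) by (simp add: L_def)
  qed
  ultimately show ?thesis by (intro exI[of _ "\<lambda>x. g (p0 x)"]) simp
qed

section \<open>Comparison with the heat solutions\<close>

text \<open>
  Running maxima are Lipschitz in the path, so the constraints pass to the limit: sequences that
  satisfy more and more of them accumulate at terminal paths that satisfy all.
\<close>

lemma windows_limit:
  fixes x :: "nat \<Rightarrow> ('n::finite) path" and v :: "real ^ 'n"
  assumes x: "\<And>j. x j \<in> cont_paths T" and h: "\<And>k. 0 < h k"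
    and small: "\<And>k j i. k < j \<Longrightarrow> i < wnum (h k) \<Longrightarrow> wmax (h k) v i (T, x j) \<le> (1 / 2) ^ k"
  shows "\<exists>y\<in>cont_paths T. (\<forall>k. \<forall>i<wnum (h k). wmax (h k) v i (T, y) \<le> (1 / 2) ^ k) \<and>
    (\<exists>s. strict_mono (s :: nat \<Rightarrow> nat) \<and> (\<forall>e>0. \<exists>N. \<forall>j\<ge>N. sup_dist T (x (s j)) y < e))"
proof -
  have xL: "(T, x j) \<in> Lambda T" for j using x T_pos by (simp add: Lambda_def)
  obtain q and s :: "nat \<Rightarrow> nat" where q: "q \<in> Lambda T" and s: "strict_mono s"
    and conv: "\<And>e. e > 0 \<Longrightarrow> \<exists>N. \<forall>j\<ge>N. d_inf T q (T, x (s j)) < e"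
    by (rule windows_compact[where t = "\<lambda>j. T" and x = x and h = h and v = "\<lambda>k. v", OF xL h small]) blast+
  have qh: "q \<in> Lambda_hat T" and xh: "(T, x j) \<in> Lambda_hat T" for j using q xL Lambda_subset by auto
  obtain y where qy: "q = (T, y)" and y: "y \<in> cont_paths T"
  proof -
    have "\<bar>fst q - T\<bar> \<le> 0 + e" if e: "e > 0" for e
    proof -
      obtain N where "d_inf T q (T, x (s N)) < e" using conv[OF e] by blast
      then show ?thesis using d_inf_ge_time[of "fst q" "snd q" T "x (s N)"] qh xh by simp
    qed
    then have "\<bar>fst q - T\<bar> \<le> 0" by (rule field_le_epsilon)
    then have "q = (T, snd q)" by (simp add: prod_eq_iff)
    moreover have "snd q \<in> cont_paths T" using q by (auto simp: Lambda_def)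
    ultimately show thesis by (rule that)
  qed
  have "wmax (h k) v i (T, y) \<le> (1 / 2) ^ k" if i: "i < wnum (h k)" for k i
  proof (rule field_le_epsilon)
    fix e :: real assume e: "0 < e"
    obtain C where C: "C \<ge> 0" "\<And>p p'. p \<in> Lambda_hat T \<Longrightarrow> p' \<in> Lambda_hat T \<Longrightarrow> \<bar>wmax (h k) v i p' - wmax (h k) v i p\<bar> \<le> C * d_inf T p p'"
      using pos_lipschitz[OF primitive_window[of "h k" i], of "woff v i"] by blast
    obtain N where N: "\<And>j. j \<ge> N \<Longrightarrow> d_inf T q (T, x (s j)) < e / (C + 1)" using conv[of "e / (C + 1)"] e C(1) by auto
    define j where "j = max N (Suc k)"
    have "C * d_inf T q (T, x (s j)) \<le> C * (e / (C + 1))"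
      using C(1) N[of j] by (intro mult_left_mono) (auto simp: j_def)
    also have "\<dots> \<le> e" using C(1) e by (simp add: field_simps)
    finally have "\<bar>wmax (h k) v i (T, x (s j)) - wmax (h k) v i q\<bar> \<le> e" using C(2)[OF qh xh[of "s j"]] by linarith
    moreover have "k < s j" using seq_suble[OF s, of j] by (simp add: j_def)
    then have "wmax (h k) v i (T, x (s j)) \<le> (1 / 2) ^ k" using i by (intro small)
    ultimately show "wmax (h k) v i (T, y) \<le> (1 / 2) ^ k + e" unfolding qy by linarith
  qed
  moreover have "\<forall>e>0. \<exists>N. \<forall>j\<ge>N. sup_dist T (x (s j)) y < e"
    using conv unfolding qy d_inf_terminal[OF y x] sup_dist_commute[of y] by blast
  ultimately show ?thesis using y s by blast
qed

text \<open>
  The function \<open>v + \<epsilon> + (2 M + 2) \<Sum> Z j\<close> dominates \<open>\<xi>\<close> at time \<open>T\<close>: where all barriers are below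
  \<open>1\<close>, because \<open>v\<close> is close to \<open>\<xi>\<close> there, and elsewhere because \<open>- (M + 2) + (2 M + 2) = M\<close>. The
  barriers are supersolutions only from shortly before \<open>t0\<close> on. At earlier times the multiple
  \<open>k\<close> of the square of the positive part of \<open>t0 - t\<close> lifts the function above the upper bound of
  \<open>u\<close>, so that nothing has to be verified there; \<open>k\<close> vanishes from \<open>t0\<close> on.
\<close>

lemma subsolution_le_heat_solution:
  fixes u :: "real \<times> ('n::finite) path \<Rightarrow> real" and h :: "nat \<Rightarrow> real"
  assumes sub: "viscosity_subsolution T \<xi> u" and uM: "\<And>p. p \<in> Lambda T \<Longrightarrow> u p \<le> M"
    and \<xi>M: "\<And>x. x \<in> cont_paths T \<Longrightarrow> \<xi> x \<le> M" and M: "0 \<le> M"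
    and v: "smooth v a b c" "\<And>q. q \<in> Lambda T \<Longrightarrow> a q + 1 / 2 * trace (c q) = 0 \<and> \<bar>v q\<bar> \<le> B"
    and vM: "\<And>x. x \<in> cont_paths T \<Longrightarrow> - (M + 2) \<le> v (T, x)"
    and h: "\<And>j. j < N \<Longrightarrow> 0 < h j"
    and Z: "\<And>j. j < N \<Longrightarrow> smooth (Z j) (za j) (zb j) (zc j)"
    and Z0: "\<And>j p. j < N \<Longrightarrow> p \<in> Lambda T \<Longrightarrow> 0 \<le> Z j p"
    and Zl: "\<And>j p. j < N \<Longrightarrow> p \<in> Lambda T \<Longrightarrow> t0 - h j \<le> fst p \<Longrightarrow> za j p + 1 / 2 * trace (zc j p) \<le> 0"
    and near: "\<And>x. x \<in> cont_paths T \<Longrightarrow> (\<And>j. j < N \<Longrightarrow> Z j (T, x) < 1) \<Longrightarrow> \<xi> x \<le> v (T, x) + \<epsilon>" and \<epsilon>: "0 \<le> \<epsilon>"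
    and p0: "(t0, x0) \<in> Lambda T"
  shows "u (t0, x0) \<le> v (t0, x0) + \<epsilon> + (2 * M + 2) * (\<Sum>j<N. Z j (t0, x0))"
proof -
  (* Inserting 1 covers the case of no barriers. *)
  define H where "H = Min (insert 1 (h ` {..<N}))"
  have "\<forall>y\<in>insert 1 (h ` {..<N}). 0 < y" using h by auto
  then have H: "0 < H" unfolding H_def by (subst Min_gr_iff) simp_all
  have Hh: "H \<le> h j" if "j < N" for j unfolding H_def using that by (intro Min_le) auto
  have B: "0 \<le> B" using v(2)[OF p0] by linarith
  define L where "L = (M + B) / H\<^sup>2"
  have L: "0 \<le> L" using M B H by (simp add: L_def)
  define k where "k t = L * (max 0 (t0 - t))\<^sup>2" for t
  define k' where "k' t = - 2 * L * max 0 (t0 - t)" for t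
  have kd: "(k has_real_derivative k' t) (at t within {0..T})" for t
  proof -
    have D: "((\<lambda>t. t0 - t) has_real_derivative - 1) (at t)" by (auto intro!: derivative_eq_intros)
    have D2: "((\<lambda>t. (max 0 (t0 - t))\<^sup>2) has_real_derivative 2 * (max 0 (t0 - t)) * (- 1)) (at t)"
      using DERIV_chain2[OF DERIV_pos_part_power[of 0] D] by (simp add: eval_nat_numeral)
    have "L * (2 * max 0 (t0 - t) * - 1) = k' t" by (simp add: k'_def)
    with DERIV_cmult[OF D2, of L] have "(k has_real_derivative k' t) (at t)" by (simp only: k_def[abs_def])
    then show ?thesis by (rule has_field_derivative_at_within)
  qed
  have k'c: "continuous_on {0..T} k'" unfolding k'_def[abs_def] by (intro continuous_intros)
  have k0: "0 \<le> k t" "k' t \<le> 0" for t using L by (auto simp: k_def k'_def)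
  note S = smooth_add[OF smooth_add[OF smooth_add[OF v(1) smooth_time[OF kd k'c]] smooth_const[of \<epsilon>]]
      smooth_scale[OF smooth_sum[of "{..<N}" Z za zb zc, OF finite_lessThan], of "2 * M + 2"]]
  let ?phi = "\<lambda>p. v p + k (fst p) + \<epsilon> + (2 * M + 2) * (\<Sum>j<N. Z j p)"
  have sm: "smooth ?phi (\<lambda>p. a p + k' (fst p) + 0 + (2 * M + 2) * (\<Sum>j<N. za j p))
     (\<lambda>p. b p + 0 + 0 + (2 * M + 2) *\<^sub>R (\<Sum>j<N. zb j p)) (\<lambda>p. c p + 0 + 0 + (2 * M + 2) *\<^sub>R (\<Sum>j<N. zc j p))"
    by (rule S) (simp add: Z)
  have Zs: "0 \<le> (\<Sum>j<N. Z j p)" if "p \<in> Lambda T" for p using Z0 that by (intro sum_nonneg) auto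
  have Zs': "0 \<le> (2 * M + 2) * (\<Sum>j<N. Z j p)" if "p \<in> Lambda T" for p using Zs[OF that] M by simp
  have "u (t0, x0) \<le> ?phi (t0, x0)"
  proof (rule comparison_smooth[OF sub uM sm _ _ _ p0, where m = "- B"])
    fix p :: "real \<times> 'n path" assume p: "p \<in> Lambda T"
    show "- B \<le> ?phi p" using v(2)[OF p] k0(1)[of "fst p"] \<epsilon> Zs'[OF p] by linarith
  next
    fix x :: "'n path" assume x: "x \<in> cont_paths T"
    then have xL: "(T, x) \<in> Lambda T" using T_pos by (simp add: Lambda_def)
    show "\<xi> x \<le> ?phi (T, x)"
    proof (cases "\<forall>j<N. Z j (T, x) < 1")
      case True
      then have "\<xi> x \<le> v (T, x) + \<epsilon>" using near[OF x] by blast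
      then show ?thesis using k0(1)[of "fst (T, x)"] Zs'[OF xL] by linarith
    next
      case False
      then obtain j where j: "j < N" "1 \<le> Z j (T, x)" by (auto simp: not_less)
      have "Z j (T, x) \<le> (\<Sum>j<N. Z j (T, x))" using j(1) Z0[OF _ xL] by (intro member_le_sum) auto
      then have big: "2 * M + 2 \<le> (2 * M + 2) * (\<Sum>j<N. Z j (T, x))" using j(2) M mult_left_mono[of 1 "\<Sum>j<N. Z j (T, x)" "2 * M + 2"] by simp
      have "\<xi> x \<le> v (T, x) + k (fst (T, x)) + \<epsilon> + (2 * M + 2)" using k0(1)[of "fst (T, x)"] \<epsilon> vM[OF x] \<xi>M[OF x] by linarith
      then show ?thesis by (rule order_trans[OF _ add_left_mono[OF big]])
    qed
  next
    fix p :: "real \<times> 'n path" assume p: "p \<in> Lambda T" and up: "?phi p < u p"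
    have t: "t0 - H \<le> fst p"
    proof (rule ccontr)
      assume "\<not> t0 - H \<le> fst p"
      then have "H\<^sup>2 \<le> (max 0 (t0 - fst p))\<^sup>2" using H by (intro power_mono) auto
      then have "L * H\<^sup>2 \<le> k (fst p)" unfolding k_def using L by (intro mult_left_mono)
      then have "M + B \<le> k (fst p)" using H by (simp add: L_def)
      then show False using up uM[OF p] v(2)[OF p] Zs'[OF p] \<epsilon> by linarith
    qed
    have "za j p + 1 / 2 * trace (zc j p) \<le> 0" if j: "j < N" for j
      by (rule Zl[OF j p]) (use Hh[OF j] t in linarith)
    then have "(\<Sum>j<N. za j p + 1 / 2 * trace (zc j p)) \<le> 0" by (intro sum_nonpos) simp
    then have 1: "(2 * M + 2) * (\<Sum>j<N. za j p + 1 / 2 * trace (zc j p)) \<le> 0" using M by (intro mult_nonneg_nonpos) auto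
    have ts: "trace (\<Sum>j<N. zc j p) = (\<Sum>j<N. trace (zc j p))"
      unfolding trace_def sum_component by (rule sum.swap)
    have tadd: "trace (C + D) = trace C + trace D" and tscale: "trace (r *\<^sub>R C) = r * trace C" for C D :: "real ^ 'n ^ 'n" and r
      by (simp_all add: trace_def sum.distrib sum_distrib_left)
    have "trace (c p + 0 + 0 + (2 * M + 2) *\<^sub>R (\<Sum>j<N. zc j p)) = trace (c p) + (2 * M + 2) * (\<Sum>j<N. trace (zc j p))"
      by (simp only: add_0_right tadd tscale ts)
    moreover have "(\<Sum>j<N. za j p + 1 / 2 * trace (zc j p)) = (\<Sum>j<N. za j p) + 1 / 2 * (\<Sum>j<N. trace (zc j p))"
      by (simp only: sum.distrib sum_distrib_left)
    then have "(2 * M + 2) * (\<Sum>j<N. za j p + 1 / 2 * trace (zc j p)) =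
        (2 * M + 2) * (\<Sum>j<N. za j p) + 1 / 2 * ((2 * M + 2) * (\<Sum>j<N. trace (zc j p)))"
      by (simp only: distrib_left mult.left_commute)
    ultimately show "a p + k' (fst p) + 0 + (2 * M + 2) * (\<Sum>j<N. za j p) +
       1 / 2 * trace (c p + 0 + 0 + (2 * M + 2) *\<^sub>R (\<Sum>j<N. zc j p)) \<le> 0"
      using v(2)[OF p] k0(2)[of "fst p"] 1 by linarith
  qed
  then show ?thesis by (simp add: k_def)
qed

subsection \<open>Reflection\<close>

lemma C12_pol_uminus:
  assumes "C12_pol T \<phi> a b c"
  shows "C12_pol T (\<lambda>p. - \<phi> p) (\<lambda>p. - a p) (\<lambda>p. - b p) (\<lambda>p. - c p)"
proof -
  have H: "C12_hat T (\<lambda>p. - f p) (\<lambda>p. - a p) (\<lambda>p. - b p) (\<lambda>p. - c p)" if h: "C12_hat T f a b c"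
    for f a :: "real \<times> 'a path \<Rightarrow> real" and b c
  proof (rule C12_hatI)
    fix x :: "'a path" and t assume x: "x \<in> cadlag_paths T" "t \<in> {0..<T}"
    have "(\<lambda>\<delta>. (- f (t + \<delta>, stopped T t x) - - f (t, x)) / \<delta>) = (\<lambda>\<delta>. - ((f (t + \<delta>, stopped T t x) - f (t, x)) / \<delta>))"
      by (rule ext) (simp add: minus_divide_left)
    then show "((\<lambda>\<delta>. (- f (t + \<delta>, stopped T t x) - - f (t, x)) / \<delta>) \<longlongrightarrow> - a (t, x)) (at_right 0)"
      using tendsto_minus[OF C12_hatD(1)[OF h x]] by simp
  next
    fix t x i j assume tx: "(t, x :: 'a path) \<in> Lambda_hat T"
    show "((\<lambda>h. - f (t, bumped T t (h *\<^sub>R axis i 1) x)) has_real_derivative (- b (t, x)) $ i) (at 0)"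
      using DERIV_minus[OF C12_hatD(3)[OF h tx, of i]] by simp
    show "((\<lambda>h. (- b (t, bumped T t (h *\<^sub>R axis j 1) x)) $ i) has_real_derivative (- c (t, x)) $ i $ j) (at 0)"
      using DERIV_minus[OF C12_hatD(4)[OF h tx, of j i]] by simp
  qed (intro tendsto_minus C12_hatD[OF h], assumption+)+
  obtain f' a' b' c' where h: "C12_hat T f' a' b' c'"
    and e: "\<forall>p\<in>Lambda T. f' p = \<phi> p \<and> a' p = a p \<and> b' p = b p \<and> c' p = c p"
    using assms unfolding C12_pol_def C12_def by blast
  have "C12 T (\<lambda>p. - \<phi> p) (\<lambda>p. - a p) (\<lambda>p. - b p) (\<lambda>p. - c p)"
    unfolding C12_def
    by (rule exI[of _ "\<lambda>p. - f' p"], rule exI[of _ "\<lambda>p. - a' p"], rule exI[of _ "\<lambda>p. - b' p"], rule exI[of _ "\<lambda>p. - c' p"])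
       (use H[OF h] e in simp)
  then show ?thesis using assms by (simp add: C12_pol_def poly_growth_def)
qed

lemma supersolution_uminus:
  assumes "viscosity_supersolution T \<xi> w"
  shows "viscosity_subsolution T (\<lambda>x. - \<xi> x) (\<lambda>p. - w p)"
proof -
  have l: "lsc_wrt (d_inf T) (Lambda T) w" and t: "\<forall>x\<in>cont_paths T. w (T, x) \<ge> \<xi> x"
    and s: "\<And>t x \<phi> a b c. t \<in> {0..<T} \<Longrightarrow> x \<in> cont_paths T \<Longrightarrow> C12_pol T \<phi> a b c \<Longrightarrow>
        ereal (w (t, x) - \<phi> (t, x)) = (INF p\<in>Lambda T. ereal (w p - \<phi> p)) \<Longrightarrow> - a (t, x) - 1 / 2 * trace (c (t, x)) \<ge> 0"
    using assms unfolding viscosity_supersolution_def by blast+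
  have usc: "usc_wrt (d_inf T) (Lambda T) (\<lambda>p. - w p)"
    unfolding usc_wrt_def
  proof (intro ballI allI impI)
    fix p :: "real \<times> 'a path" and e :: real assume "p \<in> Lambda T" "e > 0"
    then obtain d where d: "d > 0" "\<forall>q\<in>Lambda T. d_inf T p q < d \<longrightarrow> w q > w p - e"
      using l unfolding lsc_wrt_def by blast
    then show "\<exists>\<delta>>0. \<forall>q\<in>Lambda T. d_inf T p q < \<delta> \<longrightarrow> - w q < - w p + e"
      by (intro exI[of _ d]) auto
  qed
  have ineq: "- a (t, x) - 1 / 2 * trace (c (t, x)) \<le> 0"
    if tx: "t \<in> {0..<T}" "x \<in> cont_paths T" and p: "C12_pol T \<phi> a b c"
      and m: "ereal (- w (t, x) - \<phi> (t, x)) = (SUP p\<in>Lambda T. ereal (- w p - \<phi> p))" for t x \<phi> a b c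
  proof -
    have "(INF p\<in>Lambda T. ereal (w p - - \<phi> p)) = (INF p\<in>Lambda T. - ereal (- w p - \<phi> p))" by (simp add: add.commute)
    also have "\<dots> = - (SUP p\<in>Lambda T. ereal (- w p - \<phi> p))" by (rule ereal_INF_uminus_eq)
    also have "\<dots> = ereal (w (t, x) - - \<phi> (t, x))" by (simp flip: m)
    finally have "0 \<le> - (- a (t, x)) - 1 / 2 * trace (- c (t, x))"
      by (intro s[OF tx C12_pol_uminus[OF p]]) simp
    moreover have "trace (- c (t, x)) = - trace (c (t, x))" by (simp add: trace_def sum_negf)
    ultimately show ?thesis by simp
  qed
  show ?thesis
    unfolding viscosity_subsolution_def
  proof (intro conjI ballI allI impI usc)
    show "- w (T, x) \<le> - \<xi> x" if "x \<in> cont_paths T" for x using t that by simp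
  qed (rule ineq)
qed

text \<open>
  Barriers \<open>Z j\<close> at scales \<open>h j\<close>, with allowed oscillation \<open>2 ^ (- j)\<close> and size at most
  \<open>\<epsilon> 2 ^ (- j - 1)\<close> at the given point, define a compact set \<open>K\<close> of terminal paths. One smooth
  solution whose terminal value is close to \<open>\<xi>\<close> on \<open>K\<close> then lies between \<open>u\<close> and \<open>w\<close> at the
  given point, up to a multiple of \<open>\<epsilon>\<close>.
\<close>

lemma subsolution_le_supersolution:
  fixes \<xi> :: "('n::finite) path \<Rightarrow> real" and u w :: "real \<times> 'n path \<Rightarrow> real"
  assumes \<xi>: "cont_wrt (sup_dist T) (cont_paths T) \<xi>" and \<xi>b: "bounded (\<xi> ` cont_paths T)"
    and ub: "bdd_above (u ` Lambda T)" and wb: "bdd_below (w ` Lambda T)"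
    and sub: "viscosity_subsolution T \<xi> u" and sup: "viscosity_supersolution T \<xi> w"
    and p0: "(t0, x0) \<in> Lambda T"
  shows "u (t0, x0) \<le> w (t0, x0)"
proof -
  obtain M1 where M1: "\<And>x. x \<in> cont_paths T \<Longrightarrow> \<bar>\<xi> x\<bar> \<le> M1" using \<xi>b by (auto simp: bounded_iff)
  obtain M2 where M2: "\<And>p. p \<in> Lambda T \<Longrightarrow> u p \<le> M2" using ub unfolding bdd_above_def by blast
  obtain M3 where M3: "\<And>p. p \<in> Lambda T \<Longrightarrow> M3 \<le> w p" using wb unfolding bdd_below_def by blast
  define M where "M = \<bar>M1\<bar> + \<bar>M2\<bar> + \<bar>M3\<bar>"
  have M: "0 \<le> M" by (simp add: M_def)
  have \<xi>M: "\<bar>\<xi> x\<bar> \<le> M" if "x \<in> cont_paths T" for x using M1[OF that] by (simp add: M_def)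
  have uM: "u p \<le> M" if "p \<in> Lambda T" for p :: "real \<times> 'n path" using M2[OF that] unfolding M_def by linarith
  have wM: "- w p \<le> M" if "p \<in> Lambda T" for p :: "real \<times> 'n path" using M3[OF that] unfolding M_def by linarith
  have main: "u (t0, x0) - w (t0, x0) \<le> (4 * M + 6) * \<epsilon>" if \<epsilon>: "0 < \<epsilon>" for \<epsilon>
  proof -
    have "\<forall>j. \<exists>z. 0 < fst z \<and> smooth (fst (snd z)) (fst (snd (snd z))) (fst (snd (snd (snd z)))) (snd (snd (snd (snd z)))) \<and>
      (\<forall>p\<in>Lambda T. 0 \<le> fst (snd z) p \<and> (t0 - fst z \<le> fst p \<longrightarrow> fst (snd (snd z)) p + 1 / 2 * trace (snd (snd (snd (snd z))) p) \<le> 0) \<and>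
         (fst (snd z) p < 1 \<longrightarrow> (\<forall>i<wnum (fst z). wmax (fst z) (x0 0) i p \<le> (1 / 2) ^ j))) \<and>
      fst (snd z) (t0, x0) \<le> \<epsilon> * (1 / 2) ^ Suc j"
    proof
      fix j :: nat
      have "0 < (1 / 2 :: real) ^ j" "(1 / 2 :: real) ^ j \<le> 1" "0 < \<epsilon> * (1 / 2) ^ Suc j" using \<epsilon> by (auto intro: power_le_one)
      from barrier_scale[OF p0 this]
      obtain h Z a b c where "0 < h" "smooth Z a b c"
        "\<forall>p\<in>Lambda T. 0 \<le> Z p \<and> (t0 - h \<le> fst p \<longrightarrow> a p + 1 / 2 * trace (c p) \<le> 0) \<and>
         (Z p < 1 \<longrightarrow> (\<forall>i<wnum h. wmax h (x0 0) i p \<le> (1 / 2) ^ j))"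
        "Z (t0, x0) \<le> \<epsilon> * (1 / 2) ^ Suc j" by blast
      then show "\<exists>z. 0 < fst z \<and> smooth (fst (snd z)) (fst (snd (snd z))) (fst (snd (snd (snd z)))) (snd (snd (snd (snd z)))) \<and>
        (\<forall>p\<in>Lambda T. 0 \<le> fst (snd z) p \<and> (t0 - fst z \<le> fst p \<longrightarrow> fst (snd (snd z)) p + 1 / 2 * trace (snd (snd (snd (snd z))) p) \<le> 0) \<and>
           (fst (snd z) p < 1 \<longrightarrow> (\<forall>i<wnum (fst z). wmax (fst z) (x0 0) i p \<le> (1 / 2) ^ j))) \<and>
        fst (snd z) (t0, x0) \<le> \<epsilon> * (1 / 2) ^ Suc j"
        by (intro exI[of _ "(h, Z, a, b, c)"]) simp
    qed
    then obtain z where z: "\<forall>j. 0 < fst (z j) \<and> smooth (fst (snd (z j))) (fst (snd (snd (z j)))) (fst (snd (snd (snd (z j))))) (snd (snd (snd (snd (z j))))) \<and>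
      (\<forall>p\<in>Lambda T. 0 \<le> fst (snd (z j)) p \<and> (t0 - fst (z j) \<le> fst p \<longrightarrow> fst (snd (snd (z j))) p + 1 / 2 * trace (snd (snd (snd (snd (z j)))) p) \<le> 0) \<and>
         (fst (snd (z j)) p < 1 \<longrightarrow> (\<forall>i<wnum (fst (z j)). wmax (fst (z j)) (x0 0) i p \<le> (1 / 2) ^ j))) \<and>
      fst (snd (z j)) (t0, x0) \<le> \<epsilon> * (1 / 2) ^ Suc j"
      by (rule choice[THEN exE])
    define h where "h j = fst (z j)" for j
    define Z where "Z j = fst (snd (z j))" for j
    define za where "za j = fst (snd (snd (z j)))" for j
    define zb where "zb j = fst (snd (snd (snd (z j))))" for j
    define zc where "zc j = snd (snd (snd (snd (z j))))" for j
    note z' = z[folded h_def Z_def za_def zb_def zc_def]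
    have h: "0 < h j" and ZS: "smooth (Z j) (za j) (zb j) (zc j)" and Zd: "Z j (t0, x0) \<le> \<epsilon> * (1 / 2) ^ Suc j" for j
      using z' by blast+
    have Z0: "0 \<le> Z j p" and Zl: "t0 - h j \<le> fst p \<Longrightarrow> za j p + 1 / 2 * trace (zc j p) \<le> 0"
      and Z1: "Z j p < 1 \<Longrightarrow> i < wnum (h j) \<Longrightarrow> wmax (h j) (x0 0) i p \<le> (1 / 2) ^ j" if "p \<in> Lambda T" for j i and p :: "real \<times> 'n path"
      using z' that by blast+
    have Zsum: "(\<Sum>j<N. Z j (t0, x0)) \<le> \<epsilon>" for N
    proof -
      have "(\<Sum>j<N. Z j (t0, x0)) \<le> (\<Sum>j<N. \<epsilon> * (1 / 2) ^ Suc j)" by (intro sum_mono Zd)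
      also have "\<dots> = \<epsilon> * (1 - (1 / 2) ^ N)" by (induction N) (simp_all add: algebra_simps)
      also have "\<dots> \<le> \<epsilon> * 1" using \<epsilon> by (intro mult_left_mono) auto
      finally show ?thesis by simp
    qed
    define K where "K = {x \<in> cont_paths T. \<forall>k. \<forall>i<wnum (h k). wmax (h k) (x0 0) i (T, x) \<le> (1 / 2) ^ k}"
    have Kc: "K \<subseteq> cont_paths T" by (auto simp: K_def)
    have comp: "\<exists>y\<in>K. \<exists>s. strict_mono (s :: nat \<Rightarrow> nat) \<and> (\<forall>e>0. \<exists>N. \<forall>j\<ge>N. sup_dist T (x (s j)) y < e)"
      if x: "\<And>n. x n \<in> K" for x
      using windows_limit[of x h "x0 0"] x h unfolding K_def by blast
    obtain p where p: "trig p" "\<And>x. x \<in> K \<Longrightarrow> \<bar>\<xi> x - p x\<bar> < \<epsilon>" "\<And>x. x \<in> cont_paths T \<Longrightarrow> \<bar>p x\<bar> \<le> M + 2"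
      using trig_dense[OF \<xi> \<xi>M Kc \<epsilon> comp] by blast
    have pc: "cont_wrt (sup_dist T) (cont_paths T) p" by (rule trig_cont[OF p(1)])
    (* By compactness, finitely many of the constraints that define K already suffice. *)
    have "\<exists>N. \<forall>x\<in>cont_paths T. (\<forall>k<N. \<forall>i<wnum (h k). wmax (h k) (x0 0) i (T, x) \<le> (1 / 2) ^ k) \<longrightarrow> \<bar>\<xi> x - p x\<bar> \<le> \<epsilon>"
    proof (rule ccontr)
      assume "\<not> ?thesis"
      then have "\<forall>N. \<exists>x. x \<in> cont_paths T \<and> (\<forall>k<N. \<forall>i<wnum (h k). wmax (h k) (x0 0) i (T, x) \<le> (1 / 2) ^ k) \<and> \<epsilon> < \<bar>\<xi> x - p x\<bar>"
        by (meson not_le)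
      then obtain x where x: "\<forall>N. x N \<in> cont_paths T \<and> (\<forall>k<N. \<forall>i<wnum (h k). wmax (h k) (x0 0) i (T, x N) \<le> (1 / 2) ^ k) \<and> \<epsilon> < \<bar>\<xi> (x N) - p (x N)\<bar>"
        by (rule choice[THEN exE])
      have xc: "x N \<in> cont_paths T" for N using x by blast
      obtain y s where y: "y \<in> cont_paths T" "\<forall>k. \<forall>i<wnum (h k). wmax (h k) (x0 0) i (T, y) \<le> (1 / 2) ^ k"
        and s: "strict_mono (s :: nat \<Rightarrow> nat)" and c: "\<forall>e>0. \<exists>N. \<forall>j\<ge>N. sup_dist T (x (s j)) y < e"
        using windows_limit[of x h "x0 0"] x h by blast
      have "y \<in> K" using y by (simp add: K_def)
      then have g: "0 < (\<epsilon> - \<bar>\<xi> y - p y\<bar>) / 2" using p(2) by simp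
      obtain d1 where d1: "d1 > 0" "\<And>q. q \<in> cont_paths T \<Longrightarrow> sup_dist T y q < d1 \<Longrightarrow> dist (\<xi> q) (\<xi> y) < (\<epsilon> - \<bar>\<xi> y - p y\<bar>) / 2"
        using \<xi> y(1) g unfolding cont_wrt_def by meson
      obtain d2 where d2: "d2 > 0" "\<And>q. q \<in> cont_paths T \<Longrightarrow> sup_dist T y q < d2 \<Longrightarrow> dist (p q) (p y) < (\<epsilon> - \<bar>\<xi> y - p y\<bar>) / 2"
        using pc y(1) g unfolding cont_wrt_def by meson
      have "0 < min d1 d2" using d1 d2 by simp
      then obtain N where "sup_dist T (x (s N)) y < min d1 d2" using c by blast
      then have "sup_dist T y (x (s N)) < d1" "sup_dist T y (x (s N)) < d2" by (simp_all add: sup_dist_commute[of y])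
      then have "\<bar>\<xi> (x (s N)) - \<xi> y\<bar> < (\<epsilon> - \<bar>\<xi> y - p y\<bar>) / 2" "\<bar>p (x (s N)) - p y\<bar> < (\<epsilon> - \<bar>\<xi> y - p y\<bar>) / 2"
        using d1(2)[OF xc] d2(2)[OF xc] by (simp_all add: dist_real_def)
      moreover have "\<epsilon> < \<bar>\<xi> (x (s N)) - p (x (s N))\<bar>" using x by blast
      ultimately show False by (auto simp: abs_if split: if_splits)
    qed
    then obtain N where N: "\<And>x. x \<in> cont_paths T \<Longrightarrow> (\<And>k i. k < N \<Longrightarrow> i < wnum (h k) \<Longrightarrow> wmax (h k) (x0 0) i (T, x) \<le> (1 / 2) ^ k) \<Longrightarrow> \<bar>\<xi> x - p x\<bar> \<le> \<epsilon>"
      by blast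
    have near: "\<bar>\<xi> x - p x\<bar> \<le> \<epsilon>" if x: "x \<in> cont_paths T" and "\<And>j. j < N \<Longrightarrow> Z j (T, x) < 1" for x
    proof (rule N[OF x])
      fix k i assume "k < N" "i < wnum (h k)"
      moreover have "(T, x) \<in> Lambda T" using x T_pos by (simp add: Lambda_def)
      ultimately show "wmax (h k) (x0 0) i (T, x) \<le> (1 / 2) ^ k" using Z1 that(2) by blast
    qed
    obtain v a b c B where v: "smooth v a b c" "\<And>q. q \<in> Lambda T \<Longrightarrow> a q + 1 / 2 * trace (c q) = 0 \<and> \<bar>v q\<bar> \<le> B"
      and vT: "\<And>x. x \<in> cont_paths T \<Longrightarrow> v (T, x) = p x" using trig_heat_solution[OF p(1)] by blast
    have S: "(2 * M + 2) * (\<Sum>j<N. Z j (t0, x0)) \<le> (2 * M + 2) * \<epsilon>" using Zsum[of N] M by (intro mult_left_mono) auto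
    have 1: "u (t0, x0) \<le> v (t0, x0) + \<epsilon> + (2 * M + 2) * (\<Sum>j<N. Z j (t0, x0))"
    proof (rule subsolution_le_heat_solution[OF sub uM _ M v _ h ZS Z0 Zl _ _ p0])
      show "\<xi> x \<le> M" "- (M + 2) \<le> v (T, x)" if "x \<in> cont_paths T" for x
        using \<xi>M[OF that] p(3)[OF that] vT[OF that] by (auto simp: abs_le_iff)
      show "\<xi> x \<le> v (T, x) + \<epsilon>" if "x \<in> cont_paths T" "\<And>j. j < N \<Longrightarrow> Z j (T, x) < 1" for x
        using near[OF that] vT[OF that(1)] by (auto simp: abs_le_iff)
    qed (use \<epsilon> in auto)
    have v': "smooth (\<lambda>p. - 1 * v p) (\<lambda>p. - 1 * a p) (\<lambda>p. - 1 *\<^sub>R b p) (\<lambda>p. - 1 *\<^sub>R c p)" by (rule smooth_scale[OF v(1)])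
    have v'': "- 1 * a q + 1 / 2 * trace (- 1 *\<^sub>R c q) = 0 \<and> \<bar>- 1 * v q\<bar> \<le> B" if "q \<in> Lambda T" for q
    proof -
      have "trace (- 1 *\<^sub>R c q) = - trace (c q)" by (simp add: trace_def sum_negf)
      then show ?thesis using v(2)[OF that] by simp
    qed
    have 2: "- w (t0, x0) \<le> - 1 * v (t0, x0) + \<epsilon> + (2 * M + 2) * (\<Sum>j<N. Z j (t0, x0))"
    proof (rule subsolution_le_heat_solution[OF supersolution_uminus[OF sup] wM _ M v' v'' _ h ZS Z0 Zl _ _ p0])
      show "- \<xi> x \<le> M" "- (M + 2) \<le> - 1 * v (T, x)" if "x \<in> cont_paths T" for x
        using \<xi>M[OF that] p(3)[OF that] vT[OF that] by (auto simp: abs_le_iff)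
      show "- \<xi> x \<le> - 1 * v (T, x) + \<epsilon>" if "x \<in> cont_paths T" "\<And>j. j < N \<Longrightarrow> Z j (T, x) < 1" for x
        using near[OF that] vT[OF that(1)] by (auto simp: abs_le_iff)
    qed (use \<epsilon> in auto)
    have "(4 * M + 6) * \<epsilon> = 2 * \<epsilon> + 2 * ((2 * M + 2) * \<epsilon>)" by (simp add: algebra_simps)
    then show ?thesis using 1 2 S by linarith
  qed
  have "u (t0, x0) - w (t0, x0) \<le> 0 + e" if e: "0 < e" for e
  proof -
    have "0 < e / (4 * M + 6)" using e M by simp
    from main[OF this] show ?thesis using M by simp
  qed
  then have "u (t0, x0) - w (t0, x0) \<le> 0" by (rule field_le_epsilon)
  then show ?thesis by simp
qed

end

theorem theorem4p2:
  fixes T :: real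
    and \<xi> :: "('n::finite) path \<Rightarrow> real"
    and u w :: "real \<times> 'n path \<Rightarrow> real"
  assumes "T > 0"
    and "cont_wrt (sup_dist T) (cont_paths T) \<xi>"
    and "bounded (\<xi> ` cont_paths T)"
    and "usc_wrt (d_inf T) (Lambda T) u"
    and "lsc_wrt (d_inf T) (Lambda T) w"
    and "bdd_above (u ` Lambda T)"
    and "bdd_below (w ` Lambda T)"
    and "viscosity_subsolution T \<xi> u"
    and "viscosity_supersolution T \<xi> w"
  shows "\<forall>p\<in>Lambda T. u p \<le> w p"
proof
  fix p :: "real \<times> 'n path" assume p: "p \<in> Lambda T"
  interpret horizon T by unfold_locales (rule assms(1))
  show "u p \<le> w p"
    using subsolution_le_supersolution[OF assms(2,3,6-9), of "fst p" "snd p"] p by simp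
qed

end
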